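(* Let $(\boldsymbol\omega,\mathbf A)\in\Omega\times\mathcal B^{\mathbb C}$ with $\boldsymbol\omega=(P,Q,W)$, $\mathbf A=[A\,|\,B]$. For every eigenvalue of the Sturm–Liouville problem $(\boldsymbol\omega,\mathbf A)$, its analytic, algebraic and geometric multiplicities are equal.
   Context: Let $d\ge2$ and $[a,b]$ compact. $\Omega$ is the set of triples $(P,Q,W)$ of $d\times d$ real symmetric matrix-valued functions in $L^\infty([a,b],\mathbb R^{d\times d})$ with $P(t)\ge\mu_1I_d$, $W(t)\ge\mu_2I_d$ a.e. for some $\mu_1,\mu_2>0$. $\mathcal B^{\mathbb C}$ is the set of classes $[A\,|\,B]$ of complex $2d\times4d$ matrices $(A\,|\,B)$ with $\operatorname{rank}(A\,|\,B)=2d$ and $AB^*=BA^*$, modulo $(A\,|\,B)\sim(TA\,|\,TB)$, $T\in GL(2d,\mathbb C)$. The boundary condition is $(A\,|\,B)Y(a,b)=0$ with $Y(a,b)=(-y(a)^T,y(b)^T,(Py')(a)^T,(Py')(b)^T)^T$. Let $L^2_W([a,b],\mathbb C^d)$ be the space with inner product $\langle y,z\rangle_W=\int_a^b z^*Wy\,dt$. The operator is $T y=W^{-1}(-(Py')'+Qy)$ on $D_{\mathbf A}=\{y\in L^2_W: y,Py'\text{ absolutely continuous}, Ty\in L^2_W, y\text{ satisfies the boundary condition}\}$; it is self-adjoint and $\lambda$ is an eigenvalue iff $\lambda$ is a zero of $\Gamma(\lambda)=\det(A\Phi_\lambda+B\Psi_\lambda)$, where $\phi_{1,\lambda},\dots,\phi_{2d,\lambda}$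 are the solutions of $-(Py')'+Qy=\lambda Wy$ whose initial data $(\phi_{j,\lambda}(a),(P\phi'_{j,\lambda})(a))$ form the columns of $I_{2d}$, $\Phi_\lambda$ has $j$-th column $(-\phi_{j,\lambda}(a)^T,\phi_{j,\lambda}(b)^T)^T$ and $\Psi_\lambda$ has $j$-th column $((P\phi'_{j,\lambda})(a)^T,(P\phi'_{j,\lambda})(b)^T)^T$. The analytic multiplicity of an eigenvalue $\lambda$ is its order as a zero of $\Gamma$; the geometric multiplicity is the number of linearly independent eigenfunctions; the algebraic multiplicity is $\dim\{y\in L^2_W: (T-\lambda)^ky=0\text{ for some integer }k\ge1\}$. *)

theory Defs
  imports "HOL-Analysis.Analysis" "HOL-Library.Extended_Nat"
begin

definition abs_cont_on :: "real \<Rightarrow> real \<Rightarrow> (real \<Rightarrow> 'v::real_normed_vector) \<Rightarrow> bool" where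
  "abs_cont_on a b f \<longleftrightarrow>
     (\<forall>\<epsilon>>0. \<exists>\<delta>>0. \<forall>I. finite I \<and> I \<subseteq> {(s,t). a \<le> s \<and> s \<le> t \<and> t \<le> b} \<and>
        (\<forall>p\<in>I. \<forall>q\<in>I. p \<noteq> q \<longrightarrow> {fst p<..<snd p} \<inter> {fst q<..<snd q} = {}) \<and>
        (\<Sum>p\<in>I. snd p - fst p) < \<delta> \<longrightarrow> (\<Sum>p\<in>I. norm (f (snd p) - f (fst p))) < \<epsilon>)"

definition cmat :: "real^'n::finite^'m \<Rightarrow> complex^'n^'m" where
  "cmat M = (\<chi> i j. complex_of_real (M $ i $ j))"

definition adjoint_mat :: "complex^'n::finite^'m \<Rightarrow> complex^'m^'n" where
  "adjoint_mat M = (\<chi> i j. cnj (M $ j $ i))"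

definition Linf_on :: "real \<Rightarrow> real \<Rightarrow> (real \<Rightarrow> real^'n::finite^'n) \<Rightarrow> bool" where
  "Linf_on a b M \<longleftrightarrow> M \<in> borel_measurable (lebesgue_on {a..b}) \<and>
     (\<exists>C. AE t in lebesgue_on {a..b}. norm (M t) \<le> C)"

definition Omega :: "real \<Rightarrow> real \<Rightarrow> (real \<Rightarrow> real^'n::finite^'n) \<Rightarrow> (real \<Rightarrow> real^'n^'n) \<Rightarrow> (real \<Rightarrow> real^'n^'n) \<Rightarrow> bool" where
  "Omega a b P Q W \<longleftrightarrow>
     Linf_on a b P \<and> Linf_on a b Q \<and> Linf_on a b W \<and>
     (AE t in lebesgue_on {a..b}. transpose (P t) = P t \<and> transpose (Q t) = Q t \<and> transpose (W t) = W t) \<and>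
     (\<exists>\<mu>1>0. AE t in lebesgue_on {a..b}. \<forall>v. \<mu>1 * (v \<bullet> v) \<le> v \<bullet> (P t *v v)) \<and>
     (\<exists>\<mu>2>0. AE t in lebesgue_on {a..b}. \<forall>v. \<mu>2 * (v \<bullet> v) \<le> v \<bullet> (W t *v v))"

text \<open>Self-adjoint boundary conditions: (A|B) has rank 2d and A B^* = B A^*.\<close>
definition sa_bc :: "complex^('n::finite+'n)^('n+'n) \<Rightarrow> complex^('n+'n)^('n+'n) \<Rightarrow> bool" where
  "sa_bc A B \<longleftrightarrow>
     (\<forall>v. v v* A = 0 \<and> v v* B = 0 \<longrightarrow> v = 0) \<and>
     A ** adjoint_mat B = B ** adjoint_mat A"

definition bvec_neg :: "real \<Rightarrow> real \<Rightarrow> (real \<Rightarrow> complex^'n::finite) \<Rightarrow> complex^('n+'n)" where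
  "bvec_neg a b y = (\<chi> i. case i of Inl k \<Rightarrow> - (y a $ k) | Inr k \<Rightarrow> y b $ k)"
definition bvec :: "real \<Rightarrow> real \<Rightarrow> (real \<Rightarrow> complex^'n::finite) \<Rightarrow> complex^('n+'n)" where
  "bvec a b y = (\<chi> i. case i of Inl k \<Rightarrow> y a $ k | Inr k \<Rightarrow> y b $ k)"

definition quasi_pair :: "real \<Rightarrow> real \<Rightarrow> (real \<Rightarrow> real^'n::finite^'n) \<Rightarrow> (real \<Rightarrow> complex^'n) \<Rightarrow> (real \<Rightarrow> complex^'n) \<Rightarrow> bool" where
  "quasi_pair a b P y y1 \<longleftrightarrow> abs_cont_on a b y \<and> abs_cont_on a b y1 \<and>
     (AE t in lebesgue_on {a..b}. y differentiable (at t) \<and> y1 t = cmat (P t) *v vector_derivative y (at t))"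

definition sl_sol :: "real \<Rightarrow> real \<Rightarrow> (real \<Rightarrow> real^'n::finite^'n) \<Rightarrow> (real \<Rightarrow> real^'n^'n) \<Rightarrow> (real \<Rightarrow> real^'n^'n) \<Rightarrow> complex \<Rightarrow> (real \<Rightarrow> complex^'n) \<Rightarrow> (real \<Rightarrow> complex^'n) \<Rightarrow> bool" where
  "sl_sol a b P Q W lam y y1 \<longleftrightarrow> quasi_pair a b P y y1 \<and>
     (AE t in lebesgue_on {a..b}. y1 differentiable (at t) \<and>
        - vector_derivative y1 (at t) + cmat (Q t) *v y t = lam *s (cmat (W t) *v y t))"

text \<open>Fundamental solutions \<phi>_j with initial data (\<phi>_j(a), (P\<phi>_j')(a)) = j-th unit vector of C^{2d};
  indices Inl k refer to the y(a)-components and Inr k to the (Py')(a)-components.\<close>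
definition fund_sol :: "real \<Rightarrow> real \<Rightarrow> (real \<Rightarrow> real^'n::finite^'n) \<Rightarrow> (real \<Rightarrow> real^'n^'n) \<Rightarrow> (real \<Rightarrow> real^'n^'n) \<Rightarrow> complex \<Rightarrow> ('n+'n) \<Rightarrow> (real \<Rightarrow> complex^'n) \<times> (real \<Rightarrow> complex^'n)" where
  "fund_sol a b P Q W lam j = (SOME p. sl_sol a b P Q W lam (fst p) (snd p) \<and>
      (\<forall>k. fst p a $ k = (if j = Inl k then 1 else 0) \<and> snd p a $ k = (if j = Inr k then 1 else 0)))"

definition Phi_mat :: "real \<Rightarrow> real \<Rightarrow> (real \<Rightarrow> real^'n::finite^'n) \<Rightarrow> (real \<Rightarrow> real^'n^'n) \<Rightarrow> (real \<Rightarrow> real^'n^'n) \<Rightarrow> complex \<Rightarrow> complex^('n+'n)^('n+'n)" where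
  "Phi_mat a b P Q W lam = (\<chi> i j. bvec_neg a b (fst (fund_sol a b P Q W lam j)) $ i)"

definition Psi_mat :: "real \<Rightarrow> real \<Rightarrow> (real \<Rightarrow> real^'n::finite^'n) \<Rightarrow> (real \<Rightarrow> real^'n^'n) \<Rightarrow> (real \<Rightarrow> real^'n^'n) \<Rightarrow> complex \<Rightarrow> complex^('n+'n)^('n+'n)" where
  "Psi_mat a b P Q W lam = (\<chi> i j. bvec a b (snd (fund_sol a b P Q W lam j)) $ i)"

definition Gamma_char :: "real \<Rightarrow> real \<Rightarrow> (real \<Rightarrow> real^'n::finite^'n) \<Rightarrow> (real \<Rightarrow> real^'n^'n) \<Rightarrow> (real \<Rightarrow> real^'n^'n) \<Rightarrow> complex^('n+'n)^('n+'n) \<Rightarrow> complex^('n+'n)^('n+'n) \<Rightarrow> complex \<Rightarrow> complex" where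
  "Gamma_char a b P Q W A B lam = det (A ** Phi_mat a b P Q W lam + B ** Psi_mat a b P Q W lam)"

definition L2W :: "real \<Rightarrow> real \<Rightarrow> (real \<Rightarrow> real^'n::finite^'n) \<Rightarrow> (real \<Rightarrow> complex^'n) \<Rightarrow> bool" where
  "L2W a b W z \<longleftrightarrow> z \<in> borel_measurable (lebesgue_on {a..b}) \<and>
     integrable (lebesgue_on {a..b}) (\<lambda>t. Re (\<Sum>i\<in>UNIV. cnj (z t $ i) * (cmat (W t) *v z t) $ i))"

text \<open>T_graph y z: y \<in> D_A and T y = z (as elements of L^2_W, i.e. a.e.).\<close>
definition T_graph :: "real \<Rightarrow> real \<Rightarrow> (real \<Rightarrow> real^'n::finite^'n) \<Rightarrow> (real \<Rightarrow> real^'n^'n) \<Rightarrow> (real \<Rightarrow> real^'n^'n) \<Rightarrow> complex^('n+'n)^('n+'n) \<Rightarrow> complex^('n+'n)^('n+'n) \<Rightarrow> (real \<Rightarrow> complex^'n) \<Rightarrow> (real \<Rightarrow> complex^'n) \<Rightarrow> bool" where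
  "T_graph a b P Q W A B y z \<longleftrightarrow> L2W a b W y \<and> L2W a b W z \<and>
     (\<exists>y1. quasi_pair a b P y y1 \<and>
        (AE t in lebesgue_on {a..b}. y1 differentiable (at t) \<and>
           cmat (W t) *v z t = - vector_derivative y1 (at t) + cmat (Q t) *v y t) \<and>
        A *v bvec_neg a b y + B *v bvec a b y1 = 0)"

definition is_eigenvalue where
  "is_eigenvalue a b P Q W A B lam \<longleftrightarrow>
     (\<exists>y. T_graph a b P Q W A B y (\<lambda>t. lam *s y t) \<and> \<not> (AE t in lebesgue_on {a..b}. y t = 0))"

text \<open>Eigenspace ker(T - \<lambda>) and root space \<Union>_k ker (T - \<lambda>)^k.\<close>
definition eigenspace_T where
  "eigenspace_T a b P Q W A B lam = {y. T_graph a b P Q W A B y (\<lambda>t. lam *s y t)}"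

definition root_space_T where
  "root_space_T a b P Q W A B lam = {y. \<exists>k::nat. k \<ge> 1 \<and> (\<exists>z::nat \<Rightarrow> real \<Rightarrow> complex^'n. z 0 = y \<and>
      (\<forall>j<k. T_graph a b P Q W A B (z j) (\<lambda>t. z (Suc j) t + lam *s z j t)) \<and>
      (AE t in lebesgue_on {a..b}. z k t = 0))}"

definition lin_indep_L2 :: "real \<Rightarrow> real \<Rightarrow> (real \<Rightarrow> complex^'n::finite) set \<Rightarrow> bool" where
  "lin_indep_L2 a b F \<longleftrightarrow> finite F \<and>
     (\<forall>c. (AE t in lebesgue_on {a..b}. (\<Sum>f\<in>F. c f *s f t) = 0) \<longrightarrow> (\<forall>f\<in>F. c f = 0))"

definition dim_L2 :: "real \<Rightarrow> real \<Rightarrow> (real \<Rightarrow> complex^'n::finite) set \<Rightarrow> enat" where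
  "dim_L2 a b S = (SUP F\<in>{F. F \<subseteq> S \<and> lin_indep_L2 a b F}. enat (card F))"

definition zero_order :: "(complex \<Rightarrow> complex) \<Rightarrow> complex \<Rightarrow> nat \<Rightarrow> bool" where
  "zero_order f z m \<longleftrightarrow> (\<forall>j<m. (deriv ^^ j) f z = 0) \<and> (deriv ^^ m) f z \<noteq> 0"

end

theory Submission
  imports Defs "HOL-Complex_Analysis.Complex_Analysis"
begin

no_notation fps_nth (infixl "$" 75)

text \<open>The kernel of the characteristic matrix \<open>D(\<lambda>) = A \<Phi>\<^sub>\<lambda> + B \<Psi>\<^sub>\<lambda>\<close> is isomorphic to the eigenspace at
  \<open>\<lambda>\<close>. In a basis of \<open>\<complex>\<^sup>2\<^sup>d\<close> that extends a basis of this kernel, \<open>m\<close> columns of \<open>D\<close> are divisible by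
  the linear factor at the eigenvalue, so \<open>det D\<close> vanishes to order at least \<open>m\<close>, and to order exactly \<open>m\<close> unless
  \<open>D' u + D v = 0\<close> for some \<open>v\<close> and some nonzero \<open>u\<close> in the kernel. Because \<open>D'\<close> is given by the
  \<open>\<lambda>\<close>-derivatives of the fundamental solutions, such a pair is a Jordan chain: \<open>(T - \<lambda>) y = z\<close> with \<open>z\<close> an
  eigenfunction. Green's formula excludes it, since \<open>\<langle>z, z\<rangle> = \<langle>(T - \<lambda>) y, z\<rangle> = \<langle>y, (T - \<lambda>) z\<rangle> = 0\<close> for
  real \<open>\<lambda>\<close>. The same computation makes the root space equal to the eigenspace.\<close>

text \<open>The coefficients are only bounded and measurable, so equations hold a.e. and regularity
  is available only for the pair (y, Py'), both halves of which are absolutely continuous. The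
  fundamental theorem of calculus for such functions is therefore used twice: for the Gronwall
  bounds behind uniqueness and the parameter derivative, and for Green's formula. In the first order
  system for the pair the matrix is affine in \<lambda>. With data at \<open>a\<close> fixed, the
  \<lambda>-derivative of a solution solves the same system with zero data and a forcing -W y in the
  lower half; that forcing is what makes it a link of a Jordan chain. The boundary terms in Green's
  formula vanish because the kernel of the boundary map is parametrised by the adjoints of
  \<open>A\<close> and \<open>B\<close>. Dimensions are taken modulo null sets, boundary values
  pointwise. Continuity reconciles the two on [a,b], and y = 0 forces Py' = 0, so a solution can be
  recovered from y alone.\<close>

subsection \<open>Absolutely continuous functions\<close>

text \<open>The gauge is given by differentiability off the exceptional null set \<open>N\<close>; at tags in \<open>N\<close> it is an open
  superset of \<open>N\<close> of measure below the \<open>\<delta>\<close> of absolute continuity.\<close>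

lemma abs_cont_has_integral_deriv:
  fixes f :: "real \<Rightarrow> 'v::banach"
  assumes "a \<le> b" and ac: "abs_cont_on a b f"
    and der: "AE t in lebesgue_on {a..b}. (f has_vector_derivative g t) (at t)"
  shows "(g has_integral (f b - f a)) {a..b}"
proof (cases "a = b")
  case True
  then show ?thesis by (simp add: has_integral_refl)
next
  case False
  with \<open>a \<le> b\<close> have "a < b" by simp
  have "AE t in lebesgue. t \<in> {a..b} \<longrightarrow> (f has_vector_derivative g t) (at t)"
    using der by (simp add: AE_restrict_space_iff)
  then obtain N where N: "negligible N" and "{t. \<not> (t \<in> {a..b} \<longrightarrow> (f has_vector_derivative g t) (at t))} \<subseteq> N"
    unfolding eventually_ae_filter negligible_iff_null_sets by auto
  then have dN: "(f has_vector_derivative g t) (at t)" if "t \<in> {a..b}" "t \<notin> N" for t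
    using that by blast
  \<comment> \<open>\<open>h\<close> differs from \<open>g\<close> only on the null set
    \<open>N\<close>, so it has the same integral; vanishing there removes the Riemann terms at tags
    in \<open>N\<close>, where nothing is known about \<open>g\<close>.\<close>
  define h where "h = (\<lambda>t. if t \<in> N then 0 else g t)"
  have "(h has_integral (f b - f a)) {a..b}"
    unfolding has_integral_factor_content_real
  proof (intro allI impI)
    fix e :: real assume "e > 0"
    with \<open>a < b\<close> have e2: "e / 2 * (b - a) > 0" by simp
    obtain \<delta> where "\<delta> > 0" and \<delta>: "\<forall>I. finite I \<and> I \<subseteq> {(s,t). a \<le> s \<and> s \<le> t \<and> t \<le> b} \<and>
        (\<forall>p\<in>I. \<forall>q\<in>I. p \<noteq> q \<longrightarrow> {fst p<..<snd p} \<inter> {fst q<..<snd q} = {}) \<and>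
        (\<Sum>p\<in>I. snd p - fst p) < \<delta> \<longrightarrow> (\<Sum>p\<in>I. norm (f (snd p) - f (fst p))) < e / 2 * (b - a)"
      using ac[unfolded abs_cont_on_def, rule_format, OF e2] by blast
    have N0: "N \<in> null_sets lebesgue" using N by (simp add: negligible_iff_null_sets)
    obtain T where T: "open T" "N \<subseteq> T" "T - N \<in> lmeasurable" "emeasure lebesgue (T - N) < ennreal \<delta>"
      using sets_lebesgue_outer_open[of N \<delta>] N0 \<open>\<delta> > 0\<close> by blast
    have "T = (T - N) \<union> N" using T(2) by blast
    moreover have "N \<in> lmeasurable" using N by (simp add: negligible_imp_measurable)
    ultimately have Tm: "T \<in> lmeasurable" using T(3) by (metis fmeasurable.Un)
    have "emeasure lebesgue T = emeasure lebesgue (T - N)"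
      by (metis N0 Tm emeasure_Diff_null_set fmeasurableD)
    then have mT: "measure lebesgue T < \<delta>"
      using T(4) by (smt (verit, best) \<open>0 < \<delta>\<close> Tm emeasure_eq_measure2 ennreal_less_iff measure_nonneg)
    have "\<exists>r>0. \<forall>y. norm (y - x) < r \<longrightarrow> norm (f y - f x - (y - x) *\<^sub>R g x) \<le> e / 2 * norm (y - x)"
      if "x \<in> {a..b} - N" for x
    proof -
      have "(f has_derivative (\<lambda>h. h *\<^sub>R g x)) (at x)"
        using dN that unfolding has_vector_derivative_def by blast
      then show ?thesis using \<open>e > 0\<close> unfolding has_derivative_at_alt by (meson half_gt_zero)
    qed
    then obtain r where r: "\<And>x. x \<in> {a..b} - N \<Longrightarrow> r x > 0"
       "\<And>x y. \<lbrakk>x \<in> {a..b} - N; norm (y - x) < r x\<rbrakk> \<Longrightarrow> norm (f y - f x - (y - x) *\<^sub>R g x) \<le> e / 2 * norm (y - x)"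
      by metis
    define d where "d = (\<lambda>x. if x \<in> N then T else if x \<in> {a..b} then ball x (r x) else UNIV)"
    have "gauge d" unfolding gauge_def d_def using T r(1) by auto
    moreover have "norm (sum (\<lambda>(x,k). measure lborel k *\<^sub>R h x) p - (f b - f a)) \<le> e * measure lborel {a..b}"
      if p: "p tagged_division_of {a..b}" and fine: "d fine p" for p
    proof -
      note pD = tagged_division_ofD[OF p]
      have fin: "finite p" by (rule pD(1))
      have K: "\<exists>u v. K = {u..v} \<and> u \<le> x \<and> x \<le> v \<and> a \<le> u \<and> v \<le> b \<and> Inf K = u \<and> Sup K = v"
        if xK: "(x, K) \<in> p" for x K
      proof -
        obtain u v where uv: "K = {u..v}" using pD(4)[OF xK] by (metis cbox_interval)
        moreover have "u \<le> x" "x \<le> v" using pD(2)[OF xK] uv by auto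
        moreover have "a \<le> u" "v \<le> b" using pD(3)[OF xK] uv calculation by auto
        ultimately show ?thesis by (metis interval_bounds_real order_trans)
      qed
      have ba: "b - a = (\<Sum>(x,K)\<in>p. Sup K - Inf K)" "f b - f a = (\<Sum>(x,K)\<in>p. f(Sup K) - f(Inf K))"
        using additive_tagged_division_1[where f= "\<lambda>x. x"] additive_tagged_division_1[where f= f]
            \<open>a \<le> b\<close> p by auto
      \<comment> \<open>Tags outside \<open>N\<close> obey the straddle estimate of
        differentiability, with total error \<open>e / 2 * (b - a)\<close>. At tags in
        \<open>N\<close> only the increments of \<open>f\<close> remain, and absolute continuity
        makes them as small.\<close>
      define q where "q = {(x,K) \<in> p. x \<in> N}"
      have q: "q \<subseteq> p" "finite q" using fin unfolding q_def by (auto intro: finite_subset)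
      have "sum (\<lambda>(x,k). measure lborel k *\<^sub>R h x) p - (f b - f a)
          = (\<Sum>(x,k)\<in>p. measure lborel k *\<^sub>R h x - (f (Sup k) - f (Inf k)))"
        unfolding ba by (simp add: sum_subtractf case_prod_unfold)
      also have "\<dots> = (\<Sum>(x,k)\<in>p - q. measure lborel k *\<^sub>R h x - (f (Sup k) - f (Inf k)))
                   + (\<Sum>(x,k)\<in>q. measure lborel k *\<^sub>R h x - (f (Sup k) - f (Inf k)))"
        using sum.subset_diff[OF q(1) fin] .
      finally have eq: "sum (\<lambda>(x,k). measure lborel k *\<^sub>R h x) p - (f b - f a) = \<dots>" .
      have "norm (\<Sum>(x,k)\<in>p - q. measure lborel k *\<^sub>R h x - (f (Sup k) - f (Inf k)))
          \<le> (\<Sum>z\<in>p - q. e / 2 * (case z of (x,k) \<Rightarrow> Sup k - Inf k))"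
      proof (rule sum_norm_le, safe)
        fix x k assume xk: "(x, k) \<in> p" "(x, k) \<notin> q"
        then have xN: "x \<notin> N" unfolding q_def by auto
        obtain u v where uv: "k = {u..v}" "u \<le> x" "x \<le> v" "a \<le> u" "v \<le> b" "Inf k = u" "Sup k = v"
          using K[OF xk(1)] by blast
        have xab: "x \<in> {a..b} - N" using uv xN by auto
        have "k \<subseteq> ball x (r x)" using fine xk(1) xab unfolding fine_def d_def by fastforce
        moreover have "u \<in> k" "v \<in> k" using uv by auto
        ultimately have ux: "norm (u - x) < r x" "norm (v - x) < r x" by (auto simp: dist_real_def)
        have "measure lborel k *\<^sub>R h x - (f v - f u) =
           (f u - f x - (u - x) *\<^sub>R g x) - (f v - f x - (v - x) *\<^sub>R g x)"
          using uv xN by (simp add: h_def algebra_simps)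
        then have "norm (measure lborel k *\<^sub>R h x - (f v - f u)) \<le>
           norm (f u - f x - (u - x) *\<^sub>R g x) + norm (f v - f x - (v - x) *\<^sub>R g x)"
          by (metis norm_triangle_ineq4)
        also have "\<dots> \<le> e / 2 * norm (u - x) + e / 2 * norm (v - x)"
          using r(2)[OF xab ux(1)] r(2)[OF xab ux(2)] by linarith
        also have "\<dots> = e / 2 * (v - u)" using uv by (simp add: field_simps)
        finally show "norm (measure lborel k *\<^sub>R h x - (f (Sup k) - f (Inf k))) \<le> e / 2 * (Sup k - Inf k)"
          using uv by simp
      qed
      also have "\<dots> \<le> (\<Sum>z\<in>p. e / 2 * (case z of (x,k) \<Rightarrow> Sup k - Inf k))"
      proof (rule sum_mono2[OF fin])
        fix z assume "z \<in> p - (p - q)"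
        then have "(fst z, snd z) \<in> p" by auto
        from K[OF this] show "0 \<le> e / 2 * (case z of (x, k) \<Rightarrow> Sup k - Inf k)"
          using \<open>e > 0\<close> by (auto simp: case_prod_unfold)
      qed auto
      also have "\<dots> = e / 2 * (b - a)" unfolding ba(1) sum_distrib_left ..
      finally have 1: "norm (\<Sum>(x,k)\<in>p - q. measure lborel k *\<^sub>R h x - (f (Sup k) - f (Inf k))) \<le> e / 2 * (b - a)" .
      \<comment> \<open>Degenerate intervals contribute no increment and are dropped. Positive
        length makes \<open>J\<close> injective, since equal intervals with disjoint interiors would
        be empty inside.\<close>
      define q' where "q' = {(x,K) \<in> q. Inf K < Sup K}"
      have q': "q' \<subseteq> q" "finite q'" "q' \<subseteq> p" using q unfolding q'_def by (auto intro: finite_subset)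
      define J where "J = (\<lambda>(x::real,K::real set). (Inf K, Sup K))"
      have disj: "{fst (J z)<..<snd (J z)} \<inter> {fst (J w)<..<snd (J w)} = {}"
        if zw': "z \<in> q'" "w \<in> q'" "z \<noteq> w" for z w
      proof -
        obtain x k y l where zw: "z = (x,k)" "w = (y,l)" by (meson surj_pair)
        have "interior k \<inter> interior l = {}" using pD(5) zw' zw q' by blast
        moreover obtain u v where "k = {u..v}" "Inf k = u" "Sup k = v" using K zw zw' q' by blast
        moreover obtain u' v' where "l = {u'..v'}" "Inf l = u'" "Sup l = v'" using K zw zw' q' by blast
        ultimately show ?thesis unfolding J_def zw by simp
      qed
      have inj: "inj_on J q'"
      proof (rule inj_onI, rule ccontr)
        fix z w assume zw: "z \<in> q'" "w \<in> q'" "J z = J w" "z \<noteq> w"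
        have "fst (J z) < snd (J z)" using zw(1) unfolding q'_def J_def by auto
        with disj[OF zw(1,2,4)] zw(3) show False by simp
      qed
      \<comment> \<open>Fineness puts every interval with a tag in \<open>N\<close> inside
        \<open>T\<close>, so the total length is at most the measure of \<open>T\<close>.\<close>
      have sum_len: "(\<Sum>z\<in>q'. snd (J z) - fst (J z)) < \<delta>"
      proof -
        have tp: "q' tagged_partial_division_of {a..b}"
          using tagged_partial_division_subset[OF _ q'(3)] p unfolding tagged_division_of_def by blast
        have div: "snd ` q' division_of \<Union>(snd ` q')"
          using partial_division_of_tagged_division[OF tp] .
        have inj2: "inj_on snd q'"
          using inj unfolding inj_on_def J_def by (auto simp: case_prod_unfold)
        have "(\<Sum>z\<in>q'. snd (J z) - fst (J z)) = (\<Sum>z\<in>q'. measure lebesgue (snd z))"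
        proof (rule sum.cong)
          fix z assume "z \<in> q'"
          then have "(fst z, snd z) \<in> p" using q' by auto
          from K[OF this] obtain u v where "snd z = {u..v}" "u \<le> v" "Inf (snd z) = u" "Sup (snd z) = v"
            by force
          then show "snd (J z) - fst (J z) = measure lebesgue (snd z)"
            unfolding J_def by (simp add: case_prod_unfold)
        qed simp
        also have "\<dots> = (\<Sum>k\<in>snd ` q'. measure lebesgue k)"
          by (simp add: sum.reindex[OF inj2])
        also have "\<dots> = measure lebesgue (\<Union>(snd ` q'))"
          by (rule content_division[OF div])
        also have "\<dots> \<le> measure lebesgue T"
        proof (rule measure_mono_fmeasurable[OF _ _ Tm])
          show "\<Union> (snd ` q') \<subseteq> T"
            using fine q' unfolding fine_def d_def q_def by fastforce
          show "\<Union> (snd ` q') \<in> sets lebesgue"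
            using div lmeasurable_division by blast
        qed
        finally show ?thesis using mT by linarith
      qed
      have "norm (\<Sum>(x,k)\<in>q. measure lborel k *\<^sub>R h x - (f (Sup k) - f (Inf k)))
         \<le> (\<Sum>z\<in>q. norm (f (snd (J z)) - f (fst (J z))))"
      proof (rule sum_norm_le, safe)
        fix x k assume "(x, k) \<in> q"
        then have "h x = 0" unfolding q_def h_def by auto
        then show "norm (measure lborel k *\<^sub>R h x - (f (Sup k) - f (Inf k)))
            \<le> norm (f (snd (J (x, k))) - f (fst (J (x, k))))"
          unfolding J_def by (simp add: norm_minus_commute)
      qed
      also have "\<dots> = (\<Sum>z\<in>q'. norm (f (snd (J z)) - f (fst (J z))))"
      proof (rule sum.mono_neutral_right[OF q(2) q'(1)], safe)
        fix x k assume xk: "(x, k) \<in> q" "(x, k) \<notin> q'"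
        then have "(x, k) \<in> p" using q by auto
        from K[OF this] xk have "Inf k = Sup k" unfolding q'_def by force
        then show "norm (f (snd (J (x, k))) - f (fst (J (x, k)))) = 0"
          unfolding J_def by simp
      qed
      also have "\<dots> = (\<Sum>z\<in>J ` q'. norm (f (snd z) - f (fst z)))"
        by (simp add: sum.reindex[OF inj])
      also have "\<dots> < e / 2 * (b - a)"
      proof (rule \<delta>[rule_format], intro conjI ballI impI)
        show "finite (J ` q')" using q' by auto
        show "J ` q' \<subseteq> {(s, t). a \<le> s \<and> s \<le> t \<and> t \<le> b}"
        proof
          fix z assume "z \<in> J ` q'"
          then obtain x k where "(x,k) \<in> p" "z = (Inf k, Sup k)" unfolding J_def using q' by auto
          with K[of x k] show "z \<in> {(s, t). a \<le> s \<and> s \<le> t \<and> t \<le> b}" by auto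
        qed
        show "{fst z<..<snd z} \<inter> {fst w<..<snd w} = {}" if "z \<in> J ` q'" "w \<in> J ` q'" "z \<noteq> w" for z w
          using that disj by blast
        show "(\<Sum>p\<in>J ` q'. snd p - fst p) < \<delta>"
          using sum_len by (simp add: sum.reindex[OF inj])
      qed
      finally have 2: "norm (\<Sum>(x,k)\<in>q. measure lborel k *\<^sub>R h x - (f (Sup k) - f (Inf k))) < e / 2 * (b - a)" .
      show ?thesis unfolding eq using 1 2 \<open>a \<le> b\<close>
        by (intro order_trans[OF norm_triangle_ineq]) (simp add: field_simps)
    qed
    ultimately show "\<exists>d. gauge d \<and> (\<forall>p. p tagged_division_of {a..b} \<and> d fine p \<longrightarrow>
       norm (sum (\<lambda>(x,k). measure lborel k *\<^sub>R h x) p - (f b - f a)) \<le> e * measure lborel {a..b})"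
      by (intro exI[of _ d]) simp
  qed
  then show ?thesis
    by (rule has_integral_spike[OF N, rotated]) (simp add: h_def)
qed

lemma AE_lebesgue_on_interval_iff:
  "(AE t in lebesgue_on {a..b::real}. P t) \<longleftrightarrow> (\<exists>N. negligible N \<and> (\<forall>t\<in>{a..b} - N. P t))"
proof -
  have "(AE t in lebesgue_on {a..b}. P t) \<longleftrightarrow> (AE t in lebesgue. t \<in> {a..b} \<longrightarrow> P t)"
    by (simp add: AE_restrict_space_iff)
  also have "\<dots> \<longleftrightarrow> (\<exists>N. negligible N \<and> {t. \<not> (t \<in> {a..b} \<longrightarrow> P t)} \<subseteq> N)"
    unfolding eventually_ae_filter negligible_iff_null_sets by auto
  also have "\<dots> \<longleftrightarrow> (\<exists>N. negligible N \<and> (\<forall>t\<in>{a..b} - N. P t))"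
    by blast
  finally show ?thesis .
qed

lemma AE_lebesgue_on_subinterval:
  assumes "AE t in lebesgue_on {a..b::real}. P t" "a \<le> c" "d \<le> b"
  shows "AE t in lebesgue_on {c..d}. P t"
  using assms unfolding AE_lebesgue_on_interval_iff by fastforce

lemma has_integral_AE_cong:
  fixes f g :: "real \<Rightarrow> 'v::banach"
  assumes "(f has_integral I) {a..b}" "AE t in lebesgue_on {a..b}. g t = f t"
  shows "(g has_integral I) {a..b}"
  using assms has_integral_spike unfolding AE_lebesgue_on_interval_iff by metis

section \<open>Closure properties of absolute continuity\<close>

lemma abs_cont_on_subinterval:
  assumes "abs_cont_on a b f" "a \<le> c" "d \<le> b"
  shows "abs_cont_on c d f"
proof -
  have "{(s,t). c \<le> s \<and> s \<le> t \<and> t \<le> d} \<subseteq> {(s,t). a \<le> s \<and> s \<le> t \<and> t \<le> b}"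
    using assms by auto
  then show ?thesis
    using assms(1) unfolding abs_cont_on_def by (meson subset_trans)
qed

lemma abs_cont_on_imp_continuous_on:
  assumes "abs_cont_on a b f"
  shows "continuous_on {a..b} f"
  unfolding continuous_on_iff
proof (intro ballI allI impI)
  fix x e :: real assume x: "x \<in> {a..b}" and "e > 0"
  obtain \<delta> where "\<delta> > 0" and \<delta>: "\<forall>I. finite I \<and> I \<subseteq> {(s,t). a \<le> s \<and> s \<le> t \<and> t \<le> b} \<and>
        (\<forall>p\<in>I. \<forall>q\<in>I. p \<noteq> q \<longrightarrow> {fst p<..<snd p} \<inter> {fst q<..<snd q} = {}) \<and>
        (\<Sum>p\<in>I. snd p - fst p) < \<delta> \<longrightarrow> (\<Sum>p\<in>I. norm (f (snd p) - f (fst p))) < e"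
    using assms[unfolded abs_cont_on_def, rule_format, OF \<open>e > 0\<close>] by blast
  have "dist (f y) (f x) < e" if y: "y \<in> {a..b}" "dist y x < \<delta>" for y
  proof -
    have "(\<Sum>p\<in>{(min x y, max x y)}. norm (f (snd p) - f (fst p))) < e"
      by (rule \<delta>[rule_format]) (use x y in \<open>auto simp: dist_real_def\<close>)
    then show ?thesis
      by (auto simp: dist_norm min_def max_def norm_minus_commute split: if_splits)
  qed
  then show "\<exists>d>0. \<forall>x'\<in>{a..b}. dist x' x < d \<longrightarrow> dist (f x') (f x) < e"
    using \<open>\<delta> > 0\<close> by blast
qed

lemma abs_cont_on_Lipschitz:
  assumes "\<And>s t. \<lbrakk>a \<le> s; s \<le> t; t \<le> b\<rbrakk> \<Longrightarrow> norm (f t - f s) \<le> C * (t - s)"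
  shows "abs_cont_on a b f"
  unfolding abs_cont_on_def
proof (intro allI impI)
  fix e :: real assume "e > 0"
  define \<delta> where "\<delta> = e / (\<bar>C\<bar> + 1)"
  have \<delta>: "\<delta> > 0" "(\<bar>C\<bar> + 1) * \<delta> = e" using \<open>e > 0\<close> unfolding \<delta>_def by auto
  have "(\<Sum>p\<in>I. norm (f (snd p) - f (fst p))) < e"
    if I: "I \<subseteq> {(s,t). a \<le> s \<and> s \<le> t \<and> t \<le> b}" "(\<Sum>p\<in>I. snd p - fst p) < \<delta>" for I
  proof -
    have "(\<Sum>p\<in>I. norm (f (snd p) - f (fst p))) \<le> (\<Sum>p\<in>I. (\<bar>C\<bar> + 1) * (snd p - fst p))"
    proof (rule sum_mono)
      fix p assume "p \<in> I"
      with I have p: "a \<le> fst p" "fst p \<le> snd p" "snd p \<le> b" by auto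
      have "norm (f (snd p) - f (fst p)) \<le> C * (snd p - fst p)" by (rule assms[OF p])
      also have "\<dots> \<le> (\<bar>C\<bar> + 1) * (snd p - fst p)"
        by (rule mult_right_mono) (use p in auto)
      finally show "norm (f (snd p) - f (fst p)) \<le> (\<bar>C\<bar> + 1) * (snd p - fst p)" .
    qed
    also have "\<dots> = (\<bar>C\<bar> + 1) * (\<Sum>p\<in>I. snd p - fst p)" by (simp add: sum_distrib_left)
    also have "\<dots> < (\<bar>C\<bar> + 1) * \<delta>" by (rule mult_strict_left_mono[OF I(2)]) simp
    finally show ?thesis using \<delta>(2) by simp
  qed
  then show "\<exists>\<delta>>0. \<forall>I. finite I \<and> I \<subseteq> {(s,t). a \<le> s \<and> s \<le> t \<and> t \<le> b} \<and>
        (\<forall>p\<in>I. \<forall>q\<in>I. p \<noteq> q \<longrightarrow> {fst p<..<snd p} \<inter> {fst q<..<snd q} = {}) \<and>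
        (\<Sum>p\<in>I. snd p - fst p) < \<delta> \<longrightarrow> (\<Sum>p\<in>I. norm (f (snd p) - f (fst p))) < e"
    using \<delta>(1) by (intro exI[of _ \<delta>]) simp
qed

text \<open>A test family for \<open>h\<close> is also one for \<open>f\<close> and
  \<open>g\<close>, so their sums bound that of \<open>h\<close>. Linear images, sums and bilinear
  products all reduce to such an increment estimate. The factor \<open>\<bar>C\<bar> + 1\<close>
  keeps \<open>\<eta>\<close> positive whatever the sign of \<open>C\<close>.\<close>

lemma abs_cont_on_dominated:
  assumes f: "abs_cont_on a b f" and g: "abs_cont_on a b g"
    and bd: "\<And>s t. \<lbrakk>a \<le> s; s \<le> t; t \<le> b\<rbrakk> \<Longrightarrow>
       norm (h t - h s) \<le> C * norm (f t - f s) + C * norm (g t - g s)"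
  shows "abs_cont_on a b h"
  unfolding abs_cont_on_def
proof (intro allI impI)
  fix e :: real assume "e > 0"
  define \<eta> where "\<eta> = e / (\<bar>C\<bar> + 1) / 2"
  have \<eta>: "\<eta> > 0" using \<open>e > 0\<close> unfolding \<eta>_def by auto
  have "\<eta> + \<eta> = e / (\<bar>C\<bar> + 1)" unfolding \<eta>_def by (rule field_sum_of_halves)
  then have \<eta>2: "(\<bar>C\<bar> + 1) * (\<eta> + \<eta>) = e" by auto
  obtain d1 where "d1 > 0" and d1: "\<forall>I. finite I \<and> I \<subseteq> {(s,t). a \<le> s \<and> s \<le> t \<and> t \<le> b} \<and>
        (\<forall>p\<in>I. \<forall>q\<in>I. p \<noteq> q \<longrightarrow> {fst p<..<snd p} \<inter> {fst q<..<snd q} = {}) \<and>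
        (\<Sum>p\<in>I. snd p - fst p) < d1 \<longrightarrow> (\<Sum>p\<in>I. norm (f (snd p) - f (fst p))) < \<eta>"
    using f[unfolded abs_cont_on_def, rule_format, OF \<eta>] by blast
  obtain d2 where "d2 > 0" and d2: "\<forall>I. finite I \<and> I \<subseteq> {(s,t). a \<le> s \<and> s \<le> t \<and> t \<le> b} \<and>
        (\<forall>p\<in>I. \<forall>q\<in>I. p \<noteq> q \<longrightarrow> {fst p<..<snd p} \<inter> {fst q<..<snd q} = {}) \<and>
        (\<Sum>p\<in>I. snd p - fst p) < d2 \<longrightarrow> (\<Sum>p\<in>I. norm (g (snd p) - g (fst p))) < \<eta>"
    using g[unfolded abs_cont_on_def, rule_format, OF \<eta>] by blast
  have "(\<Sum>p\<in>I. norm (h (snd p) - h (fst p))) < e"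
    if I: "finite I" "I \<subseteq> {(s,t). a \<le> s \<and> s \<le> t \<and> t \<le> b}"
       "\<forall>p\<in>I. \<forall>q\<in>I. p \<noteq> q \<longrightarrow> {fst p<..<snd p} \<inter> {fst q<..<snd q} = {}"
       "(\<Sum>p\<in>I. snd p - fst p) < min d1 d2" for I
  proof -
    have F: "(\<Sum>p\<in>I. norm (f (snd p) - f (fst p))) < \<eta>" by (rule d1[rule_format]) (use I in auto)
    have G: "(\<Sum>p\<in>I. norm (g (snd p) - g (fst p))) < \<eta>" by (rule d2[rule_format]) (use I in auto)
    have "(\<Sum>p\<in>I. norm (h (snd p) - h (fst p))) \<le>
      (\<Sum>p\<in>I. (\<bar>C\<bar> + 1) * (norm (f (snd p) - f (fst p)) + norm (g (snd p) - g (fst p))))"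
    proof (rule sum_mono)
      fix p assume "p \<in> I"
      with I have p: "a \<le> fst p" "fst p \<le> snd p" "snd p \<le> b" by auto
      have "norm (h (snd p) - h (fst p)) \<le> C * (norm (f (snd p) - f (fst p)) + norm (g (snd p) - g (fst p)))"
        using bd[OF p] by (simp add: distrib_left)
      also have "\<dots> \<le> (\<bar>C\<bar> + 1) * (norm (f (snd p) - f (fst p)) + norm (g (snd p) - g (fst p)))"
        by (rule mult_right_mono) auto
      finally show "norm (h (snd p) - h (fst p)) \<le>
         (\<bar>C\<bar> + 1) * (norm (f (snd p) - f (fst p)) + norm (g (snd p) - g (fst p)))" .
    qed
    also have "\<dots> = (\<bar>C\<bar> + 1) * ((\<Sum>p\<in>I. norm (f (snd p) - f (fst p))) + (\<Sum>p\<in>I. norm (g (snd p) - g (fst p))))"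
      by (simp only: sum_distrib_left sum.distrib distrib_left)
    also have "\<dots> < (\<bar>C\<bar> + 1) * (\<eta> + \<eta>)"
      by (rule mult_strict_left_mono) (use F G in auto)
    finally show ?thesis using \<eta>2 by simp
  qed
  then show "\<exists>\<delta>>0. \<forall>I. finite I \<and> I \<subseteq> {(s,t). a \<le> s \<and> s \<le> t \<and> t \<le> b} \<and>
        (\<forall>p\<in>I. \<forall>q\<in>I. p \<noteq> q \<longrightarrow> {fst p<..<snd p} \<inter> {fst q<..<snd q} = {}) \<and>
        (\<Sum>p\<in>I. snd p - fst p) < \<delta> \<longrightarrow> (\<Sum>p\<in>I. norm (h (snd p) - h (fst p))) < e"
    using \<open>d1 > 0\<close> \<open>d2 > 0\<close> by (intro exI[of _ "min d1 d2"] conjI allI impI) auto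
qed

lemma abs_cont_on_linear:
  assumes "bounded_linear L" "abs_cont_on a b f"
  shows "abs_cont_on a b (\<lambda>t. L (f t))"
proof -
  interpret bounded_linear L by fact
  obtain K where K: "\<And>x. norm (L x) \<le> norm x * K" using bounded by blast
  show ?thesis
  proof (rule abs_cont_on_dominated[OF assms(2,2), where C = "\<bar>K\<bar>"])
    fix s t
    have "norm (L (f t) - L (f s)) \<le> norm (f t - f s) * K" using K by (metis diff)
    also have "\<dots> \<le> norm (f t - f s) * \<bar>K\<bar>" by (intro mult_left_mono) auto
    also have "\<dots> \<le> \<bar>K\<bar> * norm (f t - f s) + \<bar>K\<bar> * norm (f t - f s)" by simp
    finally show "norm (L (f t) - L (f s)) \<le> \<bar>K\<bar> * norm (f t - f s) + \<bar>K\<bar> * norm (f t - f s)" .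
  qed
qed

lemma abs_cont_on_add:
  assumes "abs_cont_on a b f" "abs_cont_on a b g"
  shows "abs_cont_on a b (\<lambda>t. f t + g t)"
proof (rule abs_cont_on_dominated[OF assms, where C = 1])
  fix s t
  show "norm (f t + g t - (f s + g s)) \<le> 1 * norm (f t - f s) + 1 * norm (g t - g s)"
    by (metis add_diff_add mult_1 norm_triangle_ineq)
qed

lemma abs_cont_on_diff:
  assumes "abs_cont_on a b f" "abs_cont_on a b g"
  shows "abs_cont_on a b (\<lambda>t. f t - g t)"
  using abs_cont_on_add[OF assms(1) abs_cont_on_linear[OF bounded_linear_minus[OF bounded_linear_ident] assms(2)]]
  by simp

lemma abs_cont_on_bilinear:
  assumes h: "bounded_bilinear h" and f: "abs_cont_on a b f" and g: "abs_cont_on a b g"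
  shows "abs_cont_on a b (\<lambda>t. h (f t) (g t))"
proof -
  interpret bounded_bilinear h by fact
  obtain K where "K \<ge> 0" and K: "\<And>x y. norm (h x y) \<le> norm x * norm y * K"
    using nonneg_bounded by blast
  have "bounded (f ` {a..b})" "bounded (g ` {a..b})"
    using f g by (auto intro!: compact_imp_bounded compact_continuous_image abs_cont_on_imp_continuous_on)
  then obtain F G where F: "\<And>t. t \<in> {a..b} \<Longrightarrow> norm (f t) \<le> F" and G: "\<And>t. t \<in> {a..b} \<Longrightarrow> norm (g t) \<le> G"
    unfolding bounded_iff by (metis image_eqI)
  define C where "C = K * max (max F G) 0"
  show ?thesis
  proof (rule abs_cont_on_dominated[OF f g, where C = C])
    fix s t assume st: "a \<le> s" "s \<le> t" "t \<le> b"
    have "h (f t) (g t) - h (f s) (g s) = h (f t - f s) (g t) + h (f s) (g t - g s)"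
      by (simp add: diff_left diff_right)
    then have "norm (h (f t) (g t) - h (f s) (g s)) \<le> norm (h (f t - f s) (g t)) + norm (h (f s) (g t - g s))"
      by (metis norm_triangle_ineq)
    moreover have "norm (h (f t - f s) (g t)) \<le> C * norm (f t - f s)"
    proof -
      have "norm (g t) \<le> max (max F G) 0" using G[of t] st by auto
      then have "K * norm (f t - f s) * norm (g t) \<le> K * norm (f t - f s) * max (max F G) 0"
        using \<open>K \<ge> 0\<close> by (intro mult_left_mono) auto
      then show ?thesis using K[of "f t - f s" "g t"] unfolding C_def by (simp add: mult_ac)
    qed
    moreover have "norm (h (f s) (g t - g s)) \<le> C * norm (g t - g s)"
    proof -
      have "norm (f s) \<le> max (max F G) 0" using F[of s] st by auto
      then have "K * norm (g t - g s) * norm (f s) \<le> K * norm (g t - g s) * max (max F G) 0"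
        using \<open>K \<ge> 0\<close> by (intro mult_left_mono) auto
      then show ?thesis using K[of "f s" "g t - g s"] unfolding C_def by (simp add: mult_ac)
    qed
    ultimately show "norm (h (f t) (g t) - h (f s) (g s)) \<le> C * norm (f t - f s) + C * norm (g t - g s)"
      by linarith
  qed
qed

text \<open>One-dimensional Lebesgue differentiation. \<open>integrable_ccontinuous_explicit\<close>
  controls averages over intervals to the right of a point; applied to the reflected function it
  controls those to the left, and together they give a two-sided derivative.\<close>

lemma indefinite_integral_has_vector_derivative_AE:
  fixes g :: "real \<Rightarrow> 'v::euclidean_space"
  assumes g: "g integrable_on {a..b}"
    and u: "\<And>t. t \<in> {a..b} \<Longrightarrow> u t = c + integral {a..t} g"
  shows "AE t in lebesgue_on {a..b}. (u has_vector_derivative g t) (at t)"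
proof -
  define g0 where "g0 = (\<lambda>t. if t \<in> {a..b} then g t else 0)"
  have "g0 integrable_on UNIV"
    using g unfolding g0_def integrable_restrict_UNIV .
  then have int: "g0 integrable_on cbox p q" for p q
    by (meson integrable_on_subcbox subset_UNIV)
  have int': "(\<lambda>x. g0 (- x)) integrable_on cbox p q" for p q :: real
    using int[of "- q" "- p"] Henstock_Kurzweil_Integration.integrable_reflect_real[where f = g0 and a = "-q" and b = "-p"] by simp
  obtain N1 where N1: "negligible N1" "\<And>x e. \<lbrakk>x \<notin> N1; 0 < e\<rbrakk> \<Longrightarrow>
     \<exists>d>0. \<forall>h. 0 < h \<and> h < d \<longrightarrow> norm (integral (cbox x (x + h *\<^sub>R One)) g0 /\<^sub>R h ^ DIM(real) - g0 x) < e"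
    using integrable_ccontinuous_explicit[of g0] int by blast
  obtain N2 where N2: "negligible N2" "\<And>x e. \<lbrakk>x \<notin> N2; 0 < e\<rbrakk> \<Longrightarrow>
     \<exists>d>0. \<forall>h. 0 < h \<and> h < d \<longrightarrow> norm (integral (cbox x (x + h *\<^sub>R One)) (\<lambda>x. g0 (- x)) /\<^sub>R h ^ DIM(real) - g0 (- x)) < e"
    using integrable_ccontinuous_explicit[of "\<lambda>x. g0 (- x)"] int' by blast
  \<comment> \<open>The end points join the exceptional set because \<open>u\<close> is constrained
    only on \<open>{a..b}\<close>, which says nothing about a two-sided derivative there.\<close>
  define N where "N = N1 \<union> uminus ` N2 \<union> {a, b}"
  have "negligible (uminus ` N2)"
    by (rule negligible_differentiable_image_negligible[OF _ N2(1)])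
       (auto intro!: derivative_intros simp: differentiable_on_def)
  then have "negligible N"
    using N1(1) unfolding N_def by simp
  moreover have "(u has_vector_derivative g t) (at t)" if t: "t \<in> {a..b} - N" for t
  proof -
    have tab: "a < t" "t < b" and t1: "t \<notin> N1" and t2: "- t \<notin> N2"
      using t unfolding N_def by (auto simp: image_iff)
    have u_diff: "u q - u p = integral {p..q} g0" if "a \<le> p" "p \<le> q" "q \<le> b" for p q
    proof -
      have "g integrable_on {a..q}" using g that by (meson integrable_subinterval_real atLeastatMost_subset_iff order_refl)
      then have "integral {a..p} g + integral {p..q} g = integral {a..q} g"
        using that by (intro Henstock_Kurzweil_Integration.integral_combine) auto
      moreover have "integral {p..q} g0 = integral {p..q} g"
        by (rule integral_cong) (use that in \<open>auto simp: g0_def\<close>)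
      moreover have "u p = c + integral {a..p} g" "u q = c + integral {a..q} g"
        using that by (auto intro!: u)
      ultimately show ?thesis by (simp add: algebra_simps)
    qed
    have "\<exists>d>0. \<forall>y. norm (y - t) < d \<longrightarrow> norm (u y - u t - (y - t) *\<^sub>R g t) \<le> e * norm (y - t)"
      if "e > 0" for e
    proof -
      obtain d1 where d1: "d1 > 0" "\<And>h. 0 < h \<Longrightarrow> h < d1 \<Longrightarrow> norm (integral {t..t + h} g0 /\<^sub>R h - g0 t) < e"
        using N1(2)[OF t1 \<open>e > 0\<close>] by auto
      obtain d2 where d2: "d2 > 0" "\<And>h. 0 < h \<Longrightarrow> h < d2 \<Longrightarrow>
          norm (integral {- t..- t + h} (\<lambda>x. g0 (- x)) /\<^sub>R h - g0 t) < e"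
        using N2(2)[OF t2 \<open>e > 0\<close>] by auto
      have gt: "g0 t = g t" using tab unfolding g0_def by auto
      have sc: "norm (h *\<^sub>R x - h *\<^sub>R y) \<le> e * h" if "h > 0" "norm (x - y) < e" for h and x y :: 'v
        using that by (simp flip: scaleR_diff_right)
      define d where "d = min (min d1 d2) (min (t - a) (b - t))"
      have "norm (u y - u t - (y - t) *\<^sub>R g t) \<le> e * norm (y - t)" if y: "norm (y - t) < d" for y
      proof (cases y t rule: linorder_cases)
        case equal
        then show ?thesis by simp
      next
        case greater
        define h where "h = y - t"
        have h: "h > 0" "h < d1" "y = t + h" "y \<le> b"
          using greater y unfolding h_def d_def by auto
        have "u y - u t = integral {t..t + h} g0" using u_diff[of t y] h tab by auto
        also have "\<dots> = h *\<^sub>R (integral {t..t + h} g0 /\<^sub>R h)" using h by simp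
        finally have "u y - u t - h *\<^sub>R g t = h *\<^sub>R (integral {t..t + h} g0 /\<^sub>R h) - h *\<^sub>R g t" by simp
        then have "norm (u y - u t - h *\<^sub>R g t) \<le> e * h"
          using sc[OF h(1) d1(2)[OF h(1,2)]] gt by simp
        then show ?thesis using h unfolding h_def by simp
      next
        case less
        define h where "h = t - y"
        have h: "h > 0" "h < d2" "y = t - h" "a \<le> y"
          using less y unfolding h_def d_def by auto
        have "u t - u y = integral {y..t} g0" using u_diff[of y t] h tab by auto
        also have "\<dots> = integral {- t..- t + h} (\<lambda>x. g0 (- x))"
          using Henstock_Kurzweil_Integration.integral_reflect_real[where f = g0 and a = y and b = t] h by (simp add: add.commute)
        also have "\<dots> = h *\<^sub>R (integral {- t..- t + h} (\<lambda>x. g0 (- x)) /\<^sub>R h)" using h by simp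
        finally have eq: "u t - u y = h *\<^sub>R (integral {- t..- t + h} (\<lambda>x. g0 (- x)) /\<^sub>R h)" .
        have "norm (u t - u y - h *\<^sub>R g t) \<le> e * h"
          unfolding eq using sc[OF h(1) d2(2)[OF h(1,2)]] gt by simp
        moreover have "u y - u t - (y - t) *\<^sub>R g t = - (u t - u y - h *\<^sub>R g t)"
          unfolding h_def by (simp add: algebra_simps)
        ultimately have "norm (u y - u t - (y - t) *\<^sub>R g t) \<le> e * h" by (simp only: norm_minus_cancel)
        moreover have "norm (y - t) = h" using h(1) unfolding h_def by simp
        ultimately show ?thesis by simp
      qed
      moreover have "d > 0" using d1 d2 tab unfolding d_def by auto
      ultimately show ?thesis by blast
    qed
    then show ?thesis
      unfolding has_vector_derivative_def has_derivative_at_alt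
      by (auto simp: bounded_linear_scaleR_left)
  qed
  ultimately show ?thesis unfolding AE_lebesgue_on_interval_iff by blast
qed

subsection \<open>Linear Caratheodory systems\<close>

lemma norm_vector_smult:
  fixes x :: "complex^'m"
  shows "norm (c *s x) = cmod c * norm x"
proof -
  have "norm (c *s x) = L2_set (\<lambda>i. cmod c * norm (x $ i)) UNIV"
    unfolding norm_vec_def by (simp add: norm_mult)
  also have "\<dots> = cmod c * norm x"
    unfolding norm_vec_def by (simp add: L2_set_right_distrib)
  finally show ?thesis .
qed

lemma bounded_linear_vector_smult: "bounded_linear (\<lambda>x :: complex^'m. c *s x)"
  by (rule bounded_linear_intro[where K = "cmod c"])
     (auto simp: norm_vector_smult vec_eq_iff algebra_simps)

lemma borel_measurable_vec_iff:
  fixes f :: "'a \<Rightarrow> complex^'m"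
  shows "f \<in> borel_measurable M \<longleftrightarrow> (\<forall>i. (\<lambda>t. f t $ i) \<in> borel_measurable M)"
proof
  assume "f \<in> borel_measurable M"
  then show "\<forall>i. (\<lambda>t. f t $ i) \<in> borel_measurable M"
    by (auto intro!: measurable_compose[of f M borel "\<lambda>x :: complex^'m. x $ _" borel] borel_measurable_continuous_onI
          continuous_intros)
next
  assume *: "\<forall>i. (\<lambda>t. f t $ i) \<in> borel_measurable M"
  show "f \<in> borel_measurable M"
    unfolding borel_measurable_euclidean_space[of f]
    using * by (auto simp: Basis_vec_def inner_axis intro!: borel_measurable_inner)
qed

lemma integrable_bounded_measurable:
  fixes f :: "real \<Rightarrow> 'v::euclidean_space"
  assumes "f \<in> borel_measurable (lebesgue_on {a..b})" "AE t in lebesgue_on {a..b}. norm (f t) \<le> C"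
  shows "integrable (lebesgue_on {a..b}) f"
proof -
  interpret finite_measure "lebesgue_on {a..b}"
    by (rule finite_measure_lebesgue_on) simp
  show ?thesis by (rule integrable_const_bound[OF assms(2,1)])
qed

lemma integral_AE_norm_bound:
  fixes f :: "real \<Rightarrow> 'v::euclidean_space"
  assumes f: "f integrable_on {a..b}" and g: "(g has_integral J) {a..b}"
    and le: "AE t in lebesgue_on {a..b}. norm (f t) \<le> g t"
  shows "norm (integral {a..b} f) \<le> J"
proof -
  obtain N where N: "negligible N" "\<And>t. t \<in> {a..b} - N \<Longrightarrow> norm (f t) \<le> g t"
    using le unfolding AE_lebesgue_on_interval_iff by blast
  define f' where "f' = (\<lambda>t. if t \<in> N then 0 else f t)"
  define g' where "g' = (\<lambda>t. if t \<in> N then 0 else g t)"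
  have "(f' has_integral integral {a..b} f) {a..b}"
    by (rule has_integral_spike[OF N(1) _ integrable_integral[OF f]]) (auto simp: f'_def)
  moreover have "(g' has_integral J) {a..b}"
    by (rule has_integral_spike[OF N(1) _ g]) (auto simp: g'_def)
  moreover have "norm (f' t) \<le> g' t" if "t \<in> {a..b}" for t
    using that N(2)[of t] unfolding f'_def g'_def by auto
  ultimately show ?thesis
    using integral_norm_bound_integral[of f' "{a..b}" g'] by (auto simp: has_integral_iff)
qed

text \<open>The majorant \<open>C + K * G\<close>, with \<open>G\<close> the primitive of
  \<open>g\<close>, multiplied by \<open>exp (- K * (s - a))\<close> has nonpositive derivative,
  hence stays below its initial value \<open>C\<close>.\<close>

lemma gronwall:
  fixes g :: "real \<Rightarrow> real"
  assumes cont: "continuous_on {a..b} g" and le: "\<And>t. t \<in> {a..b} \<Longrightarrow> g t \<le> C + K * integral {a..t} g"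
    and "K \<ge> 0" and t: "t \<in> {a..b}"
  shows "g t \<le> C * exp (K * (t - a))"
proof -
  define G where "G = (\<lambda>s. integral {a..s} g)"
  define h where "h = (\<lambda>s. (C + K * G s) * exp (- K * (s - a)))"
  have dG: "(G has_real_derivative g s) (at s within {a..b})" if "s \<in> {a..b}" for s
    using integral_has_real_derivative[OF cont that] unfolding G_def .
  have dh: "(h has_real_derivative (K * g s - K * (C + K * G s)) * exp (- K * (s - a))) (at s within {a..b})"
    if "s \<in> {a..b}" for s
    unfolding h_def by (auto intro!: derivative_eq_intros dG[OF that] simp: algebra_simps)
  have "h t \<le> h a"
    proof (rule DERIV_nonpos_imp_decreasing_open[where f = h])
      show "a \<le> t" using t by simp
    next
      fix s assume s: "a < s" "s < t"
      then have "at s within {a..b} = at s" using t by (intro at_within_Icc_at) auto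
      moreover have "(K * g s - K * (C + K * G s)) * exp (- K * (s - a)) \<le> 0"
      proof -
        have "K * g s \<le> K * (C + K * G s)"
          using le[of s] s t \<open>K \<ge> 0\<close> unfolding G_def by (intro mult_left_mono) auto
        then show ?thesis by (intro mult_nonpos_nonneg) auto
      qed
      ultimately show "\<exists>y. (h has_real_derivative y) (at s) \<and> y \<le> 0"
        using dh[of s] s t by (metis atLeastAtMost_iff less_eq_real_def order_less_le_trans)
    next
      have "continuous_on {a..b} h"
        by (meson dh DERIV_continuous continuous_on_eq_continuous_within)
      then show "continuous_on {a..t} h"
        by (rule continuous_on_subset) (use t in auto)
    qed
  then have "(C + K * G t) * exp (- K * (t - a)) \<le> C"
    unfolding h_def G_def by simp
  then have "(C + K * G t) * exp (- K * (t - a)) * exp (K * (t - a)) \<le> C * exp (K * (t - a))"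
    by (intro mult_right_mono) auto
  then have "C + K * G t \<le> C * exp (K * (t - a))"
    by (simp add: mult.assoc flip: exp_add)
  then show ?thesis using le[OF t] unfolding G_def by simp
qed

text \<open>The bound is quantified over all \<open>x\<close> inside the a.e. statement, so one null
  set serves every vector function inserted for \<open>x\<close>.\<close>

definition lin_coeff :: "real \<Rightarrow> real \<Rightarrow> (real \<Rightarrow> complex^'m^'m) \<Rightarrow> real \<Rightarrow> bool" where
  "lin_coeff a b M K \<longleftrightarrow> K \<ge> 0 \<and>
     (\<forall>i j. (\<lambda>t. M t $ i $ j) \<in> borel_measurable (lebesgue_on {a..b})) \<and>
     (AE t in lebesgue_on {a..b}. \<forall>x. norm (M t *v x) \<le> K * norm x)"

definition lin_sol :: "real \<Rightarrow> real \<Rightarrow> (real \<Rightarrow> complex^'m^'m) \<Rightarrow> (real \<Rightarrow> complex^'m) \<Rightarrow> (real \<Rightarrow> complex^'m) \<Rightarrow> bool" where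
  "lin_sol a b M f u \<longleftrightarrow> abs_cont_on a b u \<and>
     (AE t in lebesgue_on {a..b}. (u has_vector_derivative (M t *v u t + f t)) (at t))"

lemma continuous_bounded_on_interval:
  fixes u :: "real \<Rightarrow> 'v::real_normed_vector"
  assumes "continuous_on {a..b} u"
  obtains C where "C \<ge> 0" "\<And>t. t \<in> {a..b} \<Longrightarrow> norm (u t) \<le> C"
proof -
  have "bounded (u ` {a..b})"
    using assms by (intro compact_imp_bounded compact_continuous_image) auto
  then obtain C where "\<And>t. t \<in> {a..b} \<Longrightarrow> norm (u t) \<le> C"
    unfolding bounded_iff by blast
  then have "\<And>t. t \<in> {a..b} \<Longrightarrow> norm (u t) \<le> max C 0" by fastforce
  then show thesis using that[of "max C 0"] by auto
qed

lemma lin_coeff_measurable: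
  assumes "lin_coeff a b M K" "continuous_on {a..b} u"
  shows "(\<lambda>t. M t *v u t) \<in> borel_measurable (lebesgue_on {a..b})"
proof -
  have "u \<in> borel_measurable (lebesgue_on {a..b})"
    using assms(2) by (rule continuous_imp_measurable_on_sets_lebesgue) simp
  then have "\<forall>i. (\<lambda>t. u t $ i) \<in> borel_measurable (lebesgue_on {a..b})"
    using borel_measurable_vec_iff by blast
  then have "(\<lambda>t. \<Sum>j\<in>UNIV. M t $ i $ j * u t $ j) \<in> borel_measurable (lebesgue_on {a..b})" for i
    using assms(1) unfolding lin_coeff_def by (intro borel_measurable_sum borel_measurable_times) auto
  then show ?thesis
    unfolding borel_measurable_vec_iff[of "\<lambda>t. M t *v u t"] by (simp add: matrix_vector_mult_def)
qed

lemma lin_coeff_bound: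
  assumes M: "lin_coeff a b M K" and u: "\<And>t. t \<in> {a..b} \<Longrightarrow> norm (u t) \<le> C t"
  shows "AE t in lebesgue_on {a..b}. norm (M t *v u t) \<le> K * C t"
proof -
  have "AE t in lebesgue_on {a..b}. \<forall>x. norm (M t *v x) \<le> K * norm x"
    using M unfolding lin_coeff_def by blast
  then obtain N where N: "negligible N" "\<And>t x. t \<in> {a..b} - N \<Longrightarrow> norm (M t *v x) \<le> K * norm x"
    unfolding AE_lebesgue_on_interval_iff by blast
  have "norm (M t *v u t) \<le> K * C t" if "t \<in> {a..b} - N" for t
  proof -
    have "K * norm (u t) \<le> K * C t"
      using M u that unfolding lin_coeff_def by (intro mult_left_mono) auto
    then show ?thesis using N(2)[OF that, of "u t"] by linarith
  qed
  then show ?thesis using N(1) unfolding AE_lebesgue_on_interval_iff by blast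
qed

lemma lin_coeff_integrable:
  assumes "lin_coeff a b M K" "continuous_on {a..b} u"
  shows "(\<lambda>t. M t *v u t) integrable_on {a..b}"
proof -
  obtain C where "C \<ge> 0" "\<And>t. t \<in> {a..b} \<Longrightarrow> norm (u t) \<le> C"
    using continuous_bounded_on_interval[OF assms(2)] by blast
  then have "integrable (lebesgue_on {a..b}) (\<lambda>t. M t *v u t)"
    using integrable_bounded_measurable[OF lin_coeff_measurable[OF assms] lin_coeff_bound[OF assms(1)]]
    by blast
  then show ?thesis by (rule integrable_on_lebesgue_on) simp
qed

lemma lin_coeff_subinterval:
  assumes M: "lin_coeff a b M K" and "c \<in> {a..b}"
  shows "lin_coeff a c M K"
proof -
  have sub: "{a..c} \<subseteq> {a..b}" using assms(2) by auto
  have "(\<lambda>t. M t $ i $ j) \<in> borel_measurable (lebesgue_on {a..c})" for i j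
    using M sub unfolding lin_coeff_def
    by (meson measurable_restrict_mono)
  then show ?thesis
    using M assms(2) unfolding lin_coeff_def
    by (auto intro: AE_lebesgue_on_subinterval[where a = a and b = b])
qed

lemma lin_coeff_mono: "lin_coeff a b M K \<Longrightarrow> K \<le> L \<Longrightarrow> lin_coeff a b M L"
  unfolding lin_coeff_def
  by (auto elim!: eventually_mono) (meson mult_right_mono norm_ge_zero order_trans)

text \<open>The Neumann series of the Volterra operator converges because its \<open>n\<close>-th term is bounded by
  \<open>C (K (t - a)) ^ n / n!\<close>.\<close>

lemma volterra_solution_exists:
  fixes F :: "real \<Rightarrow> complex^'m"
  assumes M: "lin_coeff a b M K" and "a \<le> b" and F: "continuous_on {a..b} F"
  obtains u where "continuous_on {a..b} u"
    "\<And>t. t \<in> {a..b} \<Longrightarrow> u t = F t + integral {a..t} (\<lambda>s. M s *v u s)"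
proof -
  define V where "V = (\<lambda>w t. integral {a..t} (\<lambda>s. M s *v w s))"
  define v where "v = (\<lambda>n. (V ^^ n) F)"
  have K: "K \<ge> 0" using M unfolding lin_coeff_def by blast
  have v0: "v 0 = F" and vSuc: "v (Suc n) = V (v n)" for n unfolding v_def by auto
  have cV: "continuous_on {a..b} (V w)" if "continuous_on {a..b} w" for w
    unfolding V_def by (rule indefinite_integral_continuous_1[OF lin_coeff_integrable[OF M that]])
  have cv: "continuous_on {a..b} (v n)" for n
    by (induction n) (auto simp: v0 vSuc F cV)
  have int: "(\<lambda>s. M s *v w s) integrable_on {a..t}" if "continuous_on {a..b} w" "t \<in> {a..b}" for w t
    by (rule integrable_subinterval_real[OF lin_coeff_integrable[OF M that(1)]]) (use that in auto)
  have Vbound: "norm (V w t) \<le> J" if w: "continuous_on {a..b} w" and t: "t \<in> {a..b}"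
     and g: "\<And>s. s \<in> {a..t} \<Longrightarrow> norm (w s) \<le> g s" and J: "((\<lambda>s. K * g s) has_integral J) {a..t}" for w t g J
    unfolding V_def
    by (rule integral_AE_norm_bound[OF int[OF w t] J lin_coeff_bound[OF lin_coeff_subinterval[OF M t] g]])
  obtain C where C: "C \<ge> 0" "\<And>t. t \<in> {a..b} \<Longrightarrow> norm (F t) \<le> C"
    using continuous_bounded_on_interval[OF F] by blast
  have bd: "norm (v n t) \<le> C * (K * (t - a)) ^ n / fact n" if "t \<in> {a..b}" for n t
    using that
  proof (induction n arbitrary: t)
    case 0
    then show ?case using C by (simp add: v0)
  next
    case (Suc n)
    show ?case unfolding vSuc
    proof (rule Vbound[OF cv Suc.prems, where g = "\<lambda>s. C * (K * (s - a)) ^ n / fact n"])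
      fix s assume "s \<in> {a..t}"
      then show "norm (v n s) \<le> C * (K * (s - a)) ^ n / fact n"
        using Suc.prems by (intro Suc.IH) auto
    next
      have "((\<lambda>s. K * (C * (K * (s - a)) ^ n / fact n)) has_integral
         (C * (K * (t - a)) ^ Suc n / fact (Suc n) - C * (K * (a - a)) ^ Suc n / fact (Suc n))) {a..t}"
      proof (rule fundamental_theorem_of_calculus)
        fix s :: real
        have "((\<lambda>s. C * (K * (s - a)) ^ Suc n / fact (Suc n)) has_real_derivative
           C * (real (Suc n) * (K * (s - a)) ^ n * K) / fact (Suc n)) (at s within {a..t})"
          by (auto intro!: derivative_eq_intros simp del: power_Suc fact_Suc)
        also have "C * (real (Suc n) * (K * (s - a)) ^ n * K) / fact (Suc n) = K * (C * (K * (s - a)) ^ n / fact n)"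
          by (simp add: field_simps del: of_nat_Suc)
        finally show "((\<lambda>s. C * (K * (s - a)) ^ Suc n / fact (Suc n)) has_vector_derivative
           K * (C * (K * (s - a)) ^ n / fact n)) (at s within {a..t})"
          by (simp only: has_real_derivative_iff_has_vector_derivative)
      qed (use Suc.prems in auto)
      then show "((\<lambda>s. K * (C * (K * (s - a)) ^ n / fact n)) has_integral
         C * (K * (t - a)) ^ Suc n / fact (Suc n)) {a..t}"
        by simp
    qed
  qed
  have bd': "norm (v n t) \<le> C * ((K * (b - a)) ^ n / fact n)" if "t \<in> {a..b}" for n t
  proof -
    have "(K * (t - a)) ^ n \<le> (K * (b - a)) ^ n"
      using that K by (intro power_mono mult_left_mono) auto
    then have "C * (K * (t - a)) ^ n / fact n \<le> C * (K * (b - a)) ^ n / fact n"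
      using C by (intro divide_right_mono mult_left_mono) auto
    then show ?thesis using bd[OF that, of n] by simp
  qed
  have "summable (\<lambda>n. (K * (b - a)) ^ n / fact n)"
    using summable_exp[of "K * (b - a)"] by (simp add: divide_inverse mult.commute)
  then have sm: "summable (\<lambda>n. C * ((K * (b - a)) ^ n / fact n))"
    by (rule summable_mult)
  define S where "S = (\<lambda>n t. \<Sum>i<n. v i t)"
  define u where "u = (\<lambda>t. \<Sum>i. v i t)"
  have lim: "uniform_limit {a..b} S u sequentially"
    unfolding S_def u_def by (rule Weierstrass_m_test[OF bd' sm])
  have cS: "continuous_on {a..b} (S n)" for n
    unfolding S_def by (intro continuous_on_sum cv)
  have cu: "continuous_on {a..b} u"
    by (rule uniform_limit_theorem[OF _ lim]) (auto simp: cS)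
  \<comment> \<open>The partial sums follow the Picard recursion, so their uniform limit solves the
    integral equation as soon as \<open>V\<close> passes to the limit.\<close>
  have SSuc: "S (Suc n) t = F t + V (S n) t" if t: "t \<in> {a..b}" for n t
  proof (induction n)
    case 0
    then show ?case by (simp add: S_def V_def v0)
  next
    case (Suc n)
    have "S (Suc n) = (\<lambda>s. S n s + v n s)" unfolding S_def by simp
    then have "V (S (Suc n)) t = integral {a..t} (\<lambda>s. M s *v S n s + M s *v v n s)"
      unfolding V_def by (simp add: matrix_vector_right_distrib)
    also have "\<dots> = V (S n) t + V (v n) t"
      unfolding V_def by (rule integral_add) (auto intro!: int t cS cv)
    finally show ?case using Suc by (simp add: S_def vSuc)
  qed
  have "u t = F t + V u t" if t: "t \<in> {a..b}" for t
  proof -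
    have "(\<lambda>n. V (S n) t) \<longlonglongrightarrow> V u t"
    proof (rule metric_LIMSEQ_I)
      fix r :: real assume "r > 0"
      \<comment> \<open>The summand 1 avoids division by zero when
        \<open>K * (b - a) = 0\<close>.\<close>
      define e where "e = r / (K * (b - a) + 1)"
      have Kb: "K * (b - a) \<ge> 0" using K \<open>a \<le> b\<close> by simp
      have "e > 0" using \<open>r > 0\<close> Kb unfolding e_def by (simp add: add_nonneg_pos)
      then obtain n0 where n0: "\<And>n s. n \<ge> n0 \<Longrightarrow> s \<in> {a..b} \<Longrightarrow> dist (S n s) (u s) < e"
        using lim unfolding uniform_limit_sequentially_iff by blast
      have "dist (V (S n) t) (V u t) < r" if n: "n \<ge> n0" for n
      proof -
        have "V (S n) t - V u t = V (\<lambda>s. S n s - u s) t"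
          unfolding V_def matrix_vector_mult_diff_distrib
          by (rule integral_diff[symmetric]) (auto intro!: int t cS cu)
        also have "norm \<dots> \<le> (K * e) * (t - a)"
        proof (rule Vbound[OF _ t, where g = "\<lambda>_. e"])
          show "continuous_on {a..b} (\<lambda>s. S n s - u s)" by (intro continuous_intros cS cu)
          show "norm (S n s - u s) \<le> e" if "s \<in> {a..t}" for s
            using n0[OF n, of s] that t by (auto simp: dist_norm)
          show "((\<lambda>s. K * e) has_integral K * e * (t - a)) {a..t}"
            using has_integral_const_real[of "K * e" a t] t by (simp add: mult.commute)
        qed
        also have "\<dots> \<le> (K * e) * (b - a)"
          using t K \<open>e > 0\<close> by (intro mult_left_mono) auto
        also have "\<dots> = (K * (b - a)) * e" by simp
        also have "\<dots> < (K * (b - a) + 1) * e" using \<open>e > 0\<close> by (simp add: algebra_simps)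
        also have "\<dots> = r" unfolding e_def using Kb by auto
        finally show ?thesis by (simp add: dist_norm)
      qed
      then show "\<exists>no. \<forall>n\<ge>no. dist (V (S n) t) (V u t) < r" by blast
    qed
    then have "(\<lambda>n. F t + V (S n) t) \<longlonglongrightarrow> F t + V u t" by (intro tendsto_intros)
    then have "(\<lambda>n. S (Suc n) t) \<longlonglongrightarrow> F t + V u t" using SSuc[OF t] by simp
    moreover have "(\<lambda>n. S (Suc n) t) \<longlonglongrightarrow> u t"
      using tendsto_uniform_limitI[OF lim t] by (rule LIMSEQ_Suc)
    ultimately show ?thesis using LIMSEQ_unique by blast
  qed
  then show thesis using that[OF cu] unfolding V_def by blast
qed

text \<open>The Volterra equation with right-hand side \<open>u0 + integral {a..t} f\<close> is the
  integrated system. Its integrand is essentially bounded, which makes the solution Lipschitz, hence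
  absolutely continuous, and Lebesgue differentiation recovers the equation a.e.\<close>

lemma lin_sol_exists:
  fixes u0 :: "complex^'m"
  assumes M: "lin_coeff a b M K" and ab: "a \<le> b"
    and f: "f \<in> borel_measurable (lebesgue_on {a..b})" "AE t in lebesgue_on {a..b}. norm (f t) \<le> C"
  obtains u where "lin_sol a b M f u" "u a = u0"
proof -
  have fi: "f integrable_on {a..b}"
    using integrable_bounded_measurable[OF f] by (rule integrable_on_lebesgue_on) simp
  have "continuous_on {a..b} (\<lambda>t. u0 + integral {a..t} f)"
    by (intro continuous_intros indefinite_integral_continuous_1 fi)
  then obtain u where cu: "continuous_on {a..b} u" and
      u: "\<And>t. t \<in> {a..b} \<Longrightarrow> u t = u0 + integral {a..t} f + integral {a..t} (\<lambda>s. M s *v u s)"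
    using volterra_solution_exists[OF M ab] by blast
  define g where "g = (\<lambda>t. M t *v u t + f t)"
  have Mi: "(\<lambda>t. M t *v u t) integrable_on {a..b}" by (rule lin_coeff_integrable[OF M cu])
  have gi: "g integrable_on {a..b}" unfolding g_def by (intro integrable_add Mi fi)
  have ug: "u t = u0 + integral {a..t} g" if "t \<in> {a..b}" for t
  proof -
    have "integral {a..t} g = integral {a..t} (\<lambda>s. M s *v u s) + integral {a..t} f"
      unfolding g_def
      by (intro integral_add integrable_subinterval_real[OF Mi] integrable_subinterval_real[OF fi])
         (use that in auto)
    then show ?thesis using u[OF that] by simp
  qed
  have der: "AE t in lebesgue_on {a..b}. (u has_vector_derivative g t) (at t)"
    by (rule indefinite_integral_has_vector_derivative_AE[OF gi ug])
  obtain U where U: "U \<ge> 0" "\<And>t. t \<in> {a..b} \<Longrightarrow> norm (u t) \<le> U"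
    using continuous_bounded_on_interval[OF cu] by blast
  have gb: "AE t in lebesgue_on {a..b}. norm (g t) \<le> K * U + C"
  proof -
    have "AE t in lebesgue_on {a..b}. norm (M t *v u t) \<le> K * U"
      by (rule lin_coeff_bound[OF M U(2)])
    then show ?thesis using f(2) unfolding g_def
      by eventually_elim (meson add_mono norm_triangle_le)
  qed
  have "abs_cont_on a b u"
  proof (rule abs_cont_on_Lipschitz[where C = "K * U + C"])
    fix s t assume st: "a \<le> s" "s \<le> t" "t \<le> b"
    have gi': "g integrable_on {p..q}" if "a \<le> p" "q \<le> b" for p q
      by (rule integrable_subinterval_real[OF gi]) (use that in auto)
    have "integral {a..s} g + integral {s..t} g = integral {a..t} g"
      using st by (intro Henstock_Kurzweil_Integration.integral_combine gi') auto
    then have "u t - u s = integral {s..t} g"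
      using ug[of s] ug[of t] st by (simp add: algebra_simps)
    moreover have "norm (integral {s..t} g) \<le> (K * U + C) * (t - s)"
    proof (rule integral_AE_norm_bound)
      show "g integrable_on {s..t}" by (rule gi') (use st in auto)
      show "((\<lambda>_. K * U + C) has_integral (K * U + C) * (t - s)) {s..t}"
        using has_integral_const_real[of "K * U + C" s t] st by (simp add: mult.commute)
      show "AE x in lebesgue_on {s..t}. norm (g x) \<le> K * U + C"
        by (rule AE_lebesgue_on_subinterval[OF gb]) (use st in auto)
    qed
    ultimately show "norm (u t - u s) \<le> (K * U + C) * (t - s)" by simp
  qed
  with der have "lin_sol a b M f u" unfolding lin_sol_def g_def by blast
  moreover have "u a = u0" using ug[of a] ab by simp
  ultimately show thesis by (rule that)
qed

lemma lin_sol_continuous: "lin_sol a b M f u \<Longrightarrow> continuous_on {a..b} u"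
  unfolding lin_sol_def by (blast intro: abs_cont_on_imp_continuous_on)

text \<open>Absolute continuity turns the equation into an integral inequality for
  \<open>norm (u t)\<close>, to which Gronwall applies. The bound is uniform in \<open>t\<close> and
  linear in the data and the forcing, so it yields uniqueness and both difference estimates for the
  parameter derivative.\<close>

lemma lin_sol_norm_bound:
  assumes M: "lin_coeff a b M K" and u: "lin_sol a b M f u"
    and f: "AE t in lebesgue_on {a..b}. norm (f t) \<le> C" and "C \<ge> 0" and t: "t \<in> {a..b}"
  shows "norm (u t) \<le> (norm (u a) + C * (b - a)) * exp (K * (b - a))"
proof -
  have K: "K \<ge> 0" using M unfolding lin_coeff_def by blast
  have cu: "continuous_on {a..b} u" by (rule lin_sol_continuous[OF u])
  have "norm (u t) \<le> (norm (u a) + C * (b - a)) * exp (K * (t - a))"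
  proof (rule gronwall[where g = "\<lambda>t. norm (u t)", OF _ _ K t])
    show "continuous_on {a..b} (\<lambda>t. norm (u t))" by (intro continuous_intros cu)
    fix s assume s: "s \<in> {a..b}"
    have I: "((\<lambda>t. M t *v u t + f t) has_integral (u s - u a)) {a..s}"
      by (rule abs_cont_has_integral_deriv)
         (use s u in \<open>auto simp: lin_sol_def intro: abs_cont_on_subinterval AE_lebesgue_on_subinterval\<close>)
    have "continuous_on {a..s} (\<lambda>t. norm (u t))"
      by (intro continuous_intros continuous_on_subset[OF cu]) (use s in auto)
    then have "((\<lambda>t. K * norm (u t)) has_integral K * integral {a..s} (\<lambda>t. norm (u t))) {a..s}"
      by (intro has_integral_mult_right integrable_integral integrable_continuous_interval)
    then have J: "((\<lambda>t. K * norm (u t) + C) has_integral K * integral {a..s} (\<lambda>t. norm (u t)) + C * (s - a)) {a..s}"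
      using has_integral_const_real[of C a s] s by (intro has_integral_add) (auto simp: mult.commute)
    have "AE t in lebesgue_on {a..b}. norm (M t *v u t) \<le> K * norm (u t)"
      by (rule lin_coeff_bound[OF M order_refl])
    then have "AE t in lebesgue_on {a..b}. norm (M t *v u t + f t) \<le> K * norm (u t) + C"
      using f by eventually_elim (meson add_mono norm_triangle_le)
    then have "AE t in lebesgue_on {a..s}. norm (M t *v u t + f t) \<le> K * norm (u t) + C"
      by (rule AE_lebesgue_on_subinterval) (use s in auto)
    then have "norm (integral {a..s} (\<lambda>t. M t *v u t + f t)) \<le> K * integral {a..s} (\<lambda>t. norm (u t)) + C * (s - a)"
      using I by (intro integral_AE_norm_bound[OF _ J]) auto
    then have "norm (u s - u a) \<le> K * integral {a..s} (\<lambda>t. norm (u t)) + C * (s - a)"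
      using integral_unique[OF I] by simp
    moreover have "C * (s - a) \<le> C * (b - a)"
      using s \<open>C \<ge> 0\<close> by (intro mult_left_mono) auto
    moreover have "norm (u s) \<le> norm (u a) + norm (u s - u a)"
      by (metis add.commute diff_add_cancel norm_triangle_ineq)
    ultimately show "norm (u s) \<le> norm (u a) + C * (b - a) + K * integral {a..s} (\<lambda>t. norm (u t))"
      by linarith
  qed
  also have "\<dots> \<le> (norm (u a) + C * (b - a)) * exp (K * (b - a))"
    using t K \<open>C \<ge> 0\<close> by (intro mult_left_mono) (auto intro!: mult_left_mono)
  finally show ?thesis .
qed

lemma lin_sol_add_smult:
  assumes "lin_sol a b M f u" "lin_sol a b M g w"
  shows "lin_sol a b M (\<lambda>t. f t + c *s g t) (\<lambda>t. u t + c *s w t)"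
proof -
  have "AE t in lebesgue_on {a..b}. (u has_vector_derivative (M t *v u t + f t)) (at t)"
       "AE t in lebesgue_on {a..b}. (w has_vector_derivative (M t *v w t + g t)) (at t)"
    using assms unfolding lin_sol_def by auto
  then have "AE t in lebesgue_on {a..b}. ((\<lambda>t. u t + c *s w t) has_vector_derivative
      (M t *v (u t + c *s w t) + (f t + c *s g t))) (at t)"
  proof eventually_elim
    case (elim t)
    have "((\<lambda>t. u t + c *s w t) has_vector_derivative ((M t *v u t + f t) + c *s (M t *v w t + g t))) (at t)"
      by (intro has_vector_derivative_add elim bounded_linear.has_vector_derivative[OF bounded_linear_vector_smult])
    then show ?case by (simp add: vec.add vec.scale vector_add_ldistrib algebra_simps)
  qed
  moreover have "abs_cont_on a b (\<lambda>t. u t + c *s w t)"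
    using assms unfolding lin_sol_def
    by (intro abs_cont_on_add abs_cont_on_linear[OF bounded_linear_vector_smult]) auto
  ultimately show ?thesis unfolding lin_sol_def by blast
qed

lemma lin_sol_unique:
  assumes M: "lin_coeff a b M K" and u: "lin_sol a b M f u" and w: "lin_sol a b M f w"
    and "u a = w a" "t \<in> {a..b}"
  shows "u t = w t"
proof -
  have "lin_sol a b M (\<lambda>t. f t + (- 1) *s f t) (\<lambda>t. u t + (- 1) *s w t)"
    by (rule lin_sol_add_smult[OF u w])
  then have "norm (u t + (- 1) *s w t) \<le> (norm (u a + (- 1) *s w a) + 0 * (b - a)) * exp (K * (b - a))"
    by (rule lin_sol_norm_bound[OF M]) (use assms(5) in \<open>auto simp: vec_eq_iff\<close>)
  then show ?thesis using \<open>u a = w a\<close> by (simp add: vec_eq_iff)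
qed

section \<open>Differentiability of solutions in the spectral parameter\<close>

definition pencil :: "(real \<Rightarrow> complex^'m^'m) \<Rightarrow> (real \<Rightarrow> complex^'m^'m) \<Rightarrow> complex \<Rightarrow> real \<Rightarrow> complex^'m^'m" where
  "pencil M0 M1 lam t = (\<chi> i j. M0 t $ i $ j + lam * M1 t $ i $ j)"

lemma pencil_mult_vector: "pencil M0 M1 lam t *v x = M0 t *v x + lam *s (M1 t *v x)"
  by (simp add: pencil_def matrix_vector_mult_def vec_eq_iff sum.distrib sum_distrib_left algebra_simps)

lemma lin_coeff_pencil:
  assumes "lin_coeff a b M0 K0" "lin_coeff a b M1 K1"
  shows "lin_coeff a b (pencil M0 M1 lam) (K0 + cmod lam * K1)"
proof -
  have "AE t in lebesgue_on {a..b}. \<forall>x. norm (M0 t *v x) \<le> K0 * norm x"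
       "AE t in lebesgue_on {a..b}. \<forall>x. norm (M1 t *v x) \<le> K1 * norm x"
    using assms unfolding lin_coeff_def by auto
  then have "AE t in lebesgue_on {a..b}. \<forall>x. norm (pencil M0 M1 lam t *v x) \<le> (K0 + cmod lam * K1) * norm x"
  proof eventually_elim
    case (elim t)
    show ?case
    proof
      fix x
      have "norm (pencil M0 M1 lam t *v x) \<le> norm (M0 t *v x) + cmod lam * norm (M1 t *v x)"
        unfolding pencil_mult_vector by (metis norm_triangle_ineq norm_vector_smult)
      also have "\<dots> \<le> K0 * norm x + cmod lam * (K1 * norm x)"
        using elim by (intro add_mono mult_left_mono) auto
      finally show "norm (pencil M0 M1 lam t *v x) \<le> (K0 + cmod lam * K1) * norm x"
        by (simp add: algebra_simps)
    qed
  qed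
  moreover have "(\<lambda>t. pencil M0 M1 lam t $ i $ j) \<in> borel_measurable (lebesgue_on {a..b})" for i j
    using assms unfolding lin_coeff_def pencil_def vec_lambda_beta
    by (intro borel_measurable_add borel_measurable_times) auto
  ultimately show ?thesis using assms unfolding lin_coeff_def by simp
qed

text \<open>A change of parameter becomes a forcing term, so solutions for different parameters can
  be subtracted within one system.\<close>

lemma lin_sol_pencil_shift:
  assumes "lin_sol a b (pencil M0 M1 mu) f u"
  shows "lin_sol a b (pencil M0 M1 lam) (\<lambda>t. f t + (mu - lam) *s (M1 t *v u t)) u"
proof -
  have "pencil M0 M1 mu t *v u t + f t = pencil M0 M1 lam t *v u t + (f t + (mu - lam) *s (M1 t *v u t))" for t
    unfolding pencil_mult_vector by (simp add: vec_eq_iff algebra_simps)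
  then show ?thesis using assms unfolding lin_sol_def by (simp only:)
qed

text \<open>Two applications of the norm bound. The difference of the solutions at \<open>mu\<close>
  and \<open>lam\<close> has forcing \<open>(mu - lam) *s (M1 t *v u mu t)\<close>, so it is of
  first order. Subtracting \<open>(mu - lam) *s w\<close> leaves the forcing \<open>M1\<close> times
  that difference, again multiplied by \<open>mu - lam\<close>, so the remainder is of second
  order.\<close>

theorem lin_sol_pencil_has_field_derivative:
  assumes M0: "lin_coeff a b M0 K0" and M1: "lin_coeff a b M1 K1" and ab: "a \<le> b"
    and u: "\<And>mu. lin_sol a b (pencil M0 M1 mu) (\<lambda>_. 0) (u mu)" "\<And>mu. u mu a = u0"
    and w: "lin_sol a b (pencil M0 M1 lam) (\<lambda>t. M1 t *v u lam t) w" "w a = 0"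
    and t: "t \<in> {a..b}"
  shows "((\<lambda>mu. u mu t $ i) has_field_derivative w t $ i) (at lam)"
proof -
  \<comment> \<open>\<open>L\<close> dominates the system matrices for all \<open>mu\<close> within
    distance 1 of \<open>lam\<close>, so the exponential factor \<open>E\<close> is uniform
    there.\<close>
  define L where "L = K0 + (cmod lam + 1) * K1"
  define E where "E = exp (L * (b - a))"
  have K: "K0 \<ge> 0" "K1 \<ge> 0" using M0 M1 unfolding lin_coeff_def by auto
  have pc: "lin_coeff a b (pencil M0 M1 mu) L" if "cmod (mu - lam) < 1" for mu
  proof (rule lin_coeff_mono[OF lin_coeff_pencil[OF M0 M1]])
    have "cmod mu \<le> cmod lam + 1" using that norm_triangle_ineq[of "mu - lam" lam] by simp
    then show "K0 + cmod mu * K1 \<le> L" unfolding L_def using K by (intro add_left_mono mult_right_mono)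
  qed
  have pl: "lin_coeff a b (pencil M0 M1 lam) L" using pc[of lam] by simp
  \<comment> \<open>\<open>S\<close> bounds the solutions near \<open>lam\<close>, \<open>D\<close>
    the first differences divided by \<open>cmod (mu - lam)\<close>, and \<open>Z\<close> the
    remainder divided by its square.\<close>
  define S where "S = norm u0 * E"
  define D where "D = K1 * S * (b - a) * E"
  define Z where "Z = K1 * D * (b - a) * E"
  have "S \<ge> 0" unfolding S_def E_def by simp
  then have "D \<ge> 0" unfolding D_def E_def using K ab by simp
  have main: "norm (u mu t - u lam t - (mu - lam) *s w t) \<le> cmod (mu - lam) * (cmod (mu - lam) * Z)"
    if mu: "cmod (mu - lam) < 1" for mu
  proof -
    define d where "d = (\<lambda>t. u mu t + (- 1) *s u lam t)"
    have uS: "norm (u mu s) \<le> S" if "s \<in> {a..b}" for s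
      using lin_sol_norm_bound[OF pc[OF mu] u(1), of 0 s] that unfolding S_def E_def by (simp add: u(2))
    have "lin_sol a b (pencil M0 M1 lam) (\<lambda>t. (0 + (mu - lam) *s (M1 t *v u mu t)) + (- 1) *s 0) d"
      unfolding d_def by (intro lin_sol_add_smult lin_sol_pencil_shift u)
    then have ld: "lin_sol a b (pencil M0 M1 lam) (\<lambda>t. (mu - lam) *s (M1 t *v u mu t)) d" by simp
    have dD: "norm (d s) \<le> cmod (mu - lam) * D" if s: "s \<in> {a..b}" for s
    proof -
      have "AE t in lebesgue_on {a..b}. norm (M1 t *v u mu t) \<le> K1 * S"
        by (rule lin_coeff_bound[OF M1 uS])
      then have "AE t in lebesgue_on {a..b}. norm ((mu - lam) *s (M1 t *v u mu t)) \<le> cmod (mu - lam) * (K1 * S)"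
        by eventually_elim (unfold norm_vector_smult, intro mult_left_mono, auto)
      from lin_sol_norm_bound[OF pl ld this _ s]
      show ?thesis using K \<open>S \<ge> 0\<close> by (simp add: d_def u(2) vec_eq_iff D_def E_def mult_ac)
    qed
    have "lin_sol a b (pencil M0 M1 lam) (\<lambda>t. (mu - lam) *s (M1 t *v u mu t) + (- (mu - lam)) *s (M1 t *v u lam t))
        (\<lambda>t. d t + (- (mu - lam)) *s w t)"
      by (rule lin_sol_add_smult[OF ld w(1)])
    also have "(\<lambda>t. (mu - lam) *s (M1 t *v u mu t) + (- (mu - lam)) *s (M1 t *v u lam t)) =
       (\<lambda>t. (mu - lam) *s (M1 t *v d t))"
      unfolding d_def by (simp add: vec.add vec.scale vec_eq_iff fun_eq_iff algebra_simps)
    finally have le: "lin_sol a b (pencil M0 M1 lam) (\<lambda>t. (mu - lam) *s (M1 t *v d t)) (\<lambda>t. d t + (- (mu - lam)) *s w t)" .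
    have "AE t in lebesgue_on {a..b}. norm (M1 t *v d t) \<le> K1 * (cmod (mu - lam) * D)"
      by (rule lin_coeff_bound[OF M1 dD])
    then have "AE t in lebesgue_on {a..b}. norm ((mu - lam) *s (M1 t *v d t)) \<le> cmod (mu - lam) * (K1 * (cmod (mu - lam) * D))"
      by eventually_elim (unfold norm_vector_smult, intro mult_left_mono, auto)
    from lin_sol_norm_bound[OF pl le this _ t]
    have "norm (d t + (- (mu - lam)) *s w t) \<le> cmod (mu - lam) * (cmod (mu - lam) * Z)"
      using K \<open>D \<ge> 0\<close> by (simp add: d_def u(2) w(2) vec_eq_iff Z_def E_def mult_ac)
    also have "d t + (- (mu - lam)) *s w t = u mu t - u lam t - (mu - lam) *s w t"
      unfolding d_def by (simp add: vec_eq_iff)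
    finally show ?thesis .
  qed
  have quot: "norm ((u mu t $ i - u lam t $ i) / (mu - lam) - w t $ i) \<le> cmod (mu - lam) * Z"
    if mu: "cmod (mu - lam) < 1" "mu \<noteq> lam" for mu
  proof -
    have "(u mu t $ i - u lam t $ i) / (mu - lam) - w t $ i = (u mu t - u lam t - (mu - lam) *s w t) $ i / (mu - lam)"
      using mu by (simp add: field_simps)
    also have "norm \<dots> \<le> norm (u mu t - u lam t - (mu - lam) *s w t) / cmod (mu - lam)"
      unfolding norm_divide by (intro divide_right_mono Finite_Cartesian_Product.norm_nth_le) simp
    also have "\<dots> \<le> cmod (mu - lam) * (cmod (mu - lam) * Z) / cmod (mu - lam)"
      by (intro divide_right_mono main mu) auto
    finally show ?thesis using mu by simp
  qed
  have "((\<lambda>mu. (u mu t $ i - u lam t $ i) / (mu - lam) - w t $ i) \<longlongrightarrow> 0) (at lam)"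
  proof (rule Lim_null_comparison[where g = "\<lambda>mu. cmod (mu - lam) * Z"])
    show "\<forall>\<^sub>F mu in at lam. norm ((u mu t $ i - u lam t $ i) / (mu - lam) - w t $ i) \<le> cmod (mu - lam) * Z"
      unfolding eventually_at using quot by (intro exI[of _ 1]) (auto simp: dist_norm)
    have "((\<lambda>mu. cmod (mu - lam) * Z) \<longlongrightarrow> cmod (lam - lam) * Z) (at lam)"
      by (intro tendsto_intros)
    then show "((\<lambda>mu. cmod (mu - lam) * Z) \<longlongrightarrow> 0) (at lam)" by simp
  qed
  then show ?thesis
    unfolding has_field_derivative_iff by (rule LIM_zero_cancel)
qed

subsection \<open>The determinant of a holomorphic matrix family\<close>

text \<open>Among the derivatives of \<open>(w - z) ^ m\<close> at \<open>z\<close> of order at most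
  \<open>m\<close> only the last is nonzero, so Leibniz' rule leaves \<open>fact m * h z\<close> at
  order \<open>m\<close> and nothing below.\<close>

lemma zero_order_power_mult:
  assumes "h holomorphic_on UNIV" "h z \<noteq> 0" "\<And>w. f w = (w - z) ^ m * h w"
  shows "zero_order f z m"
proof -
  have f: "f = (\<lambda>w. (w - z) ^ m * h w)" using assms(3) by blast
  have pow: "(deriv ^^ i) (\<lambda>w. (w - z) ^ m) z = (if i = m then fact m else 0)" if "i \<le> m" for i
    using that by (simp add: higher_deriv_power pochhammer_fact)
  have eq: "(deriv ^^ j) f z = (\<Sum>i = 0..j. of_nat (j choose i) * (if i = m then fact m else 0) * (deriv ^^ (j - i)) h z)"
    if "j \<le> m" for j
  proof -
    have "(deriv ^^ j) f z = (\<Sum>i = 0..j. of_nat (j choose i) * (deriv ^^ i) (\<lambda>w. (w - z) ^ m) z * (deriv ^^ (j - i)) h z)"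
      unfolding f by (rule higher_deriv_mult[where S = UNIV]) (use assms in \<open>auto intro!: holomorphic_intros\<close>)
    also have "\<dots> = (\<Sum>i = 0..j. of_nat (j choose i) * (if i = m then fact m else 0) * (deriv ^^ (j - i)) h z)"
      by (rule sum.cong) (use that pow in auto)
    finally show ?thesis .
  qed
  have "(deriv ^^ j) f z = 0" if "j < m" for j
    using eq[of j] that by (auto intro!: sum.neutral)
  moreover have "(deriv ^^ m) f z = fact m * h z"
  proof -
    have "(deriv ^^ m) f z = (\<Sum>i\<in>{m}. of_nat (m choose i) * (if i = m then fact m else 0) * (deriv ^^ (m - i)) h z)"
      unfolding eq[OF order_refl] by (rule sum.mono_neutral_right) auto
    then show ?thesis by simp
  qed
  ultimately show ?thesis unfolding zero_order_def using assms(2) by simp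
qed

lemma holomorphic_on_det:
  fixes M :: "complex \<Rightarrow> complex^'m^'m"
  assumes "\<And>i j. (\<lambda>z. M z $ i $ j) holomorphic_on S"
  shows "(\<lambda>z. det (M z)) holomorphic_on S"
  unfolding det_def by (intro holomorphic_intros assms)

text \<open>\<open>nd\<close> says that \<open>D'\<close> sends no nonzero kernel vector into the
  range of \<open>D z0\<close>. When this fails the order can exceed the kernel dimension, as for
  the scalar family \<open>z ^ 2\<close> at 0.\<close>

theorem zero_order_det_eq_dim_kernel:
  fixes D :: "complex \<Rightarrow> complex^'m^'m"
  assumes hol: "\<And>i j. (\<lambda>z. D z $ i $ j) holomorphic_on UNIV"
    and der: "\<And>i j. ((\<lambda>z. D z $ i $ j) has_field_derivative D' $ i $ j) (at z0)"
    and nd: "\<And>u v. D z0 *v u = 0 \<Longrightarrow> D' *v u + D z0 *v v = 0 \<Longrightarrow> u = 0"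
  shows "zero_order (\<lambda>z. det (D z)) z0 (vec.dim {u. D z0 *v u = 0})"
proof -
  define S where "S = {u. D z0 *v u = 0}"
  have S: "vec.subspace S"
    unfolding vec.subspace_def S_def
    by (auto simp: vec.add vec.scale)
  obtain Bk where Bk: "Bk \<subseteq> S" "vec.independent Bk" "S \<subseteq> vec.span Bk" "card Bk = vec.dim S"
    using vec.basis_exists by blast
  obtain Bf where Bf: "Bk \<subseteq> Bf" "Bf \<subseteq> UNIV" "vec.independent Bf" "UNIV \<subseteq> vec.span Bf"
    by (rule vec.maximal_independent_subset_extend[OF subset_UNIV Bk(2)])
  have fin: "finite Bf" by (rule vec.finiteI_independent[OF Bf(3)])
  have "card Bf = vec.dim (UNIV :: (complex^'m) set)"
    by (metis Bf(3,4) vec.dim_eq_card vec.span_UNIV top.extremum_uniqueI)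
  then have "card Bf = CARD('m)" by (simp only: vec_dim_card)
  then obtain c :: "'m \<Rightarrow> complex^'m" where c: "bij_betw c UNIV Bf"
    using finite_same_card_bij[of "UNIV :: 'm set" Bf] fin by auto
  define K where "K = {j. c j \<in> Bk}"
  have cK: "c ` K = Bk" using c Bf(1) unfolding K_def bij_betw_def by blast
  have inj: "inj c" using c unfolding bij_betw_def by blast
  have cardK: "card K = vec.dim S"
    using cK inj Bk(4) by (metis card_image inj_on_subset subset_UNIV)
  have indep: "x j = 0" if "(\<Sum>j\<in>UNIV. x j *s c j) = 0" for x j
  proof -
    have sum0: "(\<Sum>v\<in>Bf. x (inv c v) *s v) = 0"
      using that sum.reindex_bij_betw[OF c, of "\<lambda>v. x (inv c v) *s v"] inj by simp
    have Bf0: "r v = 0" if "(\<Sum>v\<in>Bf. r v *s v) = 0" "v \<in> Bf" for r v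
      using that Bf(3) unfolding vec.dependent_finite[OF fin] by blast
    have "x (inv c (c j)) = 0"
      by (rule Bf0[OF sum0]) (use c in \<open>auto simp: bij_betw_def\<close>)
    then show ?thesis using inj by simp
  qed
  define C where "C = (\<chi> i j. c j $ i)"
  have Cv: "C *v x = (\<Sum>j\<in>UNIV. x $ j *s c j)" for x
    unfolding C_def by (simp add: vec_eq_iff matrix_vector_mult_def mult.commute)
  have "\<exists>B. B ** C = mat 1"
    unfolding matrix_left_invertible_ker using indep Cv by (metis vec_eq_iff zero_index)
  then have detC: "det C \<noteq> 0" by (simp add: invertible_left_inverse flip: invertible_det_nz)
  define f where "f = (\<lambda>j i z. (D z *v c j) $ i)"
  have f_hol: "f j i holomorphic_on UNIV" for i j
    unfolding f_def matrix_vector_mult_def by (auto intro!: holomorphic_intros hol)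
  have f_der: "(f j i has_field_derivative (D' *v c j) $ i) (at z0)" for i j
    unfolding f_def matrix_vector_mult_def by (auto intro!: derivative_eq_intros der)
  have f0: "f j i z0 = 0" if "j \<in> K" for i j
    using that Bk(1) unfolding K_def f_def S_def by auto
  \<comment> \<open>The transformed columns are stored as rows, because \<open>det_rows_mul\<close>
    extracts scalars from rows. The value at \<open>z0\<close> is the limit of the quotient, which
    fills a removable singularity.\<close>
  define E where "E = (\<lambda>z. \<chi> j i. if j \<in> K then (if z = z0 then (D' *v c j) $ i else f j i z / (z - z0)) else f j i z)"
  have E_hol: "(\<lambda>z. E z $ j $ i) holomorphic_on UNIV" for i j
  proof (cases "j \<in> K")
    case True
    have "(\<lambda>z. if z = z0 then deriv (f j i) z0 else (f j i z - f j i z0) / (z - z0)) holomorphic_on UNIV"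
      by (rule pole_lemma) (auto simp: f_hol)
    then show ?thesis unfolding f0[OF True] DERIV_imp_deriv[OF f_der] diff_zero using True by (simp add: E_def)
  next
    case False
    then show ?thesis by (simp add: E_def f_hol)
  qed
  have detE: "det (D z) * det C = (z - z0) ^ card K * det (E z)" for z
  proof -
    have "transpose (D z ** C) = (\<chi> j. (if j \<in> K then z - z0 else 1) *s (E z $ j))"
      using f0 by (auto simp: vec_eq_iff transpose_def E_def f_def C_def matrix_matrix_mult_def matrix_vector_mult_def)
    then have "det (D z) * det C = (\<Prod>j\<in>UNIV. if j \<in> K then z - z0 else 1) * det (\<chi> j. E z $ j)"
      by (metis det_mul det_rows_mul det_transpose)
    also have "(\<chi> j. E z $ j) = E z" by (simp add: vec_eq_iff)
    also have "(\<Prod>j\<in>UNIV. if j \<in> K then z - z0 else 1) = (z - z0) ^ card K"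
      by (simp add: prod.If_cases)
    finally show ?thesis .
  qed
  have "det (E z0) \<noteq> 0"
  proof
    assume "det (E z0) = 0"
    then have "\<not> (\<exists>B. B ** transpose (E z0) = mat 1)"
      by (metis det_transpose invertible_det_nz invertible_left_inverse)
    then obtain x where x: "transpose (E z0) *v x = 0" "x \<noteq> 0"
      unfolding matrix_left_invertible_ker by blast
    \<comment> \<open>A null vector of the transpose of \<open>E z0\<close> splits along
      \<open>K\<close> into the relation \<open>D' *v u + D z0 *v v = 0\<close>, with
      \<open>u\<close> in the kernel and \<open>v\<close> in the span of the complementary basis
      vectors.\<close>
    define u where "u = (\<Sum>j\<in>K. x $ j *s c j)"
    define v where "v = (\<Sum>j\<in>-K. x $ j *s c j)"
    have uS: "u \<in> S" unfolding u_def
      by (intro vec.subspace_sum[OF S] vec.subspace_scale[OF S]) (use Bk(1) K_def in auto)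
    have "(D' *v u + D z0 *v v) $ i = (transpose (E z0) *v x) $ i" for i
    proof -
      have "(transpose (E z0) *v x) $ i = (\<Sum>j\<in>UNIV. E z0 $ j $ i * x $ j)"
        by (simp add: matrix_vector_mult_def transpose_def)
      also have "\<dots> = (\<Sum>j\<in>K. E z0 $ j $ i * x $ j) + (\<Sum>j\<in>-K. E z0 $ j $ i * x $ j)"
        using sum.subset_diff[of K UNIV "\<lambda>j. E z0 $ j $ i * x $ j"] by (simp add: Compl_eq_Diff_UNIV add.commute)
      also have "(\<Sum>j\<in>K. E z0 $ j $ i * x $ j) = (\<Sum>j\<in>K. (D' *v (x $ j *s c j)) $ i)"
        by (rule sum.cong) (auto simp: E_def vec.scale)
      also have "\<dots> = (D' *v u) $ i" unfolding u_def by (simp add: vec.sum)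
      also have "(\<Sum>j\<in>-K. E z0 $ j $ i * x $ j) = (\<Sum>j\<in>-K. (D z0 *v (x $ j *s c j)) $ i)"
        by (rule sum.cong) (auto simp: E_def f_def vec.scale)
      also have "\<dots> = (D z0 *v v) $ i" unfolding v_def by (simp add: vec.sum)
      finally show ?thesis by simp
    qed
    then have eq: "D' *v u + D z0 *v v = 0" using x(1) by (metis vec_eq_iff)
    \<comment> \<open>Once \<open>nd\<close> kills \<open>u\<close>, \<open>v\<close> lies in the
      kernel as well; being also a combination of basis vectors off \<open>K\<close>, it must have
      zero coefficients by independence.\<close>
    have u0: "u = 0" using nd[OF _ eq] uS unfolding S_def by blast
    then have "v \<in> S" using eq unfolding S_def by simp
    then have "v \<in> vec.span Bk" using Bk(3) by blast
    then obtain r where "v = (\<Sum>w\<in>Bk. r w *s w)"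
      using vec.span_finite[of Bk] finite_subset[OF Bf(1) fin] by auto
    also have "\<dots> = (\<Sum>j\<in>K. r (c j) *s c j)"
      unfolding cK[symmetric] by (subst sum.reindex) (use inj in \<open>auto intro: inj_on_subset\<close>)
    finally have v: "v = (\<Sum>j\<in>K. r (c j) *s c j)" .
    have split: "(\<Sum>j\<in>UNIV. g j *s c j) = (\<Sum>j\<in>K. g j *s c j) + (\<Sum>j\<in>-K. g j *s c j)" for g
      using sum.subset_diff[of K UNIV "\<lambda>j. g j *s c j"] by (simp add: Compl_eq_Diff_UNIV add.commute)
    have "(\<Sum>j\<in>UNIV. (if j \<in> K then x $ j else 0) *s c j) = u"
      unfolding split u_def by simp
    then have xK: "x $ j = 0" if "j \<in> K" for j
      using indep[of "\<lambda>j. if j \<in> K then x $ j else 0" j] u0 that by simp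
    have "(\<Sum>j\<in>UNIV. (if j \<in> K then - r (c j) else x $ j) *s c j) = - v + v"
    proof -
      have "(\<Sum>j\<in>K. (if j \<in> K then - r (c j) else x $ j) *s c j) = - v"
        unfolding v sum_negf[symmetric] by (rule sum.cong) auto
      moreover have "(\<Sum>j\<in>-K. (if j \<in> K then - r (c j) else x $ j) *s c j) = v"
        unfolding v_def by (rule sum.cong) auto
      ultimately show ?thesis unfolding split by simp
    qed
    then have xnK: "x $ j = 0" if "j \<notin> K" for j
      using indep[of "\<lambda>j. if j \<in> K then - r (c j) else x $ j" j] that by simp
    from xK xnK have "x = 0" by (metis vec_eq_iff zero_index)
    with x(2) show False by simp
  qed
  moreover have "(\<lambda>z. det (E z) / det C) holomorphic_on UNIV"
    using detC by (intro holomorphic_intros holomorphic_on_det E_hol)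
  moreover have "det (D z) = (z - z0) ^ card K * (det (E z) / det C)" for z
    using detE[of z] detC by (simp add: field_simps)
  ultimately have "zero_order (\<lambda>z. det (D z)) z0 (card K)"
    using detC by (intro zero_order_power_mult[where h = "\<lambda>z. det (E z) / det C"]) auto
  then show ?thesis unfolding cardK S_def .
qed

subsection \<open>Self-adjoint boundary conditions\<close>

text \<open>Conjugate-linear in the first argument, so the integrand of the inner product of
  \<open>y\<close> and \<open>z\<close> in L^2_W is
  \<open>csp (z t) (cmat (W t) *v y t)\<close>.\<close>

definition csp :: "complex^'k \<Rightarrow> complex^'k \<Rightarrow> complex" where
  "csp x y = (\<Sum>i\<in>UNIV. cnj (x $ i) * y $ i)"

lemma csp_add_left: "csp (x + x') y = csp x y + csp x' y"
  and csp_add_right: "csp x (y + y') = csp x y + csp x y'"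
  and csp_diff_left: "csp (x - x') y = csp x y - csp x' y"
  and csp_diff_right: "csp x (y - y') = csp x y - csp x y'"
  and csp_minus_left: "csp (- x) y = - csp x y"
  and csp_minus_right: "csp x (- y) = - csp x y"
  and csp_smult_left: "csp (c *s x) y = cnj c * csp x y"
  and csp_smult_right: "csp x (c *s y) = c * csp x y"
  and csp_zero_left [simp]: "csp 0 y = 0"
  and csp_zero_right [simp]: "csp x 0 = 0"
  unfolding csp_def
  by (simp_all add: algebra_simps sum.distrib sum_subtractf sum_negf sum_distrib_left)

lemma norm_csp_le: "norm (csp x y) \<le> norm x * norm y"
proof -
  have "norm (csp x y) \<le> (\<Sum>i\<in>UNIV. \<bar>norm (x $ i)\<bar> * \<bar>norm (y $ i)\<bar>)"
    unfolding csp_def by (rule order_trans[OF norm_sum]) (simp add: norm_mult)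
  also have "\<dots> \<le> norm x * norm y"
    unfolding norm_vec_def by (rule L2_set_mult_ineq)
  finally show ?thesis .
qed

text \<open>\<open>bounded_bilinear\<close> means real bilinearity, so the conjugation in the first
  slot is harmless and the product rule applies to \<open>csp\<close>.\<close>

lemma bounded_bilinear_csp: "bounded_bilinear csp"
proof
  show "\<exists>K. \<forall>x y :: complex^'k. norm (csp x y) \<le> norm x * norm y * K"
    using norm_csp_le by (intro exI[of _ 1]) auto
  show "csp (r *\<^sub>R x) y = r *\<^sub>R csp x y" for r and x y :: "complex^'k"
    unfolding csp_def by (simp add: scaleR_sum_right)
  show "csp x (r *\<^sub>R y) = r *\<^sub>R csp x y" for r and x y :: "complex^'k"
    unfolding csp_def by (simp add: scaleR_sum_right)
qed (simp_all add: csp_add_left csp_add_right)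

lemma csp_self: "csp x x = complex_of_real ((norm x)\<^sup>2)"
proof -
  have "(norm x)\<^sup>2 = (\<Sum>i\<in>UNIV. (cmod (x $ i))\<^sup>2)"
    unfolding norm_vec_def L2_set_def by (simp add: sum_nonneg)
  then show ?thesis
    unfolding csp_def by (simp add: complex_norm_square mult.commute del: of_real_power)
qed

lemma csp_adjoint: "csp (adjoint_mat A *v x) y = csp x (A *v y)"
proof -
  have "csp (adjoint_mat A *v x) y = (\<Sum>i\<in>UNIV. \<Sum>j\<in>UNIV. A $ j $ i * cnj (x $ j) * y $ i)"
    unfolding csp_def adjoint_mat_def matrix_vector_mult_def by (simp add: sum_distrib_right)
  also have "\<dots> = (\<Sum>j\<in>UNIV. \<Sum>i\<in>UNIV. A $ j $ i * cnj (x $ j) * y $ i)" by (rule sum.swap)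
  also have "\<dots> = csp x (A *v y)"
    unfolding csp_def matrix_vector_mult_def by (simp add: sum_distrib_left mult_ac)
  finally show ?thesis .
qed

lemma csp_cmat_symmetric:
  assumes "transpose S = S"
  shows "csp (cmat S *v x) y = csp x (cmat S *v y)"
proof -
  have "S $ i $ j = S $ j $ i" for i j
    using assms by (metis transpose_def vec_lambda_beta)
  then have "adjoint_mat (cmat S) = cmat S"
    by (simp add: adjoint_mat_def cmat_def vec_eq_iff)
  then show ?thesis by (metis csp_adjoint)
qed

text \<open>Coercivity is given for real vectors only. For x = p + iq the cross terms of the form
  are purely imaginary, so its real part is the sum of the real forms at p and q.\<close>

lemma Re_csp_cmat_ge:
  fixes S :: "real^'k^'k"
  assumes "\<And>v. \<mu> * (v \<bullet> v) \<le> v \<bullet> (S *v v)"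
  shows "\<mu> * (norm x)\<^sup>2 \<le> Re (csp x (cmat S *v x))"
proof -
  define p q where "p = (\<chi> i. Re (x $ i))" and "q = (\<chi> i. Im (x $ i))"
  have "Re (csp x (cmat S *v x)) = p \<bullet> (S *v p) + q \<bullet> (S *v q)"
    unfolding csp_def cmat_def matrix_vector_mult_def inner_vec_def p_def q_def
    by (simp add: sum.distrib sum_distrib_left algebra_simps)
  moreover have "(norm x)\<^sup>2 = p \<bullet> p + q \<bullet> q"
    unfolding norm_vec_def L2_set_def inner_vec_def p_def q_def
    by (simp add: sum_nonneg cmod_power2 sum.distrib flip: power2_eq_square)
  ultimately show ?thesis using assms[of p] assms[of q] by (simp add: distrib_left)
qed

text \<open>Since \<open>(A + iB)(A + iB)\<^sup>* = AA\<^sup>* + BB\<^sup>*\<close> when \<open>AB\<^sup>* = BA\<^sup>*\<close>, both \<open>A \<plusminus> iB\<close> are invertible.\<close>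

lemma sa_bc_left_kernel:
  fixes A B :: "complex^('n::finite + 'n)^('n + 'n)"
  assumes "sa_bc A B" "c = \<i> \<or> c = - \<i>"
    and v: "adjoint_mat A *v v + c *s (adjoint_mat B *v v) = 0"
  shows "v = 0"
proof -
  define x y where "x = adjoint_mat A *v v" and "y = adjoint_mat B *v v"
  have AB: "A ** adjoint_mat B = B ** adjoint_mat A" using assms(1) unfolding sa_bc_def by blast
  \<comment> \<open>Self-adjointness makes \<open>csp x y\<close> symmetric, so in the square of
    \<open>x + c *s y\<close> the cross terms \<open>c * csp x y\<close> and
    \<open>cnj c * csp y x\<close> cancel.\<close>
  have "csp x y = csp v (A *v y)" unfolding x_def by (rule csp_adjoint)
  also have "A *v y = B *v x" unfolding x_def y_def matrix_vector_mul_assoc AB ..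
  also have "csp v (B *v x) = csp y x" unfolding y_def by (rule csp_adjoint[symmetric])
  finally have xy: "csp x y = csp y x" .
  have cc: "cnj c = - c" "c * c = - 1" using assms(2) by auto
  have "0 = csp (x + c *s y) (x + c *s y)" using v unfolding x_def y_def by simp
  also have "\<dots> = csp x x + csp y y"
    using cc by (simp add: csp_add_left csp_add_right csp_smult_left csp_smult_right xy algebra_simps
        flip: mult.assoc)
  also have "\<dots> = complex_of_real ((norm x)\<^sup>2 + (norm y)\<^sup>2)" by (simp add: csp_self)
  finally have "(norm x)\<^sup>2 + (norm y)\<^sup>2 = 0" by (metis of_real_eq_0_iff)
  then have xy0: "x = 0" "y = 0" by (auto simp: sum_power2_eq_zero_iff)
  \<comment> \<open>Conjugation turns a common null vector of the two adjoints into a common left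
    null vector of \<open>A\<close> and \<open>B\<close>, which the rank condition excludes.\<close>
  define w where "w = (\<chi> i. cnj (v $ i))"
  have adj: "(w v* M) $ j = cnj ((adjoint_mat M *v v) $ j)" for M :: "complex^('n + 'n)^('n + 'n)" and j
    unfolding w_def vector_matrix_mult_def adjoint_mat_def matrix_vector_mult_def by (simp add: mult.commute)
  have "w v* A = 0" "w v* B = 0"
    using xy0 unfolding x_def y_def by (simp_all add: vec_eq_iff adj)
  then have "w = 0" using assms(1) unfolding sa_bc_def by blast
  then show ?thesis unfolding w_def by (simp add: vec_eq_iff)
qed

text \<open>The adjoints parametrise a subspace of the kernel because
  \<open>A ** adjoint_mat B = B ** adjoint_mat A\<close>, and the rank condition leaves no room for
  more. In place of a dimension count, the parameter is computed by inverting \<open>U\<close>, and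
  surjectivity of \<open>U'\<close> shows that the residual vanishes.\<close>

lemma sa_bc_kernel_param:
  assumes bc: "sa_bc A B" and X: "A *v X1 + B *v X2 = 0"
  obtains c where "X1 = adjoint_mat B *v c" "X2 = - (adjoint_mat A *v c)"
proof -
  define U where "U = (\<chi> i j. adjoint_mat A $ i $ j - \<i> * adjoint_mat B $ i $ j)"
  have U: "U *v v = adjoint_mat A *v v + (- \<i>) *s (adjoint_mat B *v v)" for v
    unfolding U_def matrix_vector_mult_def
    by (simp add: vec_eq_iff algebra_simps sum_subtractf sum_distrib_left)
  define U' where "U' = (\<chi> i j. adjoint_mat A $ i $ j + \<i> * adjoint_mat B $ i $ j)"
  have U': "U' *v v = adjoint_mat A *v v + \<i> *s (adjoint_mat B *v v)" for v
    unfolding U'_def matrix_vector_mult_def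
    by (simp add: vec_eq_iff algebra_simps sum.distrib sum_distrib_left)
  have "\<exists>V. V ** U = mat 1" "\<exists>V. V ** U' = mat 1"
    unfolding matrix_left_invertible_ker U U' using sa_bc_left_kernel[OF bc] by blast+
  then obtain V V' where V: "U ** V = mat 1" and V': "U' ** V' = mat 1"
    by (metis matrix_left_right_inverse)
  \<comment> \<open>The desired equations for \<open>X1\<close> and \<open>X2\<close> imply
    \<open>U *v c = - \<i> *s X1 - X2\<close>, which determines \<open>c\<close>.\<close>
  define c where "c = V *v ((- \<i>) *s (X1 - \<i> *s X2))"
  have "U *v c = (- \<i>) *s (X1 - \<i> *s X2)"
    unfolding c_def matrix_vector_mul_assoc V by simp
  then have c: "adjoint_mat A *v c - \<i> *s (adjoint_mat B *v c) = (- \<i>) *s X1 - X2"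
    unfolding U by (simp add: vec_eq_iff algebra_simps)
  define R1 R2 where "R1 = X1 - adjoint_mat B *v c" and "R2 = X2 + adjoint_mat A *v c"
  have R1: "R1 = \<i> *s R2"
  proof -
    have "\<i> *s (adjoint_mat A *v c - \<i> *s (adjoint_mat B *v c)) = \<i> *s ((- \<i>) *s X1 - X2)"
      using c by simp
    then show ?thesis unfolding R1_def R2_def by (simp add: vec_eq_iff algebra_simps)
  qed
  have AB: "A ** adjoint_mat B = B ** adjoint_mat A" using bc unfolding sa_bc_def by blast
  have "A *v R1 + B *v R2 = A *v X1 + B *v X2 - (A ** adjoint_mat B) *v c + (B ** adjoint_mat A) *v c"
    unfolding R1_def R2_def by (simp add: vec.add vec.diff matrix_vector_mul_assoc)
  also have "\<dots> = 0" unfolding X AB by simp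
  finally have R: "A *v R1 + B *v R2 = 0" .
  have "R2 = 0"
  proof -
    \<comment> \<open>Since \<open>R1 = \<i> *s R2\<close>, the kernel equation says that
      \<open>R2\<close> is orthogonal to the range of \<open>U'\<close>, which is the whole
      space.\<close>
    have "csp (U' *v v) R2 = 0" for v
    proof -
      have "csp (U' *v v) R2 = csp v (A *v R2) - \<i> * csp v (B *v R2)"
        unfolding U' by (simp add: csp_add_left csp_smult_left csp_adjoint)
      also have "\<dots> = - \<i> * csp v (A *v R1 + B *v R2)"
        unfolding R1 by (simp add: vec.scale csp_add_right csp_smult_right algebra_simps)
      finally show ?thesis unfolding R by simp
    qed
    from this[of "V' *v R2"] have "csp R2 R2 = 0"
      unfolding matrix_vector_mul_assoc V' by simp
    then show ?thesis by (simp add: csp_self)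
  qed
  then have "R1 = 0" using R1 by simp
  with \<open>R2 = 0\<close> show thesis
    using that[of c] unfolding R1_def R2_def by (simp add: eq_neg_iff_add_eq_0)
qed

lemma sum_UNIV_sum_type:
  fixes f :: "'a::finite + 'b::finite \<Rightarrow> 'c::comm_monoid_add"
  shows "(\<Sum>i\<in>UNIV. f i) = (\<Sum>k\<in>UNIV. f (Inl k)) + (\<Sum>k\<in>UNIV. f (Inr k))"
  unfolding UNIV_Plus_UNIV[symmetric] by (subst sum.Plus) auto

text \<open>Leads from equality modulo null sets to pointwise equality, including the end points,
  where boundary values are read off.\<close>

lemma continuous_AE_zero:
  fixes f :: "real \<Rightarrow> 'v::euclidean_space"
  assumes "a < b" "continuous_on {a..b} f" "AE t in lebesgue_on {a..b}. f t = 0" "t \<in> {a..b}"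
  shows "f t = 0"
proof -
  have "((\<lambda>t. norm (f t)) has_integral 0) {a..b}"
    by (rule has_integral_AE_cong[where f = "\<lambda>_. 0"]) (use assms(3) in auto)
  moreover have "continuous_on {a..b} (\<lambda>t. norm (f t))" by (intro continuous_intros assms)
  ultimately have "norm (f t) = 0"
    using assms integral_eq_0_iff[of a b "\<lambda>t. norm (f t)"] by (metis integral_unique norm_ge_zero)
  then show ?thesis by simp
qed

subsection \<open>Block vectors and matrices\<close>

definition join :: "complex^'n::finite \<Rightarrow> complex^'n \<Rightarrow> complex^('n + 'n)" where
  "join x y = (\<chi> i. case i of Inl k \<Rightarrow> x $ k | Inr k \<Rightarrow> y $ k)"

definition upper :: "complex^('n::finite + 'n) \<Rightarrow> complex^'n" where
  "upper u = (\<chi> k. u $ Inl k)"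

definition lower :: "complex^('n::finite + 'n) \<Rightarrow> complex^'n" where
  "lower u = (\<chi> k. u $ Inr k)"

lemma join_nth [simp]: "join x y $ Inl k = x $ k" "join x y $ Inr k = y $ k"
  by (simp_all add: join_def)

lemma upper_lower_nth [simp]: "upper u $ k = u $ Inl k" "lower u $ k = u $ Inr k"
  by (simp_all add: upper_def lower_def)

lemma vec_eq_sum_type_iff: "u = v \<longleftrightarrow> (\<forall>k. u $ Inl k = v $ Inl k) \<and> (\<forall>k. u $ Inr k = v $ Inr k)"
  unfolding vec_eq_iff by (metis sum.exhaust)

lemma join_upper_lower [simp]: "join (upper u) (lower u) = u"
  by (simp add: vec_eq_sum_type_iff)

lemma upper_lower_join [simp]: "upper (join x y) = x" "lower (join x y) = y"
  by (simp_all add: vec_eq_iff)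

lemma bounded_linear_blocks:
  "bounded_linear (upper :: complex^('n::finite + 'n) \<Rightarrow> _)"
  "bounded_linear (lower :: complex^('n::finite + 'n) \<Rightarrow> _)"
  "bounded_linear (\<lambda>x :: complex^'n. join x 0)"
  "bounded_linear (\<lambda>x :: complex^'n. join 0 x)"
proof -
  have "linear (upper :: complex^('n + 'n) \<Rightarrow> _)" "linear (lower :: complex^('n + 'n) \<Rightarrow> _)"
    by (rule linearI; simp add: vec_eq_iff)+
  moreover have "linear (\<lambda>x :: complex^'n. join x 0)" "linear (\<lambda>x :: complex^'n. join 0 x)"
    by (rule linearI; simp add: vec_eq_sum_type_iff)+
  ultimately show "bounded_linear (upper :: complex^('n + 'n) \<Rightarrow> _)"
    "bounded_linear (lower :: complex^('n + 'n) \<Rightarrow> _)"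
    "bounded_linear (\<lambda>x :: complex^'n. join x 0)" "bounded_linear (\<lambda>x :: complex^'n. join 0 x)"
    by (simp_all only: linear_conv_bounded_linear)
qed

lemma join_split: "join x y = join x 0 + join 0 y"
  by (simp add: vec_eq_sum_type_iff)

lemma upper_lower_linear:
  "upper (u + v) = upper u + upper v" "lower (u + v) = lower u + lower v"
  "upper (c *s u) = c *s upper u" "lower (c *s u) = c *s lower u"
  "upper (\<Sum>j\<in>J. U j) = (\<Sum>j\<in>J. upper (U j))" "lower (\<Sum>j\<in>J. U j) = (\<Sum>j\<in>J. lower (U j))"
  by (simp_all add: vec_eq_iff)

lemma cmat_mult: "cmat (M ** N) = cmat M ** cmat N"
  by (simp add: cmat_def matrix_matrix_mult_def vec_eq_iff)

lemma cmat_mat_1: "cmat (mat 1) = mat 1"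
  by (simp add: cmat_def mat_def vec_eq_iff)

lemma norm_matrix_vector_le:
  fixes M :: "complex^'m::finite^'m"
  assumes "\<And>i j. norm (M $ i $ j) \<le> C"
  shows "norm (M *v x) \<le> real CARD('m) * (real CARD('m) * C) * norm x"
proof -
  have "norm (M *v x) \<le> (\<Sum>i\<in>UNIV. norm ((M *v x) $ i))"
    unfolding norm_vec_def by (rule L2_set_le_sum) simp
  also have "\<dots> \<le> (\<Sum>i\<in>(UNIV::'m set). real CARD('m) * C * norm x)"
  proof (rule sum_mono)
    fix i
    have "norm ((M *v x) $ i) \<le> (\<Sum>j\<in>UNIV. norm (M $ i $ j) * norm (x $ j))"
      unfolding matrix_vector_mult_def vec_lambda_beta norm_mult[symmetric] by (rule norm_sum)
    also have "\<dots> \<le> (\<Sum>j\<in>(UNIV::'m set). C * norm x)"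
      by (intro sum_mono mult_mono' assms Finite_Cartesian_Product.norm_nth_le) auto
    finally show "norm ((M *v x) $ i) \<le> real CARD('m) * C * norm x" by simp
  qed
  finally show ?thesis by simp
qed

lemma lin_coeff_bounded_entries:
  fixes M :: "real \<Rightarrow> complex^'m::finite^'m"
  assumes "\<And>i j. (\<lambda>t. M t $ i $ j) \<in> borel_measurable (lebesgue_on {a..b})" "C \<ge> 0"
    and "AE t in lebesgue_on {a..b}. \<forall>i j. norm (M t $ i $ j) \<le> C"
  shows "lin_coeff a b M (real CARD('m) * (real CARD('m) * C))"
  unfolding lin_coeff_def
proof (intro conjI)
  show "AE t in lebesgue_on {a..b}. \<forall>x. norm (M t *v x) \<le> real CARD('m) * (real CARD('m) * C) * norm x"
    using assms(3) by eventually_elim (blast intro: norm_matrix_vector_le)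
qed (use assms in auto)

subsection \<open>The inverse of a coercive matrix\<close>

text \<open>Cramer's formula, in place of \<^const>\<open>matrix_inv\<close>, makes the inverse visibly measurable.\<close>

definition cramer_inv :: "real^'n::finite^'n \<Rightarrow> real^'n^'n" where
  "cramer_inv M = (\<chi> k l. det (\<chi> i j. if j = k then axis l 1 $ i else M $ i $ j) / det M)"

lemma cramer_inv:
  fixes M :: "real^'n::finite^'n"
  assumes "det M \<noteq> 0"
  shows "M ** cramer_inv M = mat 1" "cramer_inv M ** M = mat 1"
proof -
  have "M *v (\<chi> k. cramer_inv M $ k $ l) = axis l 1" for l
    using cramer[OF assms, of "\<chi> k. cramer_inv M $ k $ l" "axis l 1"]
    by (simp add: cramer_inv_def vec_eq_iff)
  then have "(M ** cramer_inv M) $ i $ l = mat 1 $ i $ l" for i l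
    by (simp add: matrix_matrix_mult_def matrix_vector_mult_def vec_eq_iff axis_def mat_def)
  then show "M ** cramer_inv M = mat 1" by (simp add: vec_eq_iff)
  then show "cramer_inv M ** M = mat 1" by (simp add: matrix_left_right_inverse)
qed

lemma borel_measurable_det:
  fixes M :: "'a \<Rightarrow> real^'n::finite^'n"
  assumes "\<And>i j. (\<lambda>t. M t $ i $ j) \<in> borel_measurable N"
  shows "(\<lambda>t. det (M t)) \<in> borel_measurable N"
  unfolding det_def
  by (intro borel_measurable_sum borel_measurable_times borel_measurable_prod borel_measurable_const assms)

lemma borel_measurable_cramer_inv:
  fixes M :: "'a \<Rightarrow> real^'n::finite^'n"
  assumes "\<And>i j. (\<lambda>t. M t $ i $ j) \<in> borel_measurable N"
  shows "(\<lambda>t. cramer_inv (M t) $ k $ l) \<in> borel_measurable N"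
proof -
  have "(\<lambda>t. (\<chi> i j. if j = k then axis l 1 $ i else M t $ i $ j :: real^'n^'n) $ i $ j) \<in> borel_measurable N" for i j
    using assms by (cases "j = k") auto
  then show ?thesis
    unfolding cramer_inv_def vec_lambda_beta
    by (intro borel_measurable_divide borel_measurable_det assms) auto
qed

text \<open>Coercivity gives a trivial kernel. For column \<open>l\<close> of the inverse, called
  \<open>x\<close>, it gives \<open>\<mu> * (norm x)\<^sup>2 \<le> x $ l \<le> norm x\<close>, so
  the entries are bounded in terms of \<open>\<mu>\<close> alone and the inverse of \<open>P\<close>
  is essentially bounded.\<close>

lemma coercive_cramer_inv:
  fixes M :: "real^'n::finite^'n"
  assumes "\<mu> > 0" and co: "\<And>v. \<mu> * (v \<bullet> v) \<le> v \<bullet> (M *v v)"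
  shows "det M \<noteq> 0" and "\<bar>cramer_inv M $ k $ l\<bar> \<le> 1 / \<mu>"
proof -
  have "v = 0" if "M *v v = 0" for v
    using co[of v] that \<open>\<mu> > 0\<close> inner_ge_zero[of v] by (simp add: mult_le_0_iff)
  then have "\<exists>B. B ** M = mat 1" unfolding matrix_left_invertible_ker by blast
  then show det: "det M \<noteq> 0" by (simp add: invertible_left_inverse flip: invertible_det_nz)
  define x where "x = cramer_inv M *v axis l 1"
  have "M *v x = axis l 1" unfolding x_def matrix_vector_mul_assoc cramer_inv(1)[OF det] by simp
  then have "\<mu> * (norm x)\<^sup>2 \<le> x \<bullet> axis l 1" using co[of x] by (simp add: power2_norm_eq_inner)
  also have "\<dots> \<le> norm x * 1" using norm_cauchy_schwarz[of x "axis l 1"] by simp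
  finally have "norm x \<le> 1 / \<mu>"
    using \<open>\<mu> > 0\<close> by (cases "x = 0") (auto simp: power2_eq_square field_simps)
  moreover have "cramer_inv M $ k $ l = x $ k"
    unfolding x_def by (simp add: matrix_vector_mult_def axis_def if_distrib cong: if_cong)
  ultimately show "\<bar>cramer_inv M $ k $ l\<bar> \<le> 1 / \<mu>"
    using Finite_Cartesian_Product.norm_nth_le[of x k] by (metis order_trans real_norm_def)
qed

subsection \<open>The first order system\<close>

text \<open>For the pair (y, y1) with y1 = Py' the equation -y1' + Qy = \<lambda>Wy reads y' =
  P^{-1} y1 and y1' = Qy - \<lambda>Wy. \<open>sys0\<close> is the part free of \<lambda>,
  \<open>sys1\<close> the coefficient of \<lambda>.\<close>

definition sys0 :: "(real \<Rightarrow> real^'n::finite^'n) \<Rightarrow> (real \<Rightarrow> real^'n^'n) \<Rightarrow> real \<Rightarrow> complex^('n + 'n)^('n + 'n)" where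
  "sys0 P Q t = (\<chi> i j. case i of
      Inl k \<Rightarrow> (case j of Inl l \<Rightarrow> 0 | Inr l \<Rightarrow> complex_of_real (cramer_inv (P t) $ k $ l))
    | Inr k \<Rightarrow> (case j of Inl l \<Rightarrow> complex_of_real (Q t $ k $ l) | Inr l \<Rightarrow> 0))"

definition sys1 :: "(real \<Rightarrow> real^'n::finite^'n) \<Rightarrow> real \<Rightarrow> complex^('n + 'n)^('n + 'n)" where
  "sys1 W t = (\<chi> i j. case i of
      Inl k \<Rightarrow> 0
    | Inr k \<Rightarrow> (case j of Inl l \<Rightarrow> - complex_of_real (W t $ k $ l) | Inr l \<Rightarrow> 0))"

lemma sys0_mult: "sys0 P Q t *v u = join (cmat (cramer_inv (P t)) *v lower u) (cmat (Q t) *v upper u)"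
  by (simp add: vec_eq_sum_type_iff sys0_def matrix_vector_mult_def sum_UNIV_sum_type cmat_def)

lemma sys1_mult: "sys1 W t *v u = join 0 (- (cmat (W t) *v upper u))"
  by (simp add: vec_eq_sum_type_iff sys1_def matrix_vector_mult_def sum_UNIV_sum_type cmat_def sum_negf)

text \<open>A free right-hand side lets eigenfunctions and the other links of Jordan chains share
  one Green's formula.\<close>

definition sl_inhom :: "real \<Rightarrow> real \<Rightarrow> (real \<Rightarrow> real^'n::finite^'n) \<Rightarrow> (real \<Rightarrow> real^'n^'n) \<Rightarrow>
    (real \<Rightarrow> complex^'n) \<Rightarrow> (real \<Rightarrow> complex^'n) \<Rightarrow> (real \<Rightarrow> complex^'n) \<Rightarrow> bool" where
  "sl_inhom a b P Q f y y1 \<longleftrightarrow> quasi_pair a b P y y1 \<and>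
     (AE t in lebesgue_on {a..b}. y1 differentiable (at t) \<and>
        - vector_derivative y1 (at t) + cmat (Q t) *v y t = f t)"

lemma sl_sol_iff_sl_inhom:
  "sl_sol a b P Q W lam y y1 \<longleftrightarrow> sl_inhom a b P Q (\<lambda>t. lam *s (cmat (W t) *v y t)) y y1"
  unfolding sl_sol_def sl_inhom_def ..

lemma sl_inhom_continuous:
  assumes "sl_inhom a b P Q f y y1"
  shows "continuous_on {a..b} y" "continuous_on {a..b} y1"
  using assms unfolding sl_inhom_def quasi_pair_def by (auto intro: abs_cont_on_imp_continuous_on)

lemma sl_inhom_derivatives:
  assumes "sl_inhom a b P Q f y y1"
  shows "AE t in lebesgue_on {a..b}.
    (y has_vector_derivative vector_derivative y (at t)) (at t) \<and>
    (y1 has_vector_derivative vector_derivative y1 (at t)) (at t) \<and>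
    y1 t = cmat (P t) *v vector_derivative y (at t) \<and>
    vector_derivative y1 (at t) = cmat (Q t) *v y t - f t"
proof -
  have "AE t in lebesgue_on {a..b}. y differentiable (at t) \<and> y1 t = cmat (P t) *v vector_derivative y (at t)"
    "AE t in lebesgue_on {a..b}. y1 differentiable (at t) \<and> - vector_derivative y1 (at t) + cmat (Q t) *v y t = f t"
    using assms unfolding sl_inhom_def quasi_pair_def by auto
  then show ?thesis
    by eventually_elim (auto simp: vector_derivative_works[symmetric] algebra_simps)
qed

text \<open>In the interior the derivative of \<open>y\<close> is 0, so \<open>y1\<close> vanishes
  a.e., and everywhere by continuity. At the end points a two-sided derivative would also depend on
  values outside the interval, hence their exclusion.\<close>

lemma quasi_pair_zero:
  assumes "a < b" and qp: "quasi_pair a b P y y1" and y0: "\<And>t. t \<in> {a..b} \<Longrightarrow> y t = 0"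
    and t: "t \<in> {a..b}"
  shows "y1 t = 0"
proof (rule continuous_AE_zero[OF \<open>a < b\<close> _ _ t])
  show "continuous_on {a..b} y1"
    using qp unfolding quasi_pair_def by (auto intro: abs_cont_on_imp_continuous_on)
  obtain N where N: "negligible N" "\<And>t. t \<in> {a..b} - N \<Longrightarrow> y1 t = cmat (P t) *v vector_derivative y (at t)"
    using qp unfolding quasi_pair_def AE_lebesgue_on_interval_iff by blast
  have "y1 t = 0" if "t \<in> {a..b} - (N \<union> {a, b})" for t
  proof -
    have t: "t \<in> {a<..<b}" using that by auto
    have "(y has_vector_derivative 0) (at t)"
      by (rule has_vector_derivative_transform_within_open[where f = "\<lambda>_. 0" and S = "{a<..<b}"])
         (use t y0 in auto)
    then have "vector_derivative y (at t) = 0" by (rule vector_derivative_at)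
    then show ?thesis using N(2)[of t] that by simp
  qed
  moreover have "negligible (N \<union> {a, b})" using N(1) by simp
  ultimately show "AE t in lebesgue_on {a..b}. y1 t = 0"
    unfolding AE_lebesgue_on_interval_iff by blast
qed

lemma Linf_entries:
  assumes "Linf_on a b M"
  obtains C where "C \<ge> 0" "AE t in lebesgue_on {a..b}. \<forall>k l. \<bar>M t $ k $ l\<bar> \<le> C"
    "\<And>k l. (\<lambda>t. M t $ k $ l) \<in> borel_measurable (lebesgue_on {a..b})"
proof -
  obtain C where C: "AE t in lebesgue_on {a..b}. norm (M t) \<le> C" and m: "M \<in> borel_measurable (lebesgue_on {a..b})"
    using assms unfolding Linf_on_def by blast
  have "AE t in lebesgue_on {a..b}. \<forall>k l. \<bar>M t $ k $ l\<bar> \<le> max C 0"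
    using C
  proof eventually_elim
    case (elim t)
    have "\<bar>M t $ k $ l\<bar> \<le> norm (M t)" for k l
      using Finite_Cartesian_Product.norm_nth_le[of "M t" k] Finite_Cartesian_Product.norm_nth_le[of "M t $ k" l]
      by (simp add: order_trans)
    then show ?case using elim by (meson max.coboundedI1 order_trans)
  qed
  moreover have "(\<lambda>t. M t $ k $ l) \<in> borel_measurable (lebesgue_on {a..b})" for k l
    by (rule measurable_compose[OF m, of "\<lambda>x. x $ k $ l"])
       (intro borel_measurable_continuous_onI continuous_intros)
  ultimately show thesis using that[of "max C 0"] by simp
qed

section \<open>The Sturm-Liouville equation as a bounded linear system\<close>

locale sl_coeff =
  fixes a b :: real and P Q W :: "real \<Rightarrow> real^'n::finite^'n"
  assumes a_less_b: "a < b" and Omega: "Omega a b P Q W"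
begin

lemma a_le_b: "a \<le> b" using a_less_b by simp

lemma symmetric_AE:
  "AE t in lebesgue_on {a..b}. transpose (P t) = P t \<and> transpose (Q t) = Q t \<and> transpose (W t) = W t"
  using Omega unfolding Omega_def by blast

lemma inverse_AE:
  "AE t in lebesgue_on {a..b}. cmat (cramer_inv (P t)) ** cmat (P t) = mat 1 \<and> cmat (P t) ** cmat (cramer_inv (P t)) = mat 1"
proof -
  obtain \<mu> where "\<mu> > 0" "AE t in lebesgue_on {a..b}. \<forall>v. \<mu> * (v \<bullet> v) \<le> v \<bullet> (P t *v v)"
    using Omega unfolding Omega_def by blast
  from this(2) show ?thesis
  proof eventually_elim
    case (elim t)
    have "det (P t) \<noteq> 0" by (rule coercive_cramer_inv(1)[OF \<open>\<mu> > 0\<close>]) (use elim in blast)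
    then show ?case by (simp add: cramer_inv cmat_mat_1 flip: cmat_mult)
  qed
qed

lemma lin_coeff_sys: "\<exists>K0. lin_coeff a b (sys0 P Q) K0" "\<exists>K1. lin_coeff a b (sys1 W) K1"
  "\<exists>K. lin_coeff a b (\<lambda>t. cmat (W t)) K"
proof -
  have L: "Linf_on a b P" "Linf_on a b Q" "Linf_on a b W" using Omega unfolding Omega_def by auto
  obtain \<mu> where "\<mu> > 0" and mu: "AE t in lebesgue_on {a..b}. \<forall>v. \<mu> * (v \<bullet> v) \<le> v \<bullet> (P t *v v)"
    using Omega unfolding Omega_def by blast
  from mu have R: "AE t in lebesgue_on {a..b}. \<forall>k l. \<bar>cramer_inv (P t) $ k $ l\<bar> \<le> 1 / \<mu>"
    by eventually_elim (use coercive_cramer_inv(2)[OF \<open>\<mu> > 0\<close>] in blast)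
  obtain CP where P: "\<And>k l. (\<lambda>t. P t $ k $ l) \<in> borel_measurable (lebesgue_on {a..b})"
    using Linf_entries[OF L(1)] by blast
  obtain CQ where CQ: "CQ \<ge> 0" "AE t in lebesgue_on {a..b}. \<forall>k l. \<bar>Q t $ k $ l\<bar> \<le> CQ"
    "\<And>k l. (\<lambda>t. Q t $ k $ l) \<in> borel_measurable (lebesgue_on {a..b})"
    using Linf_entries[OF L(2)] by blast
  obtain CW where CW: "CW \<ge> 0" "AE t in lebesgue_on {a..b}. \<forall>k l. \<bar>W t $ k $ l\<bar> \<le> CW"
    "\<And>k l. (\<lambda>t. W t $ k $ l) \<in> borel_measurable (lebesgue_on {a..b})"
    using Linf_entries[OF L(3)] by blast
  note of_real_m = borel_measurable_of_real[where 'a = complex]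
  have "lin_coeff a b (sys0 P Q) (real CARD('n + 'n) * (real CARD('n + 'n) * max (1 / \<mu>) CQ))"
  proof (rule lin_coeff_bounded_entries)
    show "(\<lambda>t. sys0 P Q t $ i $ j) \<in> borel_measurable (lebesgue_on {a..b})" for i j
      unfolding sys0_def using CQ(3) borel_measurable_cramer_inv[OF P]
      by (cases i; cases j) (auto intro!: of_real_m)
    show "AE t in lebesgue_on {a..b}. \<forall>i j. norm (sys0 P Q t $ i $ j) \<le> max (1 / \<mu>) CQ"
      using R CQ(2)
    proof eventually_elim
      case (elim t)
      then show ?case using CQ(1) unfolding sys0_def
        by (auto split: sum.split intro: max.coboundedI1 max.coboundedI2)
    qed
  qed (use CQ in auto)
  then show "\<exists>K0. lin_coeff a b (sys0 P Q) K0" by blast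
  have "lin_coeff a b (sys1 W) (real CARD('n + 'n) * (real CARD('n + 'n) * CW))"
  proof (rule lin_coeff_bounded_entries)
    show "(\<lambda>t. sys1 W t $ i $ j) \<in> borel_measurable (lebesgue_on {a..b})" for i j
      unfolding sys1_def using CW(3)
      by (cases i; cases j) (auto intro!: of_real_m borel_measurable_uminus)
    show "AE t in lebesgue_on {a..b}. \<forall>i j. norm (sys1 W t $ i $ j) \<le> CW"
      using CW(2) by eventually_elim (use CW(1) in \<open>auto simp: sys1_def split: sum.split\<close>)
  qed (use CW in auto)
  then show "\<exists>K1. lin_coeff a b (sys1 W) K1" by blast
  have "lin_coeff a b (\<lambda>t. cmat (W t)) (real CARD('n) * (real CARD('n) * CW))"
  proof (rule lin_coeff_bounded_entries)
    show "(\<lambda>t. cmat (W t) $ i $ j) \<in> borel_measurable (lebesgue_on {a..b})" for i j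
      unfolding cmat_def using CW(3) by (auto intro!: of_real_m)
    show "AE t in lebesgue_on {a..b}. \<forall>i j. norm (cmat (W t) $ i $ j) \<le> CW"
      using CW(2) by eventually_elim (auto simp: cmat_def)
  qed (use CW in auto)
  then show "\<exists>K. lin_coeff a b (\<lambda>t. cmat (W t)) K" by blast
qed

text \<open>Invertibility of \<open>P t\<close> a.e. allows the relation y1 = Py' to be solved for
  y', which is the upper half of the system; the lower half is the differential equation
  itself.\<close>

lemma lin_sol_sys0_iff:
  "lin_sol a b (sys0 P Q) (\<lambda>t. join 0 (- f t)) u \<longleftrightarrow> sl_inhom a b P Q f (\<lambda>t. upper (u t)) (\<lambda>t. lower (u t))"
proof
  assume u: "lin_sol a b (sys0 P Q) (\<lambda>t. join 0 (- f t)) u"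
  have ac: "abs_cont_on a b (\<lambda>t. upper (u t))" "abs_cont_on a b (\<lambda>t. lower (u t))"
    using u abs_cont_on_linear[OF bounded_linear_blocks(1)] abs_cont_on_linear[OF bounded_linear_blocks(2)]
    unfolding lin_sol_def by blast+
  have "AE t in lebesgue_on {a..b}. (u has_vector_derivative (sys0 P Q t *v u t + join 0 (- f t))) (at t)"
    using u unfolding lin_sol_def by blast
  with inverse_AE have "AE t in lebesgue_on {a..b}.
     (((\<lambda>t. upper (u t)) differentiable (at t)) \<and> lower (u t) = cmat (P t) *v vector_derivative (\<lambda>t. upper (u t)) (at t)) \<and>
     (((\<lambda>t. lower (u t)) differentiable (at t)) \<and>
      - vector_derivative (\<lambda>t. lower (u t)) (at t) + cmat (Q t) *v upper (u t) = f t)"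
  proof eventually_elim
    case (elim t)
    have "((\<lambda>t. upper (u t)) has_vector_derivative upper (sys0 P Q t *v u t + join 0 (- f t))) (at t)"
      "((\<lambda>t. lower (u t)) has_vector_derivative lower (sys0 P Q t *v u t + join 0 (- f t))) (at t)"
      by (intro bounded_linear.has_vector_derivative[OF bounded_linear_blocks(1)]
            bounded_linear.has_vector_derivative[OF bounded_linear_blocks(2)] elim)+
    then have "((\<lambda>t. upper (u t)) has_vector_derivative cmat (cramer_inv (P t)) *v lower (u t)) (at t)"
      "((\<lambda>t. lower (u t)) has_vector_derivative (cmat (Q t) *v upper (u t) - f t)) (at t)"
      by (simp_all add: sys0_mult upper_lower_linear)
    then show ?case
      using elim(1) by (auto simp: vector_derivative_at matrix_vector_mul_assoc dest: differentiableI_vector)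
  qed
  then show "sl_inhom a b P Q f (\<lambda>t. upper (u t)) (\<lambda>t. lower (u t))"
    using ac unfolding sl_inhom_def quasi_pair_def by (auto elim: eventually_mono)
next
  assume s: "sl_inhom a b P Q f (\<lambda>t. upper (u t)) (\<lambda>t. lower (u t))"
  have ueq: "u = (\<lambda>t. join (upper (u t)) 0 + join 0 (lower (u t)))"
    by (simp flip: join_split)
  have "abs_cont_on a b (\<lambda>t. join (upper (u t)) 0 + join 0 (lower (u t)))"
    using s unfolding sl_inhom_def quasi_pair_def
    by (intro abs_cont_on_add abs_cont_on_linear[OF bounded_linear_blocks(3)]
          abs_cont_on_linear[OF bounded_linear_blocks(4)]) auto
  then have ac: "abs_cont_on a b u" by (subst ueq)
  have "AE t in lebesgue_on {a..b}. (u has_vector_derivative (sys0 P Q t *v u t + join 0 (- f t))) (at t)"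
    using sl_inhom_derivatives[OF s] inverse_AE
  proof eventually_elim
    case (elim t)
    have "cmat (cramer_inv (P t)) *v lower (u t) = vector_derivative (\<lambda>t. upper (u t)) (at t)"
      using elim by (simp add: matrix_vector_mul_assoc)
    then have eq: "sys0 P Q t *v u t + join 0 (- f t) =
        join (vector_derivative (\<lambda>t. upper (u t)) (at t)) 0 + join 0 (vector_derivative (\<lambda>t. lower (u t)) (at t))"
      using elim by (simp add: sys0_mult vec_eq_sum_type_iff)
    have "((\<lambda>t. join (upper (u t)) 0 + join 0 (lower (u t))) has_vector_derivative
        (join (vector_derivative (\<lambda>t. upper (u t)) (at t)) 0 + join 0 (vector_derivative (\<lambda>t. lower (u t)) (at t)))) (at t)"
      using elim by (intro has_vector_derivative_add bounded_linear.has_vector_derivative[OF bounded_linear_blocks(3)]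
         bounded_linear.has_vector_derivative[OF bounded_linear_blocks(4)]) auto
    then show ?case unfolding eq by (subst ueq)
  qed
  with ac show "lin_sol a b (sys0 P Q) (\<lambda>t. join 0 (- f t)) u" unfolding lin_sol_def by blast
qed

lemma lin_sol_pencil_iff:
  "lin_sol a b (pencil (sys0 P Q) (sys1 W) lam) (\<lambda>t. join 0 (- g t)) u \<longleftrightarrow>
     sl_inhom a b P Q (\<lambda>t. lam *s (cmat (W t) *v upper (u t)) + g t) (\<lambda>t. upper (u t)) (\<lambda>t. lower (u t))"
proof -
  have "pencil (sys0 P Q) (sys1 W) lam t *v u t + join 0 (- g t) =
    sys0 P Q t *v u t + join 0 (- (lam *s (cmat (W t) *v upper (u t)) + g t))" for t
    unfolding pencil_mult_vector sys1_mult by (simp add: vec_eq_sum_type_iff)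
  then show ?thesis
    unfolding lin_sol_sys0_iff[symmetric] lin_sol_def by (simp only:)
qed

lemma sl_sol_iff_lin_sol:
  "sl_sol a b P Q W lam (\<lambda>t. upper (u t)) (\<lambda>t. lower (u t)) \<longleftrightarrow>
     lin_sol a b (pencil (sys0 P Q) (sys1 W) lam) (\<lambda>_. 0) u"
proof -
  have "(\<lambda>_::real. 0) = (\<lambda>_. join 0 (- (0 :: complex^'n)))"
    by (simp add: vec_eq_sum_type_iff fun_eq_iff)
  then show ?thesis
    using lin_sol_pencil_iff[of lam "\<lambda>_. 0" u] by (simp add: sl_sol_iff_sl_inhom)
qed

text \<open>In the derivative of the bracket \<open>csp (z t) (y1 t) - csp (z1 t) (y t)\<close> the
  terms with \<open>P\<close> and those with \<open>Q\<close> cancel by symmetry, and only the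
  right-hand sides survive. The bracket is absolutely continuous, so it is recovered from this a.e.
  derivative.\<close>

lemma green_formula:
  assumes y: "sl_inhom a b P Q f y y1" and z: "sl_inhom a b P Q g z z1"
  shows "((\<lambda>t. csp (g t) (y t) - csp (z t) (f t)) has_integral
     (csp (z b) (y1 b) - csp (z1 b) (y b) - (csp (z a) (y1 a) - csp (z1 a) (y a)))) {a..b}"
proof (rule abs_cont_has_integral_deriv[OF a_le_b])
  show "abs_cont_on a b (\<lambda>t. csp (z t) (y1 t) - csp (z1 t) (y t))"
    using y z unfolding sl_inhom_def quasi_pair_def
    by (intro abs_cont_on_diff abs_cont_on_bilinear[OF bounded_bilinear_csp]) auto
  show "AE t in lebesgue_on {a..b}. ((\<lambda>t. csp (z t) (y1 t) - csp (z1 t) (y t)) has_vector_derivative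
      (csp (g t) (y t) - csp (z t) (f t))) (at t)"
    using sl_inhom_derivatives[OF y] sl_inhom_derivatives[OF z] symmetric_AE
  proof eventually_elim
    case (elim t)
    have "((\<lambda>t. csp (z t) (y1 t) - csp (z1 t) (y t)) has_vector_derivative
       ((csp (z t) (vector_derivative y1 (at t)) + csp (vector_derivative z (at t)) (y1 t)) -
        (csp (z1 t) (vector_derivative y (at t)) + csp (vector_derivative z1 (at t)) (y t)))) (at t)"
      using elim by (intro has_vector_derivative_diff bounded_bilinear.has_vector_derivative[OF bounded_bilinear_csp]) auto
    moreover have "(csp (z t) (vector_derivative y1 (at t)) + csp (vector_derivative z (at t)) (y1 t)) -
        (csp (z1 t) (vector_derivative y (at t)) + csp (vector_derivative z1 (at t)) (y t)) =
        csp (g t) (y t) - csp (z t) (f t)"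
      using elim by (simp add: csp_diff_left csp_diff_right csp_cmat_symmetric)
    ultimately show ?case by simp
  qed
qed

text \<open>The lower bound on \<open>W\<close> dominates a multiple of
  \<open>(norm (y t))\<^sup>2\<close>, which is continuous and so vanishes pointwise.\<close>

lemma weighted_norm_zero:
  assumes y: "continuous_on {a..b} y" and "((\<lambda>t. csp (y t) (cmat (W t) *v y t)) has_integral 0) {a..b}"
    and t: "t \<in> {a..b}"
  shows "y t = 0"
proof -
  obtain \<mu> where "\<mu> > 0" and mu: "AE t in lebesgue_on {a..b}. \<forall>v. \<mu> * (v \<bullet> v) \<le> v \<bullet> (W t *v v)"
    using Omega unfolding Omega_def by blast
  have "((\<lambda>t. Re (csp (y t) (cmat (W t) *v y t))) has_integral 0) {a..b}"
    using has_integral_linear[OF assms(2) bounded_linear_Re] by (simp add: o_def)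
  moreover have "AE t in lebesgue_on {a..b}. norm (\<mu> * (norm (y t))\<^sup>2) \<le> Re (csp (y t) (cmat (W t) *v y t))"
    using mu
  proof eventually_elim
    case (elim t)
    have "\<mu> * (norm (y t))\<^sup>2 \<le> Re (csp (y t) (cmat (W t) *v y t))"
      by (rule Re_csp_cmat_ge) (use elim in blast)
    then show ?case using \<open>\<mu> > 0\<close> by simp
  qed
  moreover have c: "continuous_on {a..b} (\<lambda>t. \<mu> * (norm (y t))\<^sup>2)" by (intro continuous_intros y)
  ultimately have "norm (integral {a..b} (\<lambda>t. \<mu> * (norm (y t))\<^sup>2)) \<le> 0"
    by (intro integral_AE_norm_bound integrable_continuous_interval)
  then have "integral {a..b} (\<lambda>t. \<mu> * (norm (y t))\<^sup>2) = 0" by simp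
  then have "\<mu> * (norm (y t))\<^sup>2 = 0"
    using integral_eq_0_iff[OF c a_less_b] \<open>\<mu> > 0\<close> t by simp
  then show ?thesis using \<open>\<mu> > 0\<close> by simp
qed

text \<open>Since \<open>W\<close> is essentially bounded, the membership clauses of
  \<open>T_graph\<close> come for free for solutions of the eigenvalue equation.\<close>

lemma L2W_continuous:
  assumes y: "continuous_on {a..b} y"
  shows "L2W a b W y"
proof -
  have my: "y \<in> borel_measurable (lebesgue_on {a..b})"
    using y by (rule continuous_imp_measurable_on_sets_lebesgue) simp
  obtain K where K: "lin_coeff a b (\<lambda>t. cmat (W t)) K" using lin_coeff_sys(3) by blast
  have K0: "K \<ge> 0" using K unfolding lin_coeff_def by blast
  have mWy: "(\<lambda>t. cmat (W t) *v y t) \<in> borel_measurable (lebesgue_on {a..b})"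
    by (rule lin_coeff_measurable[OF K y])
  obtain U where U: "U \<ge> 0" "\<And>t. t \<in> {a..b} \<Longrightarrow> norm (y t) \<le> U"
    using continuous_bounded_on_interval[OF y] by blast
  have "AE t in lebesgue_on {a..b}. norm (cmat (W t) *v y t) \<le> K * U"
    by (rule lin_coeff_bound[OF K U(2)])
  moreover have "AE t in lebesgue_on {a..b}. norm (y t) \<le> U"
    unfolding AE_lebesgue_on_interval_iff using U(2) by (intro exI[of _ "{}"]) auto
  ultimately have bd: "AE t in lebesgue_on {a..b}. norm (Re (csp (y t) (cmat (W t) *v y t))) \<le> U * (K * U)"
  proof eventually_elim
    case (elim t)
    have "norm (Re (csp (y t) (cmat (W t) *v y t))) \<le> norm (y t) * norm (cmat (W t) *v y t)"
      using abs_Re_le_cmod[of "csp (y t) (cmat (W t) *v y t)"] norm_csp_le[of "y t" "cmat (W t) *v y t"] by simp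
    also have "\<dots> \<le> U * (K * U)" using elim U(1) K0 by (intro mult_mono) auto
    finally show ?case .
  qed
  have "(\<lambda>t. csp (y t) (cmat (W t) *v y t)) \<in> borel_measurable (lebesgue_on {a..b})"
    unfolding csp_def
    using my mWy by (intro borel_measurable_sum borel_measurable_times
        measurable_compose[OF _ borel_measurable_continuous_onI[of cnj]]) (auto simp: borel_measurable_vec_iff intro: continuous_intros)
  then have "(\<lambda>t. Re (csp (y t) (cmat (W t) *v y t))) \<in> borel_measurable (lebesgue_on {a..b})"
    by (rule borel_measurable_Re[THEN measurable_compose[rotated]])
  from integrable_bounded_measurable[OF this bd] my show ?thesis
    unfolding L2W_def csp_def by simp
qed

end

lemma lin_sol_zero: "lin_sol a b M (\<lambda>_. 0) (\<lambda>_. 0)"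
  unfolding lin_sol_def by (auto intro: abs_cont_on_Lipschitz[where C = 0])

lemma lin_sol_sum:
  assumes "finite J" "\<And>j. j \<in> J \<Longrightarrow> lin_sol a b M (f j) (u j)"
  shows "lin_sol a b M (\<lambda>t. \<Sum>j\<in>J. c j *s f j t) (\<lambda>t. \<Sum>j\<in>J. c j *s u j t)"
  using assms
proof (induction J)
  case empty
  then show ?case by (simp add: lin_sol_zero)
next
  case (insert j J)
  then have "lin_sol a b M (\<lambda>t. (\<Sum>j\<in>J. c j *s f j t) + c j *s f j t) (\<lambda>t. (\<Sum>j\<in>J. c j *s u j t) + c j *s u j t)"
    by (intro lin_sol_add_smult) auto
  then show ?case using insert.hyps by (simp add: add.commute)
qed

text \<open>Independence is required of the indexed family, to suit a set \<open>F\<close> of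
  functions whose Cauchy data are given by \<open>g\<close>. Injectivity follows from it: equal
  values at two indices would admit the coefficients 1 and -1.\<close>

lemma card_le_dim_of_independent_family:
  fixes g :: "'b \<Rightarrow> 'a::field^'m::finite"
  assumes "finite F" "g ` F \<subseteq> S" and ind: "\<And>c f. (\<Sum>f\<in>F. c f *s g f) = 0 \<Longrightarrow> f \<in> F \<Longrightarrow> c f = 0"
  shows "card F \<le> vec.dim S"
proof -
  have inj: "inj_on g F"
  proof (rule inj_onI, rule ccontr)
    fix f f' assume ff: "f \<in> F" "f' \<in> F" "g f = g f'" "f \<noteq> f'"
    define c where "c = (\<lambda>x. if x = f then 1 else if x = f' then - 1 else 0 :: 'a)"
    have "(\<Sum>x\<in>F. c x *s g x) = (\<Sum>x\<in>{f, f'}. c x *s g x)"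
      by (rule sum.mono_neutral_right) (use ff \<open>finite F\<close> in \<open>auto simp: c_def\<close>)
    also have "\<dots> = 0" using ff by (simp add: c_def)
    finally have "c f = 0" by (rule ind) (rule ff)
    then show False by (simp add: c_def)
  qed
  have "vec.independent (g ` F)"
  proof
    assume "vec.dependent (g ` F)"
    then obtain r v where r: "(\<Sum>v\<in>g ` F. r v *s v) = 0" "v \<in> g ` F" "r v \<noteq> 0"
      using vec.dependent_finite[of "g ` F"] \<open>finite F\<close> by auto
    have "(\<Sum>f\<in>F. r (g f) *s g f) = 0"
      using r(1) sum.reindex[OF inj, of "\<lambda>v. r v *s v"] by simp
    then have "r (g f) = 0" if "f \<in> F" for f by (rule ind[OF _ that])
    with r show False by auto
  qed
  then have "card (g ` F) \<le> vec.dim S"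
    using assms(2) by (intro vec.independent_card_le_dim)
  then show ?thesis using card_image[OF inj] by simp
qed

subsection \<open>The boundary value problem\<close>

locale sl_problem = sl_coeff a b P Q W
  for a b and P Q W :: "real \<Rightarrow> real^'n::finite^'n" +
  fixes A B :: "complex^('n + 'n)^('n + 'n)"
  assumes sa_bc: "sa_bc A B"
begin

text \<open>The boundary operator as a map of the Cauchy data at both ends. It is jointly linear, so
  superpositions and parameter derivatives pass through it.\<close>

definition bdry :: "complex^('n + 'n) \<Rightarrow> complex^('n + 'n) \<Rightarrow> complex^('n + 'n)" where
  "bdry ua ub = A *v join (- upper ua) (upper ub) + B *v join (lower ua) (lower ub)"

lemma bvec_eq_join: "bvec_neg a b y = join (- y a) (y b)" "bvec a b y = join (y a) (y b)"
  by (simp_all add: bvec_neg_def bvec_def vec_eq_sum_type_iff)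

lemma bdry_eq:
  "A *v bvec_neg a b (\<lambda>t. upper (u t)) + B *v bvec a b (\<lambda>t. lower (u t)) = bdry (u a) (u b)"
  unfolding bdry_def bvec_eq_join ..

lemma bdry_nth:
  "bdry ua ub $ i =
     (\<Sum>k\<in>UNIV. A $ i $ Inr k * ub $ Inl k) - (\<Sum>k\<in>UNIV. A $ i $ Inl k * ua $ Inl k) +
     (\<Sum>k\<in>UNIV. B $ i $ Inl k * ua $ Inr k) + (\<Sum>k\<in>UNIV. B $ i $ Inr k * ub $ Inr k)"
  unfolding bdry_def by (simp add: matrix_vector_mult_def sum_UNIV_sum_type sum_negf)

lemma bdry_add: "bdry (ua + va) (ub + vb) = bdry ua ub + bdry va vb"
  by (simp add: vec_eq_iff bdry_nth sum.distrib algebra_simps)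

lemma bdry_smult: "bdry (c *s ua) (c *s ub) = c *s bdry ua ub"
  by (simp add: vec_eq_iff bdry_nth sum_distrib_left algebra_simps)

lemma bdry_zero: "bdry 0 0 = 0"
  by (simp add: vec_eq_iff bdry_nth)

lemma bdry_sum: "bdry (\<Sum>j\<in>J. c j *s f j) (\<Sum>j\<in>J. c j *s g j) = (\<Sum>j\<in>J. c j *s bdry (f j) (g j))"
  by (induction J rule: infinite_finite_induct) (simp_all add: bdry_add bdry_smult bdry_zero)

lemma bdry_has_field_derivative:
  assumes "\<And>k. ((\<lambda>z. ua z $ k) has_field_derivative da $ k) (at z0)"
    and "\<And>k. ((\<lambda>z. ub z $ k) has_field_derivative db $ k) (at z0)"
  shows "((\<lambda>z. bdry (ua z) (ub z) $ i) has_field_derivative bdry da db $ i) (at z0)"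
  unfolding bdry_nth by (auto intro!: derivative_eq_intros assms simp: mult.commute)

text \<open>The minus sign in \<open>bvec_neg\<close> lets the difference of brackets at
  \<open>b\<close> and \<open>a\<close> be written with the two boundary vectors. After the kernel
  parametrisation for \<open>z\<close>, it becomes \<open>csp c\<close> of the boundary expression
  of \<open>y\<close>, which is 0.\<close>

lemma green_boundary:
  assumes y: "sl_inhom a b P Q f y y1" and z: "sl_inhom a b P Q g z z1"
    and bcy: "A *v bvec_neg a b y + B *v bvec a b y1 = 0"
    and bcz: "A *v bvec_neg a b z + B *v bvec a b z1 = 0"
  shows "((\<lambda>t. csp (g t) (y t) - csp (z t) (f t)) has_integral 0) {a..b}"
proof -
  obtain c where c: "bvec_neg a b z = adjoint_mat B *v c" "bvec a b z1 = - (adjoint_mat A *v c)"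
    using sa_bc_kernel_param[OF sa_bc bcz] by blast
  have join: "csp (join x x') (join v v') = csp x v + csp x' v'" for x x' v v' :: "complex^'n"
    by (simp add: csp_def sum_UNIV_sum_type)
  have "csp (z b) (y1 b) - csp (z1 b) (y b) - (csp (z a) (y1 a) - csp (z1 a) (y a)) =
     csp (bvec_neg a b z) (bvec a b y1) - csp (bvec a b z1) (bvec_neg a b y)"
    unfolding bvec_eq_join join by (simp add: csp_minus_left csp_minus_right)
  also have "\<dots> = csp c (A *v bvec_neg a b y + B *v bvec a b y1)"
    unfolding c by (simp add: csp_minus_left csp_adjoint csp_add_right)
  also have "\<dots> = 0" using bcy by simp
  finally show ?thesis using green_formula[OF y z] by simp
qed

section \<open>Symmetry of the operator: real eigenvalues and no generalised eigenvectors\<close>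

lemma T_graph_iff:
  "T_graph a b P Q W A B y z \<longleftrightarrow> L2W a b W y \<and> L2W a b W z \<and>
     (\<exists>y1. sl_inhom a b P Q (\<lambda>t. cmat (W t) *v z t) y y1 \<and> A *v bvec_neg a b y + B *v bvec a b y1 = 0)"
  unfolding T_graph_def sl_inhom_def eq_commute[of "cmat (W _) *v z _"] by blast

lemma T_graph_eigen_iff:
  "T_graph a b P Q W A B y (\<lambda>t. lam *s y t) \<longleftrightarrow>
     (\<exists>y1. sl_sol a b P Q W lam y y1 \<and> A *v bvec_neg a b y + B *v bvec a b y1 = 0)" (is "_ \<longleftrightarrow> ?R")
proof
  assume ?R
  then obtain y1 where y1: "sl_inhom a b P Q (\<lambda>t. lam *s (cmat (W t) *v y t)) y y1"
      "A *v bvec_neg a b y + B *v bvec a b y1 = 0"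
    unfolding sl_sol_iff_sl_inhom by blast
  have c: "continuous_on {a..b} y" by (rule sl_inhom_continuous[OF y1(1)])
  moreover have "continuous_on {a..b} (\<lambda>t. lam *s y t)"
    by (rule bounded_linear.continuous_on[OF bounded_linear_vector_smult c])
  ultimately show "T_graph a b P Q W A B y (\<lambda>t. lam *s y t)"
    using y1 unfolding T_graph_iff by (auto simp: L2W_continuous vec.scale)
qed (auto simp: T_graph_iff sl_sol_iff_sl_inhom vec.scale)

text \<open>Green's formula for \<open>y\<close> against itself leaves \<open>cnj lam - lam\<close>
  times the squared weighted norm of \<open>y\<close>.\<close>

lemma eigenvalue_real:
  assumes "is_eigenvalue a b P Q W A B lam"
  shows "cnj lam = lam"
proof (rule ccontr)
  assume nr: "cnj lam \<noteq> lam"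
  obtain y where y: "T_graph a b P Q W A B y (\<lambda>t. lam *s y t)" "\<not> (AE t in lebesgue_on {a..b}. y t = 0)"
    using assms unfolding is_eigenvalue_def by blast
  obtain y1 where y1: "sl_inhom a b P Q (\<lambda>t. lam *s (cmat (W t) *v y t)) y y1"
      "A *v bvec_neg a b y + B *v bvec a b y1 = 0"
    using y(1) unfolding T_graph_eigen_iff sl_sol_iff_sl_inhom by blast
  have "((\<lambda>t. csp (lam *s (cmat (W t) *v y t)) (y t) - csp (y t) (lam *s (cmat (W t) *v y t))) has_integral 0) {a..b}"
    by (rule green_boundary[OF y1(1,1) y1(2,2)])
  then have "((\<lambda>t. (cnj lam - lam) * csp (y t) (cmat (W t) *v y t)) has_integral 0) {a..b}"
  proof (rule has_integral_AE_cong)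
    show "AE t in lebesgue_on {a..b}. (cnj lam - lam) * csp (y t) (cmat (W t) *v y t) =
        csp (lam *s (cmat (W t) *v y t)) (y t) - csp (y t) (lam *s (cmat (W t) *v y t))"
      using symmetric_AE
      by eventually_elim (simp add: csp_smult_left csp_smult_right csp_cmat_symmetric algebra_simps)
  qed
  from has_integral_mult_right[OF this, of "inverse (cnj lam - lam)"]
  have "((\<lambda>t. csp (y t) (cmat (W t) *v y t)) has_integral 0) {a..b}"
    using nr by (simp flip: mult.assoc)
  then have "y t = 0" if "t \<in> {a..b}" for t
    using weighted_norm_zero[OF sl_inhom_continuous(1)[OF y1(1)]] that by blast
  then have "AE t in lebesgue_on {a..b}. y t = 0"
    unfolding AE_lebesgue_on_interval_iff by (intro exI[of _ "{}"]) auto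
  with y(2) show False by blast
qed

text \<open>The form in terms of right-hand sides instead of \<open>T_graph\<close> serves both
  uses: the derivative of the characteristic matrix and the root space.\<close>

lemma no_jordan_chain:
  assumes lam: "cnj lam = lam"
    and y: "sl_inhom a b P Q (\<lambda>t. lam *s (cmat (W t) *v y t) + cmat (W t) *v z t) y y1"
      "A *v bvec_neg a b y + B *v bvec a b y1 = 0"
    and z: "sl_sol a b P Q W lam z z1" "A *v bvec_neg a b z + B *v bvec a b z1 = 0"
    and t: "t \<in> {a..b}"
  shows "z t = 0"
proof -
  have z': "sl_inhom a b P Q (\<lambda>t. lam *s (cmat (W t) *v z t)) z z1"
    using z(1) unfolding sl_sol_iff_sl_inhom .
  have "((\<lambda>t. csp (lam *s (cmat (W t) *v z t)) (y t) -
      csp (z t) (lam *s (cmat (W t) *v y t) + cmat (W t) *v z t)) has_integral 0) {a..b}"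
    by (rule green_boundary[OF y(1) z' y(2) z(2)])
  then have "((\<lambda>t. - csp (z t) (cmat (W t) *v z t)) has_integral 0) {a..b}"
  proof (rule has_integral_AE_cong)
    show "AE t in lebesgue_on {a..b}. - csp (z t) (cmat (W t) *v z t) =
       csp (lam *s (cmat (W t) *v z t)) (y t) - csp (z t) (lam *s (cmat (W t) *v y t) + cmat (W t) *v z t)"
      using symmetric_AE
      by eventually_elim (simp add: csp_smult_left csp_smult_right csp_add_right csp_cmat_symmetric lam)
  qed
  from has_integral_neg[OF this]
  have "((\<lambda>t. csp (z t) (cmat (W t) *v z t)) has_integral 0) {a..b}" by simp
  then show ?thesis by (rule weighted_norm_zero[OF sl_inhom_continuous(1)[OF z'] _ t])
qed

lemma T_graph_eigen_AE:
  assumes y: "T_graph a b P Q W A B y (\<lambda>t. z t + lam *s y t)" and "AE t in lebesgue_on {a..b}. z t = 0"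
  shows "T_graph a b P Q W A B y (\<lambda>t. lam *s y t)"
proof -
  obtain y1 where y1: "sl_inhom a b P Q (\<lambda>t. cmat (W t) *v (z t + lam *s y t)) y y1"
      "A *v bvec_neg a b y + B *v bvec a b y1 = 0"
    using y unfolding T_graph_iff by blast
  have "AE t in lebesgue_on {a..b}. y1 differentiable (at t) \<and>
        - vector_derivative y1 (at t) + cmat (Q t) *v y t = cmat (W t) *v (z t + lam *s y t)"
    using y1(1) unfolding sl_inhom_def by blast
  then have "AE t in lebesgue_on {a..b}. y1 differentiable (at t) \<and>
        - vector_derivative y1 (at t) + cmat (Q t) *v y t = lam *s (cmat (W t) *v y t)"
    using assms(2) by eventually_elim (simp add: vec.scale)
  then have "sl_sol a b P Q W lam y y1"
    using y1(1) unfolding sl_sol_def sl_inhom_def by blast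
  then show ?thesis using y1(2) unfolding T_graph_eigen_iff by blast
qed

lemma root_space_eq_eigenspace:
  assumes lam: "cnj lam = lam"
  shows "root_space_T a b P Q W A B lam = eigenspace_T a b P Q W A B lam"
proof
  show "eigenspace_T a b P Q W A B lam \<subseteq> root_space_T a b P Q W A B lam"
  proof
    fix y assume "y \<in> eigenspace_T a b P Q W A B lam"
    then have "T_graph a b P Q W A B y (\<lambda>t. lam *s y t)" unfolding eigenspace_T_def by blast
    then show "y \<in> root_space_T a b P Q W A B lam"
      unfolding root_space_T_def
      by (intro CollectI exI[of _ 1] conjI exI[of _ "\<lambda>j. if j = 0 then y else (\<lambda>_. 0)"]) auto
  qed
  \<comment> \<open>Induction on the chain length: the last link is an eigenfunction, and
    \<open>no_jordan_chain\<close>, applied to it and its predecessor, makes it vanish, which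
    shortens the chain. Writing the length as \<open>Suc k\<close> encodes that it is at least
    1.\<close>
  have "T_graph a b P Q W A B (z 0) (\<lambda>t. lam *s z 0 t)"
    if "\<forall>j<Suc k. T_graph a b P Q W A B (z j) (\<lambda>t. z (Suc j) t + lam *s z j t)"
       "AE t in lebesgue_on {a..b}. z (Suc k) t = 0" for k and z :: "nat \<Rightarrow> real \<Rightarrow> complex^'n"
    using that
  proof (induction k)
    case 0
    then show ?case using T_graph_eigen_AE[of "z 0" "z 1" lam] by simp
  next
    case (Suc k)
    have "T_graph a b P Q W A B (z (Suc k)) (\<lambda>t. lam *s z (Suc k) t)"
      by (rule T_graph_eigen_AE[OF _ Suc.prems(2)]) (use Suc.prems(1) in blast)
    then obtain w1 where w1: "sl_sol a b P Q W lam (z (Suc k)) w1"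
        "A *v bvec_neg a b (z (Suc k)) + B *v bvec a b w1 = 0"
      unfolding T_graph_eigen_iff by blast
    have "T_graph a b P Q W A B (z k) (\<lambda>t. z (Suc k) t + lam *s z k t)"
      using Suc.prems(1) by simp
    then obtain y1 where y1: "sl_inhom a b P Q (\<lambda>t. cmat (W t) *v (z (Suc k) t + lam *s z k t)) (z k) y1"
        "A *v bvec_neg a b (z k) + B *v bvec a b y1 = 0"
      unfolding T_graph_iff by blast
    have "cmat (W t) *v (z (Suc k) t + lam *s z k t) = lam *s (cmat (W t) *v z k t) + cmat (W t) *v z (Suc k) t" for t
      by (simp add: vec.add vec.scale)
    with y1(1) have "sl_inhom a b P Q (\<lambda>t. lam *s (cmat (W t) *v z k t) + cmat (W t) *v z (Suc k) t) (z k) y1"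
      by simp
    from no_jordan_chain[OF lam this y1(2) w1] have "z (Suc k) t = 0" if "t \<in> {a..b}" for t
      using that by blast
    then have "AE t in lebesgue_on {a..b}. z (Suc k) t = 0"
      unfolding AE_lebesgue_on_interval_iff by (intro exI[of _ "{}"]) auto
    then show ?case using Suc.IH Suc.prems(1) by simp
  qed
  then show "root_space_T a b P Q W A B lam \<subseteq> eigenspace_T a b P Q W A B lam"
    unfolding root_space_T_def eigenspace_T_def by (auto dest!: gr0_implies_Suc simp: Suc_le_eq)
qed

subsection \<open>The fundamental system and the characteristic matrix\<close>

abbreviation sys :: "complex \<Rightarrow> real \<Rightarrow> complex^('n + 'n)^('n + 'n)" where
  "sys \<equiv> pencil (sys0 P Q) (sys1 W)"

definition phi :: "complex \<Rightarrow> 'n + 'n \<Rightarrow> real \<Rightarrow> complex^('n + 'n)" where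
  "phi lam j t = join (fst (fund_sol a b P Q W lam j) t) (snd (fund_sol a b P Q W lam j) t)"

lemma lin_coeff_sys_pencil: "\<exists>K. lin_coeff a b (sys lam) K"
  using lin_coeff_sys lin_coeff_pencil by blast

text \<open>\<open>fund_sol\<close> is a choice and has its defining properties only because a
  solution with these data exists.\<close>

lemma phi: "lin_sol a b (sys lam) (\<lambda>_. 0) (phi lam j)" "phi lam j a = axis j 1"
proof -
  obtain K where K: "lin_coeff a b (sys lam) K" using lin_coeff_sys_pencil by blast
  obtain u where u: "lin_sol a b (sys lam) (\<lambda>_. 0) u" "u a = axis j 1"
    by (rule lin_sol_exists[OF K a_le_b, of "\<lambda>_. 0" 0 "axis j 1"]) auto
  let ?R = "\<lambda>p. sl_sol a b P Q W lam (fst p) (snd p) \<and>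
      (\<forall>k. fst p a $ k = (if j = Inl k then 1 else 0) \<and> snd p a $ k = (if j = Inr k then 1 else 0))"
  have "?R (\<lambda>t. upper (u t), \<lambda>t. lower (u t))"
    using u by (simp add: sl_sol_iff_lin_sol axis_def eq_commute)
  then have R: "?R (fund_sol a b P Q W lam j)"
    unfolding fund_sol_def by (rule someI)
  then show "lin_sol a b (sys lam) (\<lambda>_. 0) (phi lam j)"
    unfolding sl_sol_iff_lin_sol[symmetric] phi_def by simp
  from R show "phi lam j a = axis j 1"
    by (auto simp: vec_eq_sum_type_iff phi_def axis_def eq_commute)
qed

text \<open>The solution with Cauchy data \<open>v\<close> at \<open>a\<close>. As a combination of
  the \<open>phi\<close> it is linear in \<open>v\<close> at every \<open>t\<close>, also outside
  \<open>{a..b}\<close>, where uniqueness gives nothing.\<close>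

definition sol :: "complex \<Rightarrow> complex^('n + 'n) \<Rightarrow> real \<Rightarrow> complex^('n + 'n)" where
  "sol lam v t = (\<Sum>j\<in>UNIV. v $ j *s phi lam j t)"

lemma sol: "lin_sol a b (sys lam) (\<lambda>_. 0) (sol lam v)" "sol lam v a = v"
proof -
  have "lin_sol a b (sys lam) (\<lambda>t. \<Sum>j\<in>UNIV. v $ j *s 0) (\<lambda>t. \<Sum>j\<in>UNIV. v $ j *s phi lam j t)"
    by (rule lin_sol_sum) (auto simp: phi)
  then show "lin_sol a b (sys lam) (\<lambda>_. 0) (sol lam v)" by (simp add: sol_def[abs_def])
  show "sol lam v a = v" by (simp add: sol_def phi basis_expansion)
qed

lemma sol_unique:
  assumes "lin_sol a b (sys lam) (\<lambda>_. 0) u" "t \<in> {a..b}"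
  shows "u t = sol lam (u a) t"
proof -
  obtain K where "lin_coeff a b (sys lam) K" using lin_coeff_sys_pencil by blast
  from lin_sol_unique[OF this assms(1) sol(1) _ assms(2)] show ?thesis by (simp add: sol(2))
qed

lemma sol_sum: "sol lam (\<Sum>f\<in>F. c f *s g f) t = (\<Sum>f\<in>F. c f *s sol lam (g f) t)"
  unfolding sol_def
  by (simp add: vec.scale_sum_left vec.scale_sum_right vector_smult_assoc) (rule sum.swap)

section \<open>The characteristic matrix, its kernel and its derivative\<close>

definition chmat :: "complex \<Rightarrow> complex^('n + 'n)^('n + 'n)" where
  "chmat lam = A ** Phi_mat a b P Q W lam + B ** Psi_mat a b P Q W lam"

lemma chmat_nth: "chmat lam $ i $ j = bdry (phi lam j a) (phi lam j b) $ i"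
proof -
  have "chmat lam $ i $ j =
     (A *v bvec_neg a b (fst (fund_sol a b P Q W lam j)) + B *v bvec a b (snd (fund_sol a b P Q W lam j))) $ i"
    by (simp add: chmat_def Phi_mat_def Psi_mat_def matrix_matrix_mult_def matrix_vector_mult_def)
  then show ?thesis using bdry_eq[of "phi lam j"] by (simp add: phi_def del: vector_add_component)
qed

text \<open>The matrix measures by how much the solution with data \<open>v\<close> misses the
  boundary condition, so its kernel consists of the Cauchy data of eigenfunctions, together with
  0.\<close>

lemma chmat_mult: "chmat lam *v v = bdry (sol lam v a) (sol lam v b)"
proof -
  have "(chmat lam *v v) $ i = (\<Sum>j\<in>UNIV. v $ j *s bdry (phi lam j a) (phi lam j b)) $ i" for i
    by (simp add: matrix_vector_mult_def chmat_nth mult.commute)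
  then show ?thesis unfolding sol_def bdry_sum by (simp add: vec_eq_iff)
qed

lemma Gamma_char_eq: "Gamma_char a b P Q W A B = (\<lambda>lam. det (chmat lam))"
  unfolding Gamma_char_def[abs_def] chmat_def ..

text \<open>Formal differentiation of the system in \<open>lam\<close> yields this forcing; the
  initial value is 0 because the data of \<open>phi\<close> at \<open>a\<close> do not depend on
  \<open>lam\<close>.\<close>

lemma variation_exists:
  "\<exists>w. \<forall>j. lin_sol a b (sys lam) (\<lambda>t. sys1 W t *v phi lam j t) (w j) \<and> w j a = 0"
proof -
  obtain K where K: "lin_coeff a b (sys lam) K" using lin_coeff_sys_pencil by blast
  obtain K1 where K1: "lin_coeff a b (sys1 W) K1" using lin_coeff_sys by blast
  have "\<exists>w. lin_sol a b (sys lam) (\<lambda>t. sys1 W t *v phi lam j t) w \<and> w a = 0" for j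
  proof -
    have c: "continuous_on {a..b} (phi lam j)" by (rule lin_sol_continuous[OF phi(1)])
    obtain C where C: "\<And>t. t \<in> {a..b} \<Longrightarrow> norm (phi lam j t) \<le> C"
      using continuous_bounded_on_interval[OF c] by blast
    have "AE t in lebesgue_on {a..b}. norm (sys1 W t *v phi lam j t) \<le> K1 * C"
      by (rule lin_coeff_bound[OF K1 C])
    from lin_sol_exists[OF K a_le_b lin_coeff_measurable[OF K1 c] this, of 0] show ?thesis by blast
  qed
  then show ?thesis by metis
qed

lemma chmat_has_field_derivative:
  assumes "\<And>j. lin_sol a b (sys lam) (\<lambda>t. sys1 W t *v phi lam j t) (w j)" "\<And>j. w j a = 0"
  shows "((\<lambda>z. chmat z $ i $ j) has_field_derivative bdry (w j a) (w j b) $ i) (at lam)"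
proof -
  obtain K0 K1 where K: "lin_coeff a b (sys0 P Q) K0" "lin_coeff a b (sys1 W) K1"
    using lin_coeff_sys by blast
  have "((\<lambda>mu. phi mu j t $ k) has_field_derivative w j t $ k) (at lam)" if "t \<in> {a..b}" for t k
    by (rule lin_sol_pencil_has_field_derivative[OF K a_le_b phi assms that])
  then show ?thesis
    unfolding chmat_nth using a_le_b by (intro bdry_has_field_derivative) auto
qed

text \<open>If the function vanishes, so does its quasi-derivative, and with them the Cauchy data at
  \<open>a\<close>. Statements about eigenfunctions thus become statements about vectors.\<close>

lemma sol_zero:
  assumes "\<And>t. t \<in> {a..b} \<Longrightarrow> upper (sol lam v t) = 0"
  shows "v = 0"
proof -
  have "quasi_pair a b P (\<lambda>t. upper (sol lam v t)) (\<lambda>t. lower (sol lam v t))"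
    using sol(1)[of lam v] unfolding sl_sol_iff_lin_sol[symmetric] sl_sol_def by blast
  then have "lower (sol lam v a) = 0"
    by (rule quasi_pair_zero[OF a_less_b _ assms]) (use a_le_b in auto)
  moreover have "upper (sol lam v a) = 0" using assms a_le_b by simp
  ultimately have "join (upper v) (lower v) = join 0 0" by (simp add: sol)
  then show ?thesis by (simp add: vec_eq_sum_type_iff)
qed

lemma sol_eigen:
  assumes "chmat lam *v v = 0"
  shows "sl_sol a b P Q W lam (\<lambda>t. upper (sol lam v t)) (\<lambda>t. lower (sol lam v t))"
    "A *v bvec_neg a b (\<lambda>t. upper (sol lam v t)) + B *v bvec a b (\<lambda>t. lower (sol lam v t)) = 0"
  using assms unfolding sl_sol_iff_lin_sol bdry_eq chmat_mult by (simp_all add: sol)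

lemma zero_order_Gamma:
  assumes lam: "cnj lam = lam"
  shows "zero_order (Gamma_char a b P Q W A B) lam (vec.dim {v. chmat lam *v v = 0})"
proof -
  obtain w where w: "\<And>j. lin_sol a b (sys lam) (\<lambda>t. sys1 W t *v phi lam j t) (w j)" "\<And>j. w j a = 0"
    using variation_exists[of lam] by blast
  define D' where "D' = (\<chi> i j. bdry (w j a) (w j b) $ i)"
  have "zero_order (\<lambda>lam. det (chmat lam)) lam (vec.dim {v. chmat lam *v v = 0})"
  proof (rule zero_order_det_eq_dim_kernel[where D' = D'])
    fix i j
    \<comment> \<open>Holomorphy on the whole plane needs a derivative at every \<open>z\<close>,
      hence a separate variation system for each.\<close>
    have "\<exists>D. ((\<lambda>z. chmat z $ i $ j) has_field_derivative D) (at z)" for z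
      using variation_exists[of z] chmat_has_field_derivative[of z] by blast
    then show "(\<lambda>z. chmat z $ i $ j) holomorphic_on UNIV"
      by (simp add: holomorphic_on_def field_differentiable_def)
    show "((\<lambda>z. chmat z $ i $ j) has_field_derivative D' $ i $ j) (at lam)"
      unfolding D'_def by (simp add: chmat_has_field_derivative[OF w])
  next
    fix u v assume u: "chmat lam *v u = 0" and uv: "D' *v u + chmat lam *v v = 0"
    \<comment> \<open>\<open>wu\<close> is the \<lambda>-derivative of the solution with data
      \<open>u\<close>. Adding the homogeneous solution with data \<open>v\<close> gives
      \<open>Y\<close>, whose boundary expression is \<open>D' *v u + chmat lam *v v = 0\<close>;
      with \<open>sol lam u\<close> it forms the chain that Green's formula excludes.\<close>
    define wu where "wu = (\<lambda>t. \<Sum>j\<in>UNIV. u $ j *s w j t)"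
    define Y where "Y = (\<lambda>t. wu t + 1 *s sol lam v t)"
    have "lin_sol a b (sys lam) (\<lambda>t. \<Sum>j\<in>UNIV. u $ j *s (sys1 W t *v phi lam j t)) wu"
      unfolding wu_def by (rule lin_sol_sum) (auto simp: w)
    moreover have "(\<Sum>j\<in>UNIV. u $ j *s (sys1 W t *v phi lam j t)) = sys1 W t *v sol lam u t" for t
      unfolding sol_def by (simp add: vec.sum vec.scale)
    ultimately have "lin_sol a b (sys lam) (\<lambda>t. sys1 W t *v sol lam u t) wu" by simp
    then have "lin_sol a b (sys lam) (\<lambda>t. sys1 W t *v sol lam u t + 1 *s 0) Y"
      unfolding Y_def by (intro lin_sol_add_smult sol)
    then have "lin_sol a b (sys lam) (\<lambda>t. join 0 (- (cmat (W t) *v upper (sol lam u t)))) Y"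
      by (simp add: sys1_mult)
    then have Y: "sl_inhom a b P Q (\<lambda>t. lam *s (cmat (W t) *v upper (Y t)) + cmat (W t) *v upper (sol lam u t))
        (\<lambda>t. upper (Y t)) (\<lambda>t. lower (Y t))"
      unfolding lin_sol_pencil_iff .
    have "D' *v u = bdry (wu a) (wu b)"
    proof -
      have "(D' *v u) $ i = (\<Sum>j\<in>UNIV. u $ j *s bdry (w j a) (w j b)) $ i" for i
        by (simp add: matrix_vector_mult_def D'_def mult.commute)
      then show ?thesis unfolding wu_def bdry_sum by (simp add: vec_eq_iff)
    qed
    then have "bdry (Y a) (Y b) = 0"
      using uv unfolding Y_def chmat_mult by (simp add: bdry_add)
    then have bcY: "A *v bvec_neg a b (\<lambda>t. upper (Y t)) + B *v bvec a b (\<lambda>t. lower (Y t)) = 0"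
      unfolding bdry_eq .
    show "u = 0"
      by (rule sol_zero) (rule no_jordan_chain[OF lam Y bcY sol_eigen[OF u]])
  qed
  then show ?thesis unfolding Gamma_char_eq .
qed

text \<open>The map from kernel vectors to eigenfunctions is bijective only modulo null sets and
  values outside \<open>{a..b}\<close>, so the two inequalities are separate: Cauchy data carry
  independent eigenfunctions to independent vectors, and a kernel basis yields independent
  eigenfunctions.\<close>

lemma dim_eigenspace:
  "dim_L2 a b (eigenspace_T a b P Q W A B lam) = enat (vec.dim {v. chmat lam *v v = 0})"
  (is "dim_L2 a b ?E = enat (vec.dim ?S)")
proof (rule antisym)
  show "dim_L2 a b ?E \<le> enat (vec.dim ?S)"
    unfolding dim_L2_def
  proof (rule SUP_least)
    fix F assume "F \<in> {F. F \<subseteq> ?E \<and> lin_indep_L2 a b F}"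
    then have F: "F \<subseteq> ?E" "finite F"
      and ind: "\<And>c f. \<lbrakk>AE t in lebesgue_on {a..b}. (\<Sum>f\<in>F. c f *s f t) = 0; f \<in> F\<rbrakk> \<Longrightarrow> c f = 0"
      unfolding lin_indep_L2_def by auto
    have "\<exists>v. chmat lam *v v = 0 \<and> (\<forall>t\<in>{a..b}. f t = upper (sol lam v t))" if fF: "f \<in> F" for f
    proof -
      obtain f1 where f1: "sl_sol a b P Q W lam f f1" "A *v bvec_neg a b f + B *v bvec a b f1 = 0"
        using F(1) fF unfolding eigenspace_T_def T_graph_eigen_iff by blast
      define u where "u = (\<lambda>t. join (f t) (f1 t))"
      have u: "lin_sol a b (sys lam) (\<lambda>_. 0) u"
        using f1(1) unfolding sl_sol_iff_lin_sol[symmetric] u_def by simp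
      have ut: "u t = sol lam (u a) t" if "t \<in> {a..b}" for t by (rule sol_unique[OF u that])
      have "bdry (u a) (u b) = 0" using f1(2) bdry_eq[of u] unfolding u_def by simp
      then have "chmat lam *v u a = 0" unfolding chmat_mult using ut[of a] ut[of b] a_le_b by simp
      moreover have "f t = upper (sol lam (u a) t)" if "t \<in> {a..b}" for t
        using ut[OF that] unfolding u_def by (metis upper_lower_join(1))
      ultimately show ?thesis by blast
    qed
    then obtain g where g: "\<And>f. f \<in> F \<Longrightarrow> chmat lam *v g f = 0"
      "\<And>f t. f \<in> F \<Longrightarrow> t \<in> {a..b} \<Longrightarrow> f t = upper (sol lam (g f) t)"
      by metis
    have "card F \<le> vec.dim ?S"
    proof (rule card_le_dim_of_independent_family[OF F(2)])
      show "g ` F \<subseteq> ?S" using g(1) by blast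
      fix c f assume c: "(\<Sum>f\<in>F. c f *s g f) = 0" and "f \<in> F"
      have "(\<Sum>f\<in>F. c f *s f t) = 0" if "t \<in> {a..b}" for t
      proof -
        have "(\<Sum>f\<in>F. c f *s f t) = upper (\<Sum>f\<in>F. c f *s sol lam (g f) t)"
          unfolding upper_lower_linear by (rule sum.cong) (use g(2) that in auto)
        also have "\<dots> = upper (sol lam 0 t)" unfolding sol_sum[symmetric] c ..
        also have "\<dots> = 0" by (simp add: sol_def vec_eq_iff)
        finally show ?thesis .
      qed
      then have "AE t in lebesgue_on {a..b}. (\<Sum>f\<in>F. c f *s f t) = 0"
        unfolding AE_lebesgue_on_interval_iff by (intro exI[of _ "{}"]) auto
      then show "c f = 0" by (rule ind) fact
    qed
    then show "enat (card F) \<le> enat (vec.dim ?S)" by simp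
  qed
  obtain Bk where Bk: "Bk \<subseteq> ?S" "vec.independent Bk" "?S \<subseteq> vec.span Bk" "card Bk = vec.dim ?S"
    by (rule vec.basis_exists)
  have fin: "finite Bk" by (rule vec.finiteI_independent[OF Bk(2)])
  define h where "h = (\<lambda>v t. upper (sol lam v t))"
  have h_sum: "(\<Sum>v\<in>V. c v *s h v t) = h (\<Sum>v\<in>V. c v *s v) t" for V c t
    unfolding h_def sol_sum upper_lower_linear ..
  have h_cont: "continuous_on {a..b} (h v)" for v
    unfolding h_def
    by (rule bounded_linear.continuous_on[OF bounded_linear_blocks(1) lin_sol_continuous[OF sol(1)]])
  have h_zero: "v = 0" if "AE t in lebesgue_on {a..b}. h v t = 0" for v
  proof (rule sol_zero)
    show "upper (sol lam v t) = 0" if "t \<in> {a..b}" for t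
      using continuous_AE_zero[OF a_less_b h_cont \<open>AE t in lebesgue_on {a..b}. h v t = 0\<close> that]
      unfolding h_def .
  qed
  \<comment> \<open>\<open>dim_L2\<close> counts a set of functions, so distinct basis vectors must
    give distinct functions.\<close>
  have inj: "inj_on h Bk"
  proof (rule inj_onI)
    fix v v' assume "h v = h v'"
    have "h (v - v') t = h v t - h v' t" for t
      unfolding h_def sol_def by (simp add: vec_eq_iff algebra_simps sum_subtractf)
    then have "v - v' = 0" by (intro h_zero) (simp add: \<open>h v = h v'\<close>)
    then show "v = v'" by simp
  qed
  have "lin_indep_L2 a b (h ` Bk)"
    unfolding lin_indep_L2_def
  proof (intro conjI allI impI ballI)
    show "finite (h ` Bk)" using fin by simp
    fix c f assume "AE t in lebesgue_on {a..b}. (\<Sum>f\<in>h ` Bk. c f *s f t) = 0" and "f \<in> h ` Bk"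
    then obtain v where v: "v \<in> Bk" "f = h v" by blast
    have "(\<Sum>f\<in>h ` Bk. c f *s f t) = h (\<Sum>v\<in>Bk. c (h v) *s v) t" for t
      unfolding h_sum[symmetric] by (simp add: sum.reindex[OF inj])
    then have sum0: "(\<Sum>v\<in>Bk. c (h v) *s v) = 0"
      using \<open>AE t in lebesgue_on {a..b}. (\<Sum>f\<in>h ` Bk. c f *s f t) = 0\<close> by (intro h_zero) simp
    have "r v = 0" if "(\<Sum>v\<in>Bk. r v *s v) = 0" for r
      using that v(1) Bk(2) unfolding vec.dependent_finite[OF fin] by blast
    from this[OF sum0] show "c f = 0" unfolding v(2) .
  qed
  moreover have "h ` Bk \<subseteq> ?E"
    using Bk(1) sol_eigen unfolding eigenspace_T_def T_graph_eigen_iff h_def by blast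
  moreover have "card (h ` Bk) = vec.dim ?S" using card_image[OF inj] Bk(4) by simp
  ultimately show "enat (vec.dim ?S) \<le> dim_L2 a b ?E"
    unfolding dim_L2_def by (intro SUP_upper2[of "h ` Bk"]) auto
qed

end

theorem theorem5p1:
  fixes a b :: real
    and P Q W :: "real \<Rightarrow> real^'n::finite^'n"
    and A B :: "complex^('n+'n)^('n+'n)"
    and lam :: complex
  assumes "CARD('n) \<ge> 2"
    and "a < b"
    and "Omega a b P Q W"
    and "sa_bc A B"
    and "is_eigenvalue a b P Q W A B lam"
  shows "\<exists>m::nat. zero_order (Gamma_char a b P Q W A B) lam m \<and>
           dim_L2 a b (eigenspace_T a b P Q W A B lam) = enat m \<and>
           dim_L2 a b (root_space_T a b P Q W A B lam) = enat m"
proof -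
  interpret sl_problem a b P Q W A B
    using assms by unfold_locales
  have lam: "cnj lam = lam" by (rule eigenvalue_real[OF assms(5)])
  \<comment> \<open>The common value of the three multiplicities is
    \<open>vec.dim {v. chmat lam *v v = 0}\<close>.\<close>
  show ?thesis
    using zero_order_Gamma[OF lam] dim_eigenspace[of lam] root_space_eq_eigenspace[OF lam] by auto
qed

end
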